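(* Consider the \textsc{Top}-$k$ problem in the noisy comparison model. Fix a set $X$ of $n$ elements with values $v_1\ge\cdots\ge v_n$ and an integer $k$; let $\lambda$ be the number of elements with value strictly greater than $v_k$, $\kappa$ the number with value equal to $v_k$, and $s=\lambda+\kappa-k$. There is an algorithm ($\mathbf{Oblivious\text{-}Top}(X,k)$), with no prior knowledge of the values of $X$, which returns the \textsc{Top}-$k$ elements of $X$ with correctness probability at least $2/3$, has expected query complexity $O\left(n\log\left(\lambda+\frac{\kappa}{s+1}\right)+k^3\right)$, and has expected round complexity $O\left(\log\log\left(\lambda+\frac{\kappa}{s+1}\right)\cdot\log^*_{\lambda+\kappa/(s+1)}(n)\right)$.
   Context: \textsc{Top}-$k$ problem: output a set of $k$ elements such that no element outside the set has a value strictly larger than an element in the set. Noisy comparison model: queries ``is the value of $x$ at least the value of $y$?'' are answered correctly with probability $2/3$ and arbitrarily (adversarially) otherwise. Round complexity: number of batches of queries, each batch depending only on answers to previous batches. For $b>1$, $\log_b^*(n)$ is the least $i$ with $a_i\le0$ for $a_0=n$, $a_{j+1}=\log_b a_j$.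
   Formalization: In the bounds λ+κ/(s+1) is read as at least 2 and loglog(λ+κ/(s+1)) as at least 1, since for k=1 the quantity is 1, making the literal query bound O(1) (false) and log*_1 undefined; also 1≤k≤n is assumed. *)

theory Defs
  imports "HOL-Probability.Probability"
begin

text \<open>
  Elements are labelled by natural numbers. A query \<open>(x, y)\<close> asks whether the value of \<open>x\<close> is at
  least the value of \<open>y\<close>. A batch is a list of queries: repeated queries are allowed and receive
  independent noise.
\<close>

type_synonym query = "nat \<times> nat"
type_synonym transcript = "(query list \<times> bool list) list"

text \<open>
  A randomized adaptive strategy is a possibly infinite decision tree: on receiving the answers to
  a batch, it uses fresh private coins to pick the subtree to continue with.
\<close>

codatatype strategy =
    Output "nat set"
  | Query "query list" "bool list \<Rightarrow> strategy pmf"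

coinductive queries_within :: "nat set \<Rightarrow> strategy \<Rightarrow> bool" for X where
  "queries_within X (Output S)"
| "set qs \<subseteq> X \<times> X \<Longrightarrow>
   (\<And>as a. length as = length qs \<Longrightarrow> a \<in> set_pmf (c as) \<Longrightarrow> queries_within X a) \<Longrightarrow>
   queries_within X (Query qs c)"

text \<open>
  The adversary is adaptive. It sees the earlier batches with their answers, the current batch, and
  which positions of the batch are answered truthfully (flag \<open>True\<close>); it chooses the answers at the
  other positions.
\<close>

type_synonym adversary = "transcript \<Rightarrow> query list \<Rightarrow> bool list \<Rightarrow> nat \<Rightarrow> bool"

definition noisy_answers ::
    "(nat \<Rightarrow> real) \<Rightarrow> adversary \<Rightarrow> transcript \<Rightarrow> query list \<Rightarrow> bool list pmf" where
  "noisy_answers v adv h qs =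
     map_pmf
       (\<lambda>ok. map (\<lambda>i. if ok ! i then v (fst (qs ! i)) \<ge> v (snd (qs ! i)) else adv h qs ok i)
                 [0..<length qs])
       (replicate_pmf (length qs) (bernoulli_pmf (2/3)))"

text \<open>
  Execution cut off after \<open>t\<close> rounds: the output (\<open>None\<close> if the strategy has not halted), the number
  of queries asked, and the number of rounds used.
\<close>

primrec run ::
    "(nat \<Rightarrow> real) \<Rightarrow> adversary \<Rightarrow> nat \<Rightarrow> transcript \<Rightarrow> strategy
      \<Rightarrow> (nat set option \<times> nat \<times> nat) pmf" where
  "run v adv 0 h a =
     (case a of
        Output S \<Rightarrow> return_pmf (Some S, 0, 0)
      | Query qs c \<Rightarrow> return_pmf (None, 0, 0))"
| "run v adv (Suc t) h a =
     (case a of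
        Output S \<Rightarrow> return_pmf (Some S, 0, 0)
      | Query qs c \<Rightarrow>
          bind_pmf (noisy_answers v adv h qs) (\<lambda>as.
          bind_pmf (c as) (\<lambda>a'.
          map_pmf (\<lambda>(res, q, r). (res, q + length qs, r + 1))
            (run v adv t (h @ [(qs, as)]) a'))))"

definition execution ::
    "(nat \<Rightarrow> real) \<Rightarrow> adversary \<Rightarrow> nat \<Rightarrow> strategy pmf \<Rightarrow> (nat set option \<times> nat \<times> nat) pmf" where
  "execution v adv t A = bind_pmf A (run v adv t [])"

text \<open>
  The three quantities below increase with the cut-off \<open>t\<close>, so by continuity of measure and monotone
  convergence the suprema are the probability and the expectations for the complete execution.
  An execution that never halts counts as a failure and has infinite round complexity.
\<close>

definition success_prob ::
    "(nat \<Rightarrow> real) \<Rightarrow> adversary \<Rightarrow> (nat set \<Rightarrow> bool) \<Rightarrow> strategy pmf \<Rightarrow> real" where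
  "success_prob v adv P A =
     (SUP t. measure_pmf.prob (execution v adv t A) {(Some S, q, r) | S q r. P S})"

definition expected_queries ::
    "(nat \<Rightarrow> real) \<Rightarrow> adversary \<Rightarrow> strategy pmf \<Rightarrow> ennreal" where
  "expected_queries v adv A =
     (SUP t. \<integral>\<^sup>+ (res, q, r). of_nat q \<partial>measure_pmf (execution v adv t A))"

definition expected_rounds ::
    "(nat \<Rightarrow> real) \<Rightarrow> adversary \<Rightarrow> strategy pmf \<Rightarrow> ennreal" where
  "expected_rounds v adv A =
     (SUP t. \<integral>\<^sup>+ (res, q, r). of_nat r \<partial>measure_pmf (execution v adv t A))"

definition is_top :: "nat set \<Rightarrow> (nat \<Rightarrow> real) \<Rightarrow> nat \<Rightarrow> nat set \<Rightarrow> bool" where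
  "is_top X v k S \<longleftrightarrow> S \<subseteq> X \<and> card S = k \<and> (\<forall>x\<in>X - S. \<forall>y\<in>S. \<not> v x > v y)"

text \<open>
  The value \<open>v\<^sub>k\<close> in the non-increasing enumeration \<open>v\<^sub>1 \<ge> \<dots> \<ge> v\<^sub>n\<close>, with multiplicity, of the
  values of the elements of \<open>X\<close>.
\<close>

definition kth_value :: "nat set \<Rightarrow> (nat \<Rightarrow> real) \<Rightarrow> nat \<Rightarrow> real" where
  "kth_value X v k = rev (sorted_list_of_multiset (image_mset v (mset_set X))) ! (k - 1)"

definition num_above :: "nat set \<Rightarrow> (nat \<Rightarrow> real) \<Rightarrow> nat \<Rightarrow> nat" where
  "num_above X v k = card {x\<in>X. v x > kth_value X v k}"

definition num_tied :: "nat set \<Rightarrow> (nat \<Rightarrow> real) \<Rightarrow> nat \<Rightarrow> nat" where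
  "num_tied X v k = card {x\<in>X. v x = kth_value X v k}"

definition slack :: "nat set \<Rightarrow> (nat \<Rightarrow> real) \<Rightarrow> nat \<Rightarrow> real" where
  "slack X v k = real (num_above X v k) + real (num_tied X v k) - real k"

text \<open>
  The quantity \<open>\<lambda> + \<kappa> / (s + 1)\<close> lies in \<open>[1, 2)\<close> on some instances (it is \<open>1\<close> whenever \<open>k = 1\<close>).
  There its logarithm tends to \<open>0\<close> and the iterated logarithm to that base need not ever become
  nonpositive, so, as usual inside asymptotic bounds, it is read as being at least \<open>2\<close>.
  For the same reason the double logarithm of it is read as being at least \<open>1\<close>.
\<close>

definition hardness :: "nat set \<Rightarrow> (nat \<Rightarrow> real) \<Rightarrow> nat \<Rightarrow> real" where
  "hardness X v k =
     max 2 (real (num_above X v k) + real (num_tied X v k) / (slack X v k + 1))"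

definition log_star :: "real \<Rightarrow> real \<Rightarrow> nat" where
  "log_star b x = (LEAST i. (log b ^^ i) x \<le> 0)"

end

theory Submission
  imports Defs
begin

text \<open>
  Breaking ties by label turns each comparison into a single query for a strict total order.
  Majority votes over \<open>12 u\<close> repetitions err with probability at most \<open>2\<^sup>-\<^sup>u\<close>, whatever
  the adversary does; everything else is union bounds and Markov's inequality.

  The unknown hardness \<open>H\<close> is guessed as \<open>2\<close> to the power \<open>2\<^sup>i\<close> for \<open>i = 0, 1, \<dots>\<close>. In one
  guess, the maximum of a random sample of density about \<open>1 / k\<close> is a pivot whose rank is
  of order \<open>k\<close> (but at least \<open>2 k\<close>). All elements are compared with the pivot; survivors are
  compared again with exponentially more repetitions, so that an iterated-logarithmic number of
  rounds at cost \<open>O(n 2\<^sup>i)\<close> removes everything below the pivot. Each element above it is lost with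
  probability below \<open>1 / (100 H)\<close>, hence all \<open>\<lambda>\<close> elements above \<open>v\<^sub>k\<close> and all but \<open>s\<close> of the tied
  ones survive. Comparing all pairs of survivors yields a candidate set \<open>S\<close>. The same filtering,
  now against the minimum of \<open>S\<close>, looks for an element of \<open>X - S\<close> that should have been in \<open>S\<close>;
  if one seems to exist, the next guess is tried. A guess that is large enough fails with
  probability at most \<open>1 / 8\<close> while its cost only doubles, so the expected total cost is
  dominated by the first sufficient guess. If \<open>k\<close> is nearly linear in \<open>n\<close>, then \<open>k\<^sup>3\<close> queries
  suffice to compare all pairs.
\<close>

section \<open>Strategies as programs\<close>

text \<open>The quantity \<lambda> + \<kappa> / (s + 1) is what Markov's inequality asks for: if
  each element is lost with probability \<delta>, then losing one of the \<lambda> elements above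
  v_k, or s + 1 of the \<lambda> + \<kappa> elements at or above v_k, has probability at most
  \<delta> times this quantity. Hence O(log H) repetitions suffice, whereas a union bound over all
  of \<open>X\<close> would cost log n. Since H is unknown, acceptance has to be one-sided:
  accepting a wrong set is unlikely for every guess, while only sufficient guesses are likely to be
  accepted. As H is at most max 2 k, a number of guesses fixed in advance is enough. Within a guess
  the query and round bounds hold on every path, so only the number of guesses is random. In the
  filtering, two rounds raise the number of repetitions by a full exponential, which gives the
  iterated logarithm. Early guesses start with weaker tests and need longer schedules, but only
  about log i0 of the guesses before the first sufficient one, i0, are noticeably longer, so the
  total stays of the order of i0 + 1 times the iterated logarithm.\<close>

datatype 'a prog =
    Ret 'a
  | Ask "query list" "bool list \<Rightarrow> 'a prog"
  | Flip "nat list pmf" "nat list \<Rightarrow> 'a prog"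

primrec bind_prog :: "'a prog \<Rightarrow> ('a \<Rightarrow> 'b prog) \<Rightarrow> 'b prog" where
  "bind_prog (Ret x) f = f x"
| "bind_prog (Ask qs c) f = Ask qs (\<lambda>as. bind_prog (c as) f)"
| "bind_prog (Flip D c) f = Flip D (\<lambda>R. bind_prog (c R) f)"

text \<open>Programs form an inductive type, so the analysis can go by structural induction; the
  codatatype \<open>strategy\<close> is only the target. Passing the result to a continuation lets
  guesses be chained there, and successive coin flips merge into the distribution that selects the
  next node.\<close>

primrec to_strategy :: "'a prog \<Rightarrow> ('a \<Rightarrow> strategy pmf) \<Rightarrow> strategy pmf" where
  "to_strategy (Ret x) f = f x"
| "to_strategy (Ask qs c) f = return_pmf (Query qs (\<lambda>as. to_strategy (c as) f))"
| "to_strategy (Flip D c) f = bind_pmf D (\<lambda>R. to_strategy (c R) f)"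

text \<open>\<open>Q\<close> and \<open>R\<close> bound queries and rounds on every branch, over all
  conceivable answer lists, and \<open>I\<close> holds for every result. Within a program the cost
  bound is thus never random.\<close>

primrec safe :: "nat set \<Rightarrow> 'a prog \<Rightarrow> nat \<Rightarrow> nat \<Rightarrow> ('a \<Rightarrow> bool) \<Rightarrow> bool" where
  "safe X (Ret x) = (\<lambda>Q R I. I x)"
| "safe X (Ask qs c) = (\<lambda>Q R I. set qs \<subseteq> X \<times> X \<and> length qs \<le> Q \<and> 1 \<le> R \<and>
     (\<forall>as. safe X (c as) (Q - length qs) (R - 1) I))"
| "safe X (Flip D c) = (\<lambda>Q R I. \<forall>L\<in>set_pmf D. safe X (c L) Q R I)"

text \<open>
  The supremum over transcripts makes the expectation independent of the history, so that it
  composes along \<open>bind_prog\<close>.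
\<close>

primrec wp :: "(nat \<Rightarrow> real) \<Rightarrow> adversary \<Rightarrow> 'a prog \<Rightarrow> ('a \<Rightarrow> ennreal) \<Rightarrow> ennreal" where
  "wp v adv (Ret x) = (\<lambda>\<phi>. \<phi> x)"
| "wp v adv (Ask qs c) =
     (\<lambda>\<phi>. SUP h. \<integral>\<^sup>+ as. wp v adv (c as) \<phi> \<partial>measure_pmf (noisy_answers v adv h qs))"
| "wp v adv (Flip D c) = (\<lambda>\<phi>. \<integral>\<^sup>+ R. wp v adv (c R) \<phi> \<partial>measure_pmf D)"

section \<open>Budgets and worst-case expectations\<close>

lemma safe_mono:
  assumes "safe X p Q R I" "Q \<le> Q'" "R \<le> R'" "\<And>x. I x \<Longrightarrow> J x"
  shows "safe X p Q' R' J"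
  using assms
proof (induction p arbitrary: Q R Q' R')
  case (Ask qs c)
  have "safe X (c as) (Q' - length qs) (R' - 1) J" for as
    using Ask.IH[of "c as" "Q - length qs" "R - 1"] Ask.prems by (auto simp: diff_le_mono)
  then show ?case using Ask.prems by auto
qed auto

lemma safe_bind:
  assumes "safe X p Q1 R1 I" "\<And>x. I x \<Longrightarrow> safe X (f x) Q2 R2 J"
    and "Q1 + Q2 \<le> Q" "R1 + R2 \<le> R"
  shows "safe X (bind_prog p f) Q R J"
  using assms(1,3,4)
proof (induction p arbitrary: Q1 R1 Q R)
  case (Ret x)
  then have "safe X (f x) Q2 R2 J" using assms(2) by simp
  then have "safe X (f x) Q R J" by (rule safe_mono) (use Ret in auto)
  then show ?case by simp
next
  case (Ask qs c)
  have "safe X (bind_prog (c as) f) (Q - length qs) (R - 1) J" for as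
    by (rule Ask.IH[of _ "Q1 - length qs" "R1 - 1"]) (use Ask.prems in auto)
  then show ?case using Ask.prems by auto
next
  case (Flip D c)
  show ?case
    using Flip.IH[of _ Q1 R1 Q R] Flip.prems by auto
qed

lemma wp_bind: "wp v adv (bind_prog p f) \<phi> = wp v adv p (\<lambda>x. wp v adv (f x) \<phi>)"
  by (induction p) auto

text \<open>This rule feeds sure facts into the estimates, such as the cap on the number of
  survivors or the membership of the pivot in the sample.\<close>

lemma wp_mono_safe:
  assumes "safe X p Q R I" "\<And>x. I x \<Longrightarrow> \<phi> x \<le> \<psi> x"
  shows "wp v adv p \<phi> \<le> wp v adv p \<psi>"
  using assms(1)
proof (induction p arbitrary: Q R)
  case (Ret x)
  then show ?case using assms(2) by simp
next
  case (Ask qs c)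
  then have "wp v adv (c as) \<phi> \<le> wp v adv (c as) \<psi>" for as
    using Ask.IH[of "c as" "Q - length qs" "R - 1"] by auto
  then show ?case by (auto intro!: SUP_mono' nn_integral_mono)
next
  case (Flip D c)
  then have "wp v adv (c L) \<phi> \<le> wp v adv (c L) \<psi>" if "L \<in> set_pmf D" for L
    using Flip.IH[of "c L" Q R] that by auto
  then show ?case
    by (auto intro!: nn_integral_mono_AE simp: AE_measure_pmf_iff)
qed

lemma wp_mono:
  assumes "\<And>x. \<phi> x \<le> \<psi> x"
  shows "wp v adv p \<phi> \<le> wp v adv p \<psi>"
  by (induction p) (auto intro!: SUP_mono' nn_integral_mono assms)

lemma wp_const: "wp v adv p (\<lambda>_. c) = c"
  by (induction p) auto

lemma wp_le_const:
  assumes "\<And>x. \<phi> x \<le> c"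
  shows "wp v adv p \<phi> \<le> c"
  using wp_mono[of \<phi> "\<lambda>_. c" v adv p] assms by (simp add: wp_const)

text \<open>A supremum of sums is at most the sum of the suprema, so \<open>wp\<close> is a
  sublinear expectation. Inequalities for sums and multiples are all that union bounds and Markov's
  inequality need.\<close>

lemma wp_add: "wp v adv p (\<lambda>x. \<phi> x + \<psi> x) \<le> wp v adv p \<phi> + wp v adv p \<psi>"
proof (induction p)
  case (Ask qs c)
  have "(\<integral>\<^sup>+ as. wp v adv (c as) (\<lambda>x. \<phi> x + \<psi> x) \<partial>measure_pmf (noisy_answers v adv h qs))
    \<le> wp v adv (Ask qs c) \<phi> + wp v adv (Ask qs c) \<psi>" for h
  proof -
    have "(\<integral>\<^sup>+ as. wp v adv (c as) (\<lambda>x. \<phi> x + \<psi> x) \<partial>measure_pmf (noisy_answers v adv h qs))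
      \<le> (\<integral>\<^sup>+ as. wp v adv (c as) \<phi> + wp v adv (c as) \<psi> \<partial>measure_pmf (noisy_answers v adv h qs))"
      by (intro nn_integral_mono Ask.IH) simp
    also have "\<dots> = (\<integral>\<^sup>+ as. wp v adv (c as) \<phi> \<partial>measure_pmf (noisy_answers v adv h qs))
        + (\<integral>\<^sup>+ as. wp v adv (c as) \<psi> \<partial>measure_pmf (noisy_answers v adv h qs))"
      by (rule nn_integral_add) auto
    also have "\<dots> \<le> wp v adv (Ask qs c) \<phi> + wp v adv (Ask qs c) \<psi>"
      by (auto intro!: add_mono SUP_upper)
    finally show ?thesis .
  qed
  then show ?case by (auto intro!: SUP_least)
next
  case (Flip D c)
  have "wp v adv (Flip D c) (\<lambda>x. \<phi> x + \<psi> x)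
      \<le> (\<integral>\<^sup>+ R. wp v adv (c R) \<phi> + wp v adv (c R) \<psi> \<partial>measure_pmf D)"
    by (auto intro!: nn_integral_mono Flip.IH)
  also have "\<dots> = wp v adv (Flip D c) \<phi> + wp v adv (Flip D c) \<psi>"
    by (auto intro!: nn_integral_add)
  finally show ?case .
qed auto

lemma wp_cmult: "wp v adv p (\<lambda>x. c * \<phi> x) \<le> c * wp v adv p \<phi>"
proof (induction p)
  case (Ask qs f)
  have "(\<integral>\<^sup>+ as. wp v adv (f as) (\<lambda>x. c * \<phi> x) \<partial>measure_pmf (noisy_answers v adv h qs))
    \<le> c * wp v adv (Ask qs f) \<phi>" for h
  proof -
    have "(\<integral>\<^sup>+ as. wp v adv (f as) (\<lambda>x. c * \<phi> x) \<partial>measure_pmf (noisy_answers v adv h qs))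
      \<le> (\<integral>\<^sup>+ as. c * wp v adv (f as) \<phi> \<partial>measure_pmf (noisy_answers v adv h qs))"
      by (intro nn_integral_mono Ask.IH) simp
    also have "\<dots> = c * (\<integral>\<^sup>+ as. wp v adv (f as) \<phi> \<partial>measure_pmf (noisy_answers v adv h qs))"
      by (rule nn_integral_cmult) auto
    also have "\<dots> \<le> c * wp v adv (Ask qs f) \<phi>"
      by (auto intro!: mult_left_mono SUP_upper)
    finally show ?thesis .
  qed
  then show ?case by (auto intro!: SUP_least)
next
  case (Flip D f)
  have "wp v adv (Flip D f) (\<lambda>x. c * \<phi> x) \<le> (\<integral>\<^sup>+ R. c * wp v adv (f R) \<phi> \<partial>measure_pmf D)"
    by (auto intro!: nn_integral_mono Flip.IH)
  then show ?case by (simp add: nn_integral_cmult)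
qed auto

lemma wp_sum:
  assumes "finite A"
  shows "wp v adv p (\<lambda>x. \<Sum>a\<in>A. \<phi> a x) \<le> (\<Sum>a\<in>A. wp v adv p (\<phi> a))"
  using assms
proof (induction A rule: finite_induct)
  case (insert a A)
  have "wp v adv p (\<lambda>x. \<phi> a x + (\<Sum>a\<in>A. \<phi> a x))
      \<le> wp v adv p (\<phi> a) + wp v adv p (\<lambda>x. \<Sum>a\<in>A. \<phi> a x)"
    by (rule wp_add)
  with insert show ?case by (auto intro: order_trans add_left_mono)
qed (simp add: wp_const)

text \<open>
  A run that is cut off also pays the failure penalty \<open>\<eta>\<close>.
\<close>

definition cost_to_go ::
    "(nat \<Rightarrow> real) \<Rightarrow> adversary \<Rightarrow> (nat set \<Rightarrow> bool) \<Rightarrow> ennreal \<Rightarrow> ennreal \<Rightarrow> ennreal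
      \<Rightarrow> nat \<Rightarrow> transcript \<Rightarrow> strategy pmf \<Rightarrow> ennreal" where
  "cost_to_go v adv P \<alpha> \<beta> \<eta> t h A =
     (\<integral>\<^sup>+ (res, q, r). \<alpha> * of_nat q + \<beta> * of_nat r
         + (if \<exists>S. res = Some S \<and> P S then 0 else \<eta>)
       \<partial>measure_pmf (bind_pmf A (run v adv t h)))"

lemma cost_to_go_output:
  "cost_to_go v adv P \<alpha> \<beta> \<eta> t h (return_pmf (Output S)) = (if P S then 0 else \<eta>)"
proof -
  have "run v adv t h (Output S) = return_pmf (Some S, 0, 0)"
    by (cases t) auto
  then show ?thesis by (simp add: cost_to_go_def bind_return_pmf)
qed

lemma cost_to_go_bind:
  "cost_to_go v adv P \<alpha> \<beta> \<eta> t h (bind_pmf D f)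
     = (\<integral>\<^sup>+ x. cost_to_go v adv P \<alpha> \<beta> \<eta> t h (f x) \<partial>measure_pmf D)"
  unfolding cost_to_go_def by (simp add: bind_assoc_pmf nn_integral_bind_pmf)

lemma cost_to_go_query:
  "cost_to_go v adv P \<alpha> \<beta> \<eta> (Suc t) h (return_pmf (Query qs c))
     = \<alpha> * of_nat (length qs) + \<beta>
       + (\<integral>\<^sup>+ as. cost_to_go v adv P \<alpha> \<beta> \<eta> t (h @ [(qs, as)]) (c as)
           \<partial>measure_pmf (noisy_answers v adv h qs))"
proof -
  let ?w = "\<lambda>(res, q, r). \<alpha> * of_nat q + \<beta> * of_nat r
         + (if \<exists>S. res = Some S \<and> P S then 0 else \<eta>)"
  let ?s = "\<lambda>(res :: nat set option, q, r). (res, q + length qs, r + 1)"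
  have w: "?w (?s z) = (\<alpha> * of_nat (length qs) + \<beta>) + ?w z" for z :: "nat set option \<times> nat \<times> nat"
    by (cases z) (simp add: algebra_simps)
  have "cost_to_go v adv P \<alpha> \<beta> \<eta> (Suc t) h (return_pmf (Query qs c))
    = (\<integral>\<^sup>+ as. \<integral>\<^sup>+ a. \<integral>\<^sup>+ z. ?w (?s z) \<partial>measure_pmf (run v adv t (h @ [(qs, as)]) a)
         \<partial>measure_pmf (c as) \<partial>measure_pmf (noisy_answers v adv h qs))"
    unfolding cost_to_go_def by (simp add: bind_return_pmf nn_integral_bind_pmf)
  also have "\<dots> = \<alpha> * of_nat (length qs) + \<beta>
       + (\<integral>\<^sup>+ as. \<integral>\<^sup>+ a. \<integral>\<^sup>+ z. ?w z \<partial>measure_pmf (run v adv t (h @ [(qs, as)]) a)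
         \<partial>measure_pmf (c as) \<partial>measure_pmf (noisy_answers v adv h qs))"
    unfolding w by (simp add: nn_integral_add)
  finally show ?thesis
    unfolding cost_to_go_def by (simp add: nn_integral_bind_pmf)
qed

text \<open>Weights (1, 0, 0), (0, 1, 0) and (0, 0, 1) for \<alpha>, \<beta>, \<eta> turn this one
  estimate into bounds for queries, rounds and failure. Cutting a run short only lowers its cost but
  counts as a failure; hence for nonzero \<eta> the cut-off has to cover the \<open>R\<close> rounds
  of the program and the \<open>t0\<close> rounds of the continuation.\<close>

lemma cost_to_go_to_strategy:
  assumes "safe X p Q R I"
    and "\<And>x t h. I x \<Longrightarrow> \<eta> = 0 \<or> t0 \<le> t \<Longrightarrow> cost_to_go v adv P \<alpha> \<beta> \<eta> t h (f x) \<le> \<phi> x"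
    and "\<eta> = 0 \<or> R + t0 \<le> t"
  shows "cost_to_go v adv P \<alpha> \<beta> \<eta> t h (to_strategy p f)
      \<le> \<alpha> * of_nat Q + \<beta> * of_nat R + wp v adv p \<phi>"
  using assms(1,3)
proof (induction p arbitrary: Q R t h)
  case (Ret x)
  then have "cost_to_go v adv P \<alpha> \<beta> \<eta> t h (f x) \<le> \<phi> x"
    by (intro assms(2)) auto
  then show ?case by (simp add: add_increasing)
next
  case (Ask qs c)
  show ?case
  proof (cases t)
    case 0
    \<comment> \<open>A program that still has to ask has \<open>1 \<le> R\<close>, which excludes
      the other alternative for cut-off 0.\<close>
    then have "\<eta> = 0" using Ask.prems by auto
    with 0 show ?thesis by (simp add: cost_to_go_def bind_return_pmf)
  next
    case (Suc t')
    let ?N = "measure_pmf (noisy_answers v adv h qs)"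
    have le: "cost_to_go v adv P \<alpha> \<beta> \<eta> t' (h @ [(qs, as)]) (to_strategy (c as) f)
        \<le> \<alpha> * of_nat (Q - length qs) + \<beta> * of_nat (R - 1) + wp v adv (c as) \<phi>" for as
      by (rule Ask.IH) (use Ask.prems Suc in auto)
    have "cost_to_go v adv P \<alpha> \<beta> \<eta> t h (to_strategy (Ask qs c) f)
      \<le> \<alpha> * of_nat (length qs) + \<beta>
       + (\<integral>\<^sup>+ as. (\<alpha> * of_nat (Q - length qs) + \<beta> * of_nat (R - 1)) + wp v adv (c as) \<phi> \<partial>?N)"
      unfolding Suc to_strategy.simps cost_to_go_query
      by (intro add_left_mono nn_integral_mono le)
    also have "\<dots> = (\<alpha> * of_nat (length qs) + \<alpha> * of_nat (Q - length qs))
        + (\<beta> * of_nat 1 + \<beta> * of_nat (R - 1)) + (\<integral>\<^sup>+ as. wp v adv (c as) \<phi> \<partial>?N)"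
      by (simp add: nn_integral_add add_ac)
    also have "\<alpha> * of_nat (length qs) + \<alpha> * of_nat (Q - length qs) = \<alpha> * of_nat Q"
      using Ask.prems by (simp flip: distrib_left of_nat_add)
    also have "\<beta> * of_nat 1 + \<beta> * of_nat (R - 1) = \<beta> * of_nat R"
      using Ask.prems by (cases R) (auto simp: distrib_left)
    also have "(\<integral>\<^sup>+ as. wp v adv (c as) \<phi> \<partial>?N) \<le> wp v adv (Ask qs c) \<phi>"
      by (auto intro!: SUP_upper)
    finally show ?thesis by (simp add: add_left_mono)
  qed
next
  case (Flip D c)
  have "cost_to_go v adv P \<alpha> \<beta> \<eta> t h (to_strategy (Flip D c) f)
      \<le> (\<integral>\<^sup>+ L. (\<alpha> * of_nat Q + \<beta> * of_nat R) + wp v adv (c L) \<phi> \<partial>measure_pmf D)"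
    unfolding to_strategy.simps cost_to_go_bind
    by (intro nn_integral_mono_AE) (use Flip in \<open>auto simp: AE_measure_pmf_iff\<close>)
  then show ?case by (simp add: nn_integral_add)
qed

lemma queries_within_to_strategy:
  assumes "safe X p Q R I" "\<And>x a. I x \<Longrightarrow> a \<in> set_pmf (f x) \<Longrightarrow> queries_within X a"
    and "a \<in> set_pmf (to_strategy p f)"
  shows "queries_within X a"
  using assms(1,3)
proof (induction p arbitrary: Q R a)
  case (Ret x)
  then show ?case using assms(2) by simp
next
  case (Ask qs c)
  then have [simp]: "a = Query qs (\<lambda>as. to_strategy (c as) f)" by simp
  show ?case unfolding \<open>a = _\<close>
  proof (rule queries_within.intros)
    show "set qs \<subseteq> X \<times> X" using Ask.prems by simp
    show "queries_within X a'" if "a' \<in> set_pmf (to_strategy (c as) f)" for as a'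
      by (rule Ask.IH[of "c as" "Q - length qs" "R - 1"]) (use Ask.prems that in auto)
  qed
next
  case (Flip D c)
  then obtain L where "L \<in> set_pmf D" "a \<in> set_pmf (to_strategy (c L) f)" by auto
  then show ?case using Flip.IH[of "c L" Q R a] Flip.prems by auto
qed

text \<open>Success is a supremum over cut-offs, so one sufficiently late cut-off gives the
  bound.\<close>

lemma success_prob_ge:
  assumes "cost_to_go v adv P 0 0 1 t [] A \<le> ennreal \<epsilon>" "0 \<le> \<epsilon>"
  shows "success_prob v adv P A \<ge> 1 - \<epsilon>"
proof -
  let ?M = "execution v adv t A"
  let ?G = "{(Some S, q, r) | S q r. P S} :: (nat set option \<times> nat \<times> nat) set"
  have "cost_to_go v adv P 0 0 1 t [] A = (\<integral>\<^sup>+ z. indicator (- ?G) z \<partial>measure_pmf ?M)"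
    unfolding cost_to_go_def execution_def
    by (intro nn_integral_cong) (auto simp: indicator_def)
  also have "\<dots> = emeasure (measure_pmf ?M) (- ?G)" by simp
  also have "\<dots> = ennreal (measure_pmf.prob ?M (- ?G))"
    by (rule measure_pmf.emeasure_eq_measure)
  finally have "measure_pmf.prob ?M (- ?G) \<le> \<epsilon>"
    using assms by simp
  moreover have "measure_pmf.prob ?M (- ?G) = 1 - measure_pmf.prob ?M ?G"
    using measure_pmf.prob_compl[of ?G ?M] by (simp add: Compl_eq_Diff_UNIV)
  moreover have "measure_pmf.prob ?M ?G \<le> success_prob v adv P A"
    unfolding success_prob_def
    by (rule cSUP_upper) (auto intro!: bdd_aboveI[of _ 1])
  ultimately show ?thesis by linarith
qed

lemma expected_queries_le:
  assumes "\<And>t. cost_to_go v adv P 1 0 0 t [] A \<le> B"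
  shows "expected_queries v adv A \<le> B"
  unfolding expected_queries_def
proof (rule SUP_least)
  fix t
  show "(\<integral>\<^sup>+ (res, q, r). of_nat q \<partial>measure_pmf (execution v adv t A)) \<le> B"
    using assms[of t] unfolding cost_to_go_def execution_def by simp
qed

lemma expected_rounds_le:
  assumes "\<And>t. cost_to_go v adv P 0 1 0 t [] A \<le> B"
  shows "expected_rounds v adv A \<le> B"
  unfolding expected_rounds_def
proof (rule SUP_least)
  fix t
  show "(\<integral>\<^sup>+ (res, q, r). of_nat r \<partial>measure_pmf (execution v adv t A)) \<le> B"
    using assms[of t] unfolding cost_to_go_def execution_def by simp
qed

section \<open>Majority tests and filtering\<close>

definition truth :: "(nat \<Rightarrow> real) \<Rightarrow> query \<Rightarrow> bool" where
  "truth v q \<longleftrightarrow> v (fst q) \<ge> v (snd q)"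

definition majority :: "query list \<Rightarrow> bool list \<Rightarrow> query \<Rightarrow> bool" where
  "majority qs as q \<longleftrightarrow> length (filter (\<lambda>z. fst z = q) (zip qs as))
     < 2 * length (filter (\<lambda>z. fst z = q \<and> snd z) (zip qs as))"

definition tests :: "query set \<Rightarrow> nat \<Rightarrow> (query \<Rightarrow> bool) prog" where
  "tests T u = (let qs = concat (map (replicate (12 * u)) (SOME ts. set ts = T \<and> distinct ts))
     in Ask qs (\<lambda>as. Ret (majority qs as)))"

text \<open>
  The exponential moment of the number of corrupted answers to \<open>q\<close>; Markov's inequality turns it
  into a Chernoff bound.
\<close>

lemma nn_integral_power_corrupted:
  "(\<integral>\<^sup>+ ok. 2 ^ length (filter (\<lambda>z. fst z = q \<and> \<not> snd z) (zip qs ok))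
     \<partial>measure_pmf (replicate_pmf (length qs) (bernoulli_pmf (2/3))))
   = ennreal ((4/3) ^ length (filter (\<lambda>q'. q' = q) qs))"
proof (induction qs)
  case (Cons q' qs)
  let ?W = "\<lambda>qs ok. 2 ^ length (filter (\<lambda>z. fst z = q \<and> \<not> snd z) (zip qs ok)) :: ennreal"
  let ?w = "\<lambda>b. if q' = q \<and> \<not> b then 2 else 1 :: ennreal"
  let ?E = "(4/3) ^ length (filter (\<lambda>q'. q' = q) qs) :: real"
  have "(\<integral>\<^sup>+ ok. ?W (q' # qs) ok
      \<partial>measure_pmf (replicate_pmf (length (q' # qs)) (bernoulli_pmf (2/3))))
    = (\<integral>\<^sup>+ b. \<integral>\<^sup>+ ok. ?w b * ?W qs ok \<partial>measure_pmf (replicate_pmf (length qs) (bernoulli_pmf (2/3)))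
         \<partial>measure_pmf (bernoulli_pmf (2/3)))"
    by (auto simp: nn_integral_bind_pmf intro!: nn_integral_cong)
  also have "\<dots> = (\<integral>\<^sup>+ b. ?w b * ennreal ?E \<partial>measure_pmf (bernoulli_pmf (2/3)))"
    by (subst nn_integral_cmult) (simp_all add: Cons.IH)
  also have "\<dots> = ennreal (2/3) * (?w True * ennreal ?E) + ennreal (1/3) * (?w False * ennreal ?E)"
    by (subst nn_integral_bernoulli_pmf) (auto simp: mult_ac)
  also have "\<dots> = ennreal (2/3 * (1 * ?E) + 1/3 * ((if q' = q then 2 else 1) * ?E))"
  proof -
    have "ennreal (2/3) * (1 * ennreal e) + ennreal (1/3) * (ennreal c * ennreal e)
        = ennreal (2/3 * (1 * e) + 1/3 * (c * e))" if "0 \<le> e" "0 \<le> c" for e c :: real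
      using that by (simp flip: ennreal_mult ennreal_plus)
    from this[of ?E "if q' = q then 2 else 1"] show ?thesis by (auto split: if_splits)
  qed
  also have "2/3 * (1 * ?E) + 1/3 * ((if q' = q then 2 else 1) * ?E)
      = (4/3) ^ length (filter (\<lambda>q''. q'' = q) (q' # qs))"
    by simp
  finally show ?case .
qed simp

text \<open>A tie is read as \<open>False\<close>. For either truth value, a wrong verdict then
  requires at least half of the copies of \<open>q\<close> to be corrupted, whatever
  \<open>f\<close> answers there.\<close>

lemma majority_wrong:
  assumes "length ok = length qs"
    and as: "as = map (\<lambda>i. if ok ! i then v (fst (qs ! i)) \<ge> v (snd (qs ! i)) else f i) [0..<length qs]"
    and "majority qs as q \<noteq> truth v q"
  shows "length (filter (\<lambda>q'. q' = q) qs)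
      \<le> 2 * length (filter (\<lambda>z. fst z = q \<and> \<not> snd z) (zip qs ok))"
proof -
  let ?n = "length qs"
  define P where "P = {i. i < ?n \<and> qs ! i = q}"
  define B where "B = {i\<in>P. \<not> ok ! i}"
  define Y where "Y = {i\<in>P. as ! i}"
  have fin: "finite P" "B \<subseteq> P" "Y \<subseteq> P" by (auto simp: P_def B_def Y_def)
  have len: "length as = ?n" using as by simp
  have a: "as ! i = truth v q" if "i \<in> P - B" for i
    using that by (auto simp: as P_def B_def truth_def)
  have 1: "length (filter (\<lambda>q'. q' = q) qs) = card P"
    by (simp add: length_filter_conv_card P_def)
  have 2: "length (filter (\<lambda>z. fst z = q \<and> \<not> snd z) (zip qs ok)) = card B"
    unfolding length_filter_conv_card by (rule arg_cong[of _ _ card]) (auto simp: B_def P_def assms(1))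
  have 3: "length (filter (\<lambda>z. fst z = q) (zip qs as)) = card P"
    unfolding length_filter_conv_card by (rule arg_cong[of _ _ card]) (auto simp: P_def len)
  have 4: "length (filter (\<lambda>z. fst z = q \<and> snd z) (zip qs as)) = card Y"
    unfolding length_filter_conv_card by (rule arg_cong[of _ _ card]) (auto simp: Y_def P_def len)
  have maj: "majority qs as q \<longleftrightarrow> card P < 2 * card Y"
    unfolding majority_def 3 4 ..
  have "card P \<le> 2 * card B"
  proof (cases "truth v q")
    case True
    then have "P - B \<subseteq> Y" using a by (auto simp: Y_def)
    then have "card (P - B) \<le> card Y" using fin by (meson card_mono finite_subset)
    moreover have "card (P - B) = card P - card B" using fin by (meson card_Diff_subset finite_subset)
    ultimately show ?thesis using assms(3) True maj by linarith
  next
    case False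
    then have "Y \<subseteq> B" using a by (auto simp: Y_def)
    then have "card Y \<le> card B" using fin by (meson card_mono finite_subset)
    then show ?thesis using assms(3) False maj by linarith
  qed
  then show ?thesis unfolding 1 2 .
qed

lemma prob_majority_wrong:
  assumes "length (filter (\<lambda>q'. q' = q) qs) = 12 * u"
  shows "(\<integral>\<^sup>+ as. of_bool (majority qs as q \<noteq> truth v q) \<partial>measure_pmf (noisy_answers v adv h qs))
    \<le> ennreal ((1/2) ^ u)"
proof -
  let ?D = "replicate_pmf (length qs) (bernoulli_pmf (2/3))"
  let ?B = "\<lambda>ok. length (filter (\<lambda>z. fst z = q \<and> \<not> snd z) (zip qs ok))"
  let ?as = "\<lambda>ok. map (\<lambda>i. if ok ! i then v (fst (qs ! i)) \<ge> v (snd (qs ! i)) else adv h qs ok i)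
                 [0..<length qs]"
  have "(\<integral>\<^sup>+ as. of_bool (majority qs as q \<noteq> truth v q) \<partial>measure_pmf (noisy_answers v adv h qs))
    = (\<integral>\<^sup>+ ok. of_bool (majority qs (?as ok) q \<noteq> truth v q) \<partial>measure_pmf ?D)"
    by (simp add: noisy_answers_def)
  \<comment> \<open>A wrong verdict means at least \<open>6 * u\<close> corrupted copies, so its
    indicator is at most the scaled exponential weight.\<close>
  also have "\<dots> \<le> (\<integral>\<^sup>+ ok. ennreal ((1/2) ^ (6 * u)) * 2 ^ ?B ok \<partial>measure_pmf ?D)"
  proof (rule nn_integral_mono_AE, unfold AE_measure_pmf_iff, rule ballI)
    fix ok assume "ok \<in> set_pmf ?D"
    then have len: "length ok = length qs" by (simp add: set_replicate_pmf lists_def)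
    show "of_bool (majority qs (?as ok) q \<noteq> truth v q) \<le> ennreal ((1/2) ^ (6 * u)) * 2 ^ ?B ok"
    proof (cases "majority qs (?as ok) q = truth v q")
      case False
      have "12 * u \<le> 2 * ?B ok"
        using majority_wrong[OF len refl False] assms by simp
      then have "(1::real) \<le> (1/2) ^ (6 * u) * 2 ^ ?B ok"
        by (simp add: power_one_over field_simps power_increasing)
      then have "ennreal 1 \<le> ennreal ((1/2) ^ (6 * u) * 2 ^ ?B ok)"
        by (rule ennreal_leI)
      also have "\<dots> = ennreal ((1/2) ^ (6 * u)) * 2 ^ ?B ok"
        by (simp add: ennreal_mult flip: ennreal_power)
      finally show ?thesis using False by simp
    qed simp
  qed
  also have "\<dots> = ennreal ((1/2) ^ (6 * u)) * ennreal ((4/3) ^ (12 * u))"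
    by (simp add: nn_integral_cmult nn_integral_power_corrupted assms)
  also have "\<dots> = ennreal (((1/2) ^ 6 * (4/3) ^ 12) ^ u)"
    by (simp add: ennreal_mult[symmetric] power_mult power_mult_distrib)
  \<comment> \<open>\<open>(1/2) ^ 6 * (4/3) ^ 12\<close> is about 0.493; this is why
    \<open>tests\<close> repeats each query \<open>12 * u\<close> times.\<close>
  also have "\<dots> \<le> ennreal ((1/2) ^ u)"
    by (intro ennreal_leI power_mono) (simp_all add: field_simps)
  finally show ?thesis .
qed

lemma tests_list:
  assumes "finite T"
  obtains qs where "tests T u = Ask qs (\<lambda>as. Ret (majority qs as))" "set qs \<subseteq> T"
    "length qs = 12 * u * card T" "\<And>q. q \<in> T \<Longrightarrow> length (filter (\<lambda>q'. q' = q) qs) = 12 * u"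
proof -
  define ts where "ts = (SOME ts. set ts = T \<and> distinct ts)"
  have ts: "set ts = T" "distinct ts"
    unfolding atomize_conj ts_def by (rule someI_ex) (rule finite_distinct_list[OF assms])
  define qs where "qs = concat (map (replicate (12 * u)) ts)"
  have "length qs = 12 * u * length ts"
    unfolding qs_def by (induction ts) auto
  moreover have "length (filter (\<lambda>q'. q' = q) qs) = (if q \<in> set ts then 12 * u else 0)" for q
    unfolding qs_def using ts(2) by (induction ts) (auto simp: filter_replicate)
  moreover have "set qs \<subseteq> T" using ts by (auto simp: qs_def)
  moreover have "length ts = card T" using ts by (metis distinct_card)
  ultimately show ?thesis
    using ts by (intro that[of qs]) (simp_all add: tests_def flip: ts_def qs_def)
qed

lemma safe_tests:
  assumes "finite T" "T \<subseteq> X \<times> X" "12 * u * card T \<le> Q" "1 \<le> R"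
  shows "safe X (tests T u) Q R (\<lambda>_. True)"
proof -
  obtain qs where "tests T u = Ask qs (\<lambda>as. Ret (majority qs as))" "set qs \<subseteq> T"
    "length qs = 12 * u * card T"
    by (rule tests_list[OF assms(1), of u])
  then show ?thesis using assms by auto
qed

lemma wp_tests_wrong:
  assumes "finite T" "q \<in> T"
  shows "wp v adv (tests T u) (\<lambda>res. of_bool (res q \<noteq> truth v q)) \<le> ennreal ((1/2) ^ u)"
proof -
  obtain qs where "tests T u = Ask qs (\<lambda>as. Ret (majority qs as))" "set qs \<subseteq> T"
    "length qs = 12 * u * card T" "\<And>q. q \<in> T \<Longrightarrow> length (filter (\<lambda>q'. q' = q) qs) = 12 * u"
    using tests_list[OF assms(1), of u] by blast
  then show ?thesis using assms prob_majority_wrong[of q qs u]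
    by (auto intro!: SUP_least)
qed

lemma wp_tests_sum_wrong:
  assumes "finite T" "finite A" "f ` A \<subseteq> T"
  shows "wp v adv (tests T u) (\<lambda>res. \<Sum>x\<in>A. of_bool (res (f x) \<noteq> truth v (f x)))
    \<le> ennreal (card A * (1/2) ^ u)"
proof -
  have "wp v adv (tests T u) (\<lambda>res. \<Sum>x\<in>A. of_bool (res (f x) \<noteq> truth v (f x)))
    \<le> (\<Sum>x\<in>A. wp v adv (tests T u) (\<lambda>res. of_bool (res (f x) \<noteq> truth v (f x))))"
    by (rule wp_sum[OF assms(2)])
  also have "\<dots> \<le> (\<Sum>x\<in>A. ennreal ((1/2) ^ u))"
    by (intro sum_mono wp_tests_wrong assms) (use assms in auto)
  also have "\<dots> = ennreal (card A * (1/2) ^ u)"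
    by (simp add: ennreal_mult ennreal_of_nat_eq_real_of_nat)
  finally show ?thesis .
qed

text \<open>Union bound: after paying for a wrong verdict anywhere in \<open>T\<close>, the analysis
  may take all verdicts as correct.\<close>

lemma wp_tests_all_correct:
  assumes "finite T" "\<And>res. \<phi> res \<le> 1"
    and "\<And>res. (\<And>q. q \<in> T \<Longrightarrow> res q = truth v q) \<Longrightarrow> \<phi> res \<le> B"
  shows "wp v adv (tests T u) \<phi> \<le> ennreal (card T * (1/2) ^ u) + B"
proof -
  have "\<phi> res \<le> (\<Sum>q\<in>T. of_bool (res q \<noteq> truth v q)) + B" for res
  proof (cases "\<forall>q\<in>T. res q = truth v q")
    case True
    then show ?thesis using assms(3)[of res] by (simp add: add_increasing)
  next
    case False
    then obtain q where q: "q \<in> T" "res q \<noteq> truth v q" by auto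
    have "\<phi> res \<le> of_bool (res q \<noteq> truth v q)" using assms(2) q by simp
    also have "\<dots> \<le> (\<Sum>q\<in>T. of_bool (res q \<noteq> truth v q))"
      by (rule member_le_sum) (use q assms in auto)
    finally show ?thesis by (simp add: add_increasing2)
  qed
  then have "wp v adv (tests T u) \<phi>
      \<le> wp v adv (tests T u) (\<lambda>res. (\<Sum>q\<in>T. of_bool (res q \<noteq> truth v q)) + B)"
    by (rule wp_mono)
  also have "\<dots> \<le> wp v adv (tests T u) (\<lambda>res. \<Sum>q\<in>T. of_bool (res q \<noteq> truth v q))
      + wp v adv (tests T u) (\<lambda>_. B)"
    by (rule wp_add)
  also have "\<dots> \<le> ennreal (card T * (1/2) ^ u) + B"
    using wp_tests_sum_wrong[OF assms(1) assms(1), of "\<lambda>q. q" v adv u]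
    by (auto simp: wp_const intro!: add_mono)
  finally show ?thesis .
qed

text \<open>\<open>qf x\<close> is the query about \<open>x\<close> and \<open>sg x\<close> the
  answer that keeps \<open>x\<close>; the sign varies because the tie-broken query is oriented by
  labels. A pair \<open>(u, M)\<close> is a round of strength \<open>u\<close>, abandoned if more
  than \<open>M\<close> elements survive. The cap makes the cost of the next round a sure
  bound.\<close>

fun filtering :: "(nat \<Rightarrow> query) \<Rightarrow> (nat \<Rightarrow> bool) \<Rightarrow> (nat \<times> nat) list \<Rightarrow> nat set \<Rightarrow> nat set option prog"
  where
  "filtering qf sg [] C = Ret (Some C)"
| "filtering qf sg ((u, M) # L) C = bind_prog (tests (qf ` C) u) (\<lambda>res.
     let C' = {x\<in>C. res (qf x) = sg x}
     in if card C' > M then Ret None else filtering qf sg L C')"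

fun filter_cost :: "nat \<Rightarrow> (nat \<times> nat) list \<Rightarrow> nat" where
  "filter_cost m [] = 0"
| "filter_cost m ((u, M) # L) = 12 * u * m + filter_cost M L"

definition final_cap :: "nat \<Rightarrow> (nat \<times> nat) list \<Rightarrow> nat" where
  "final_cap m L = (if L = [] then m else snd (last L))"

lemma safe_filtering:
  assumes "finite C" "qf ` C \<subseteq> X \<times> X" "card C \<le> m"
  shows "safe X (filtering qf sg L C) (filter_cost m L) (length L)
    (\<lambda>out. \<forall>C'. out = Some C' \<longrightarrow> C' \<subseteq> C \<and> card C' \<le> final_cap m L)"
  using assms
proof (induction L arbitrary: C m)
  case Nil
  then show ?case by (simp add: final_cap_def)
next
  case (Cons a L)
  obtain u M where a: "a = (u, M)" by (cases a)
  have "safe X (let C' = {x\<in>C. res (qf x) = sg x}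
      in if card C' > M then Ret None else filtering qf sg L C') (filter_cost M L) (length L)
    (\<lambda>out. \<forall>C'. out = Some C' \<longrightarrow> C' \<subseteq> C \<and> card C' \<le> final_cap m (a # L))" for res
  proof -
    let ?C = "{x\<in>C. res (qf x) = sg x}"
    have "safe X (filtering qf sg L ?C) (filter_cost M L) (length L)
       (\<lambda>out. \<forall>C'. out = Some C' \<longrightarrow> C' \<subseteq> C \<and> card C' \<le> final_cap m (a # L))"
      if "card ?C \<le> M"
      by (rule safe_mono[OF Cons.IH[of ?C M]]) (use Cons.prems that in \<open>auto simp: final_cap_def a\<close>)
    then show ?thesis by (auto simp: Let_def)
  qed
  moreover have "safe X (tests (qf ` C) u) (12 * u * m) 1 (\<lambda>_. True)"
    using Cons.prems
    by (intro safe_tests) (auto intro!: mult_left_mono intro: order_trans[OF card_image_le])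
  ultimately show ?case unfolding a filtering.simps
    by (intro safe_bind[where I = "\<lambda>_. True" and ?Q2.0 = "filter_cost M L" and ?R2.0 = "length L"]) (auto simp: a)
qed

text \<open>An element that ought to stay disappears only in a round whose verdict on its own query
  errs, so the bound depends neither on the number of other elements nor on the caps.\<close>

lemma wp_filtering_lose:
  assumes "finite C" "x \<in> C" "truth v (qf x) = sg x"
  shows "wp v adv (filtering qf sg L C) (\<lambda>out. of_bool (\<exists>C'. out = Some C' \<and> x \<notin> C'))
    \<le> ennreal (\<Sum>(u, M)\<leftarrow>L. (1/2) ^ u)"
  using assms(1,2)
proof (induction L arbitrary: C)
  case (Cons a L)
  obtain u M where a: "a = (u, M)" by (cases a)
  let ?s = "\<Sum>(u, M)\<leftarrow>L. (1/2) ^ u :: real"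
  let ?\<phi> = "\<lambda>out. of_bool (\<exists>C'. out = Some C' \<and> x \<notin> C') :: ennreal"
  have s: "0 \<le> ?s" by (intro sum_list_nonneg) auto
  let ?F = "\<lambda>res. let C' = {x\<in>C. res (qf x) = sg x}
     in if card C' > M then Ret None else filtering qf sg L C'"
  have "wp v adv (?F res) ?\<phi> \<le> of_bool (res (qf x) \<noteq> truth v (qf x)) + ennreal ?s" for res
  proof (cases "res (qf x) = truth v (qf x)")
    case True
    then show ?thesis
      using Cons.IH[of "{x\<in>C. res (qf x) = sg x}"] Cons.prems assms(3) by (auto simp: Let_def)
  next
    case False
    have "wp v adv (?F res) ?\<phi> \<le> 1" by (rule wp_le_const) auto
    then show ?thesis using False by (auto intro: order_trans simp: add_increasing2)
  qed
  then have "wp v adv (filtering qf sg (a # L) C) ?\<phi>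
    \<le> wp v adv (tests (qf ` C) u) (\<lambda>res. of_bool (res (qf x) \<noteq> truth v (qf x)) + ennreal ?s)"
    unfolding a filtering.simps wp_bind by (intro wp_mono)
  also have "\<dots> \<le> wp v adv (tests (qf ` C) u) (\<lambda>res. of_bool (res (qf x) \<noteq> truth v (qf x)))
      + wp v adv (tests (qf ` C) u) (\<lambda>_. ennreal ?s)"
    by (rule wp_add)
  also have "\<dots> \<le> ennreal ((1/2) ^ u) + ennreal ?s"
    unfolding wp_const using Cons.prems by (intro add_mono wp_tests_wrong) auto
  finally show ?case using s by (simp add: a ennreal_plus)
qed simp

text \<open>
  Markov bound on the abort probability per element to be removed, when at most \<open>a\<close> elements are
  to be kept.
\<close>

fun abort_weight :: "nat \<Rightarrow> (nat \<times> nat) list \<Rightarrow> real" where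
  "abort_weight a [] = 0"
| "abort_weight a ((u, M) # L) = (1/2) ^ u * (1 / (real M + 1 - real a) + abort_weight a L)"

lemma abort_weight_nonneg: "\<forall>(u, M)\<in>set L. a \<le> M \<Longrightarrow> 0 \<le> abort_weight a L"
  by (induction L) auto

text \<open>With at most \<open>a\<close> rightful survivors, exceeding the cap \<open>M\<close>
  takes \<open>M + 1 - a\<close> unwanted ones, and a round of strength \<open>u\<close> leaves on
  average at most a fraction \<open>(1/2) ^ u\<close> of these. Linearity in their number lets the
  bound for the remaining rounds be averaged over the survivors of this one.\<close>

lemma wp_filtering_abort:
  assumes "finite C" "card {x\<in>C. truth v (qf x) = sg x} \<le> a" "\<forall>(u, M)\<in>set L. a \<le> M"
  shows "wp v adv (filtering qf sg L C) (\<lambda>out. of_bool (out = None))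
    \<le> ennreal (card {x\<in>C. truth v (qf x) \<noteq> sg x} * abort_weight a L)"
  using assms
proof (induction L arbitrary: C)
  case (Cons uM L)
  obtain u M where uM: "uM = (u, M)" by (cases uM)
  let ?bad = "\<lambda>C. {x\<in>C. truth v (qf x) \<noteq> sg x}"
  let ?C = "\<lambda>res. {x\<in>C. res (qf x) = sg x}"
  let ?F = "\<lambda>res. let C' = ?C res in if card C' > M then Ret None else filtering qf sg L C'"
  let ?w = "1 / (real M + 1 - real a) + abort_weight a L"
  have aM: "a \<le> M" using Cons.prems uM by auto
  have wL: "0 \<le> abort_weight a L" using Cons.prems by (intro abort_weight_nonneg) auto
  then have w0: "0 \<le> ?w" using aM by simp
  have fin: "finite (?C res)" "finite (?bad C)" for res using Cons.prems by auto
  have le: "wp v adv (?F res) (\<lambda>out. of_bool (out = None)) \<le> ennreal (card (?bad (?C res)) * ?w)" for res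
  proof (cases "card (?C res) > M")
    case True
    have "?C res = {x\<in>?C res. truth v (qf x) = sg x} \<union> ?bad (?C res)" by auto
    then have "card (?C res) \<le> card {x\<in>?C res. truth v (qf x) = sg x} + card (?bad (?C res))"
      by (metis (no_types, lifting) card_Un_le)
    also have "card {x\<in>?C res. truth v (qf x) = sg x} \<le> card {x\<in>C. truth v (qf x) = sg x}"
      using Cons.prems by (intro card_mono) auto
    finally have "real M + 1 - real a \<le> card (?bad (?C res))" using True Cons.prems by simp
    then have "1 \<le> card (?bad (?C res)) * (1 / (real M + 1 - real a))"
      using aM by (simp add: field_simps)
    also have "\<dots> \<le> card (?bad (?C res)) * ?w" using wL by (intro mult_left_mono) auto
    finally have "ennreal 1 \<le> ennreal (card (?bad (?C res)) * ?w)" by (rule ennreal_leI)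
    then show ?thesis using True by (simp add: Let_def)
  next
    case False
    have "card {x\<in>?C res. truth v (qf x) = sg x} \<le> card {x\<in>C. truth v (qf x) = sg x}"
      using Cons.prems by (intro card_mono) auto
    then have "card {x\<in>?C res. truth v (qf x) = sg x} \<le> a" using Cons.prems by simp
    then have "wp v adv (filtering qf sg L (?C res)) (\<lambda>out. of_bool (out = None))
        \<le> ennreal (card (?bad (?C res)) * abort_weight a L)"
      using Cons.prems fin by (intro Cons.IH) auto
    also have "\<dots> \<le> ennreal (card (?bad (?C res)) * ?w)"
      using aM by (intro ennreal_leI mult_left_mono) auto
    finally show ?thesis using False by (simp add: Let_def)
  qed
  have card_le: "ennreal (card (?bad (?C res)) * ?w)
      \<le> ennreal ?w * (\<Sum>x\<in>?bad C. of_bool (res (qf x) \<noteq> truth v (qf x)))" for res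
  proof -
    have "?bad (?C res) \<subseteq> {x\<in>?bad C. res (qf x) \<noteq> truth v (qf x)}" by auto
    then have "card (?bad (?C res)) \<le> card {x\<in>?bad C. res (qf x) \<noteq> truth v (qf x)}"
      using Cons.prems by (intro card_mono) auto
    also have "of_nat \<dots> = (\<Sum>x\<in>?bad C. of_bool (res (qf x) \<noteq> truth v (qf x)) :: ennreal)"
      using fin by (auto simp: Int_def intro!: arg_cong[of _ _ card])
    finally have "of_nat (card (?bad (?C res)))
        \<le> (\<Sum>x\<in>?bad C. of_bool (res (qf x) \<noteq> truth v (qf x)) :: ennreal)" by simp
    then have "ennreal ?w * of_nat (card (?bad (?C res)))
        \<le> ennreal ?w * (\<Sum>x\<in>?bad C. of_bool (res (qf x) \<noteq> truth v (qf x)))"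
      by (rule mult_left_mono) simp
    then show ?thesis
      using w0 by (simp add: ennreal_mult ennreal_of_nat_eq_real_of_nat mult.commute)
  qed
  have "wp v adv (filtering qf sg (uM # L) C) (\<lambda>out. of_bool (out = None))
    \<le> wp v adv (tests (qf ` C) u)
        (\<lambda>res. ennreal ?w * (\<Sum>x\<in>?bad C. of_bool (res (qf x) \<noteq> truth v (qf x))))"
    unfolding uM filtering.simps wp_bind
    by (rule wp_mono) (rule order_trans[OF le card_le])
  also have "\<dots> \<le> ennreal ?w * wp v adv (tests (qf ` C) u)
        (\<lambda>res. \<Sum>x\<in>?bad C. of_bool (res (qf x) \<noteq> truth v (qf x)))"
    by (rule wp_cmult)
  also have "\<dots> \<le> ennreal ?w * ennreal (card (?bad C) * (1/2) ^ u)"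
    using Cons.prems by (intro mult_left_mono wp_tests_sum_wrong) auto
  also have "\<dots> = ennreal (card (?bad C) * abort_weight a (uM # L))"
    using w0 by (subst ennreal_mult[symmetric]) (auto simp: uM mult_ac)
  finally show ?case .
qed simp

section \<open>Order, selection and sampling\<close>

definition beats :: "(nat \<Rightarrow> real) \<Rightarrow> nat \<Rightarrow> nat \<Rightarrow> bool" where
  "beats v x y \<longleftrightarrow> v x > v y \<or> (v x = v y \<and> x < y)"

text \<open>Queries go from the smaller label to the larger one: a positive answer then includes the
  case of equality, in which the smaller label wins, so one query decides \<open>beats\<close> in
  either direction.\<close>

definition beat_query :: "nat \<Rightarrow> nat \<Rightarrow> query" where
  "beat_query x y = (if x < y then (x, y) else (y, x))"

definition wins :: "(query \<Rightarrow> bool) \<Rightarrow> nat \<Rightarrow> nat \<Rightarrow> bool" where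
  "wins res x y \<longleftrightarrow> res (beat_query x y) = (x < y)"

lemma wins_truth: "wins (truth v) x y \<longleftrightarrow> beats v x y"
  by (auto simp: wins_def truth_def beat_query_def beats_def)

lemma wins_correct:
  assumes "\<And>q. q \<in> C \<times> C \<Longrightarrow> res q = truth v q" "x \<in> C" "y \<in> C"
  shows "wins res x y \<longleftrightarrow> beats v x y"
proof -
  have "beat_query x y \<in> C \<times> C" using assms by (auto simp: beat_query_def)
  then show ?thesis using assms(1) wins_truth by (simp add: wins_def)
qed

lemma beats_irrefl: "\<not> beats v x x" by (simp add: beats_def)

lemma beats_trans: "beats v x y \<Longrightarrow> beats v y z \<Longrightarrow> beats v x z"
  by (auto simp: beats_def)

lemma beats_total: "x \<noteq> y \<Longrightarrow> beats v x y \<or> beats v y x"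
  by (auto simp: beats_def)

lemma beats_imp_ge: "beats v x y \<Longrightarrow> v y \<le> v x"
  by (auto simp: beats_def)

definition place :: "(nat \<Rightarrow> real) \<Rightarrow> nat set \<Rightarrow> nat \<Rightarrow> nat" where
  "place v C x = card {y\<in>C. beats v y x}"

lemma place_mono:
  assumes "finite C" "beats v x y"
  shows "place v C x \<le> place v C y"
  unfolding place_def using assms by (intro card_mono) (auto intro: beats_trans)

lemma place_less:
  assumes "finite C" "x \<in> C" "beats v x y"
  shows "place v C x < place v C y"
proof -
  have "{z\<in>C. beats v z x} \<subset> {z\<in>C. beats v z y}"
    using assms beats_trans[of v _ x y] beats_irrefl[of v x] by blast
  then show ?thesis unfolding place_def using assms by (intro psubset_card_mono) auto
qed

text \<open>Places increase strictly along the order, hence are distinct, and \<open>card C\<close>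
  distinct numbers below \<open>card C\<close> exhaust them.\<close>

lemma place_bij:
  assumes "finite C"
  shows "bij_betw (place v C) C {..<card C}"
proof -
  have inj: "inj_on (place v C) C"
    by (rule inj_onI) (metis assms beats_total less_irrefl place_less)
  have sub: "place v C ` C \<subseteq> {..<card C}"
  proof
    fix r assume "r \<in> place v C ` C"
    then obtain x where "x \<in> C" "r = place v C x" by auto
    moreover have "{y\<in>C. beats v y x} \<subseteq> C - {x}" using beats_irrefl[of v x] by auto
    ultimately have "r \<le> card (C - {x})"
      unfolding place_def using assms by (simp only:) (intro card_mono, auto)
    also have "\<dots> < card C" using assms \<open>x \<in> C\<close> by (intro psubset_card_mono) auto
    finally show "r \<in> {..<card C}" by simp
  qed
  have "card (place v C ` C) = card {..<card C}" using inj by (simp add: card_image)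
  then have "place v C ` C = {..<card C}" using sub by (intro card_subset_eq) auto
  then show ?thesis using inj by (simp add: bij_betw_def)
qed

lemma card_place_less:
  assumes "finite C"
  shows "card {x\<in>C. place v C x < m} = min m (card C)"
proof -
  have "bij_betw (place v C) {x\<in>C. place v C x < m} {..<min m (card C)}"
    using place_bij[OF assms, of v]
  proof (rule bij_betw_subset)
    have "place v C ` C = {..<card C}" using place_bij[OF assms, of v] by (simp add: bij_betw_def)
    then show "place v C ` {x\<in>C. place v C x < m} = {..<min m (card C)}"
      by (auto simp: set_eq_iff image_iff) (metis imageE lessThan_iff image_eqI)+
  qed auto
  then show ?thesis by (simp add: bij_betw_same_card)
qed

definition leaders :: "nat \<Rightarrow> nat set \<Rightarrow> (query \<Rightarrow> bool) \<Rightarrow> nat set" where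
  "leaders k C res = {x\<in>C. card {y\<in>C. wins res y x} < k}"

text \<open>Noisy verdicts need not come from an order. A wrong number of leaders, or the lack of
  one that loses to all others, is treated as a failed guess. The returned element is meant to be
  the minimum of \<open>S\<close>, the pivot of the verification.\<close>

definition select :: "nat \<Rightarrow> nat set \<Rightarrow> (query \<Rightarrow> bool) \<Rightarrow> (nat set \<times> nat) option" where
  "select k C res = (let S = leaders k C res; last = (\<lambda>q. q \<in> S \<and> (\<forall>y\<in>S. y \<noteq> q \<longrightarrow> wins res y q))
     in if card S = k \<and> Ex last then Some (S, Eps last) else None)"

lemma select_Some:
  assumes "select k C res = Some (S, q)"
  shows "S = leaders k C res" "card S = k" "S \<subseteq> C" "q \<in> S" "\<forall>y\<in>S. y \<noteq> q \<longrightarrow> wins res y q"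
proof -
  let ?last = "\<lambda>q. q \<in> S \<and> (\<forall>y\<in>S. y \<noteq> q \<longrightarrow> wins res y q)"
  have "card S = k" "S = leaders k C res" "q = Eps ?last" "Ex ?last"
    using assms by (auto simp: select_def Let_def split: if_splits)
  moreover have "?last q" unfolding \<open>q = _\<close> using \<open>Ex ?last\<close> by (rule someI_ex)
  ultimately show "S = leaders k C res" "card S = k" "S \<subseteq> C" "q \<in> S"
    "\<forall>y\<in>S. y \<noteq> q \<longrightarrow> wins res y q"
    by (auto simp: leaders_def)
qed

lemma leaders_correct:
  assumes "\<And>q. q \<in> C \<times> C \<Longrightarrow> res q = truth v q"
  shows "leaders k C res = {x\<in>C. place v C x < k}"
proof -
  have "{y\<in>C. wins res y x} = {y\<in>C. beats v y x}" if "x \<in> C" for x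
    using wins_correct[OF assms] that by auto
  then show ?thesis by (auto simp: leaders_def place_def)
qed

lemma select_min:
  assumes "\<And>q. q \<in> C \<times> C \<Longrightarrow> res q = truth v q" "select k C res = Some (S, q)"
  shows "\<forall>y\<in>S. v q \<le> v y"
  using select_Some[OF assms(2)] wins_correct[OF assms(1)] beats_imp_ge[of v]
  by (metis order_refl subsetD)

lemma select_correct:
  assumes "\<And>q. q \<in> C \<times> C \<Longrightarrow> res q = truth v q" "finite C" "1 \<le> k" "k \<le> card C"
  obtains q where "select k C res = Some ({x\<in>C. place v C x < k}, q)"
proof -
  let ?S = "{x\<in>C. place v C x < k}"
  have S: "leaders k C res = ?S" by (rule leaders_correct[OF assms(1)])
  have "k - 1 \<in> place v C ` C"
    using place_bij[OF assms(2), of v] assms(3,4) by (auto simp: bij_betw_def)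
  then obtain q where q: "q \<in> C" "place v C q = k - 1" by auto
  have "wins res y q" if "y \<in> ?S" "y \<noteq> q" for y
  proof -
    have "\<not> beats v q y" using place_less[OF assms(2) q(1), of v y] that q by auto
    then have "beats v y q" using that beats_total by metis
    then show ?thesis using wins_correct[OF assms(1)] that q by simp
  qed
  moreover have "q \<in> ?S" using q assms(3) by auto
  moreover have "card ?S = k" using card_place_less[OF assms(2)] assms(4) by simp
  ultimately show ?thesis using S by (intro that) (auto simp: select_def Let_def)
qed

text \<open>The arbitrary choice keeps the result inside a nonempty \<open>G\<close> even if the
  verdicts are inconsistent.\<close>

definition champion :: "(query \<Rightarrow> bool) \<Rightarrow> nat set \<Rightarrow> nat" where
  "champion res G = (let best = (\<lambda>x. x \<in> G \<and> (\<forall>y\<in>G. y \<noteq> x \<longrightarrow> wins res x y))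
     in if Ex best then Eps best else (SOME x. x \<in> G))"

lemma champion_in:
  assumes "G \<noteq> {}"
  shows "champion res G \<in> G"
proof -
  let ?best = "\<lambda>x. x \<in> G \<and> (\<forall>y\<in>G. y \<noteq> x \<longrightarrow> wins res x y)"
  show ?thesis
  proof (cases "Ex ?best")
    case True
    then have "?best (Eps ?best)" by (rule someI_ex)
    then show ?thesis using True by (simp add: champion_def)
  next
    case False
    then have "champion res G = (SOME x. x \<in> G)" unfolding champion_def Let_def by (rule if_not_P)
    then show ?thesis using assms by (simp add: some_in_eq)
  qed
qed

lemma ex_max_beats:
  assumes "finite G" "G \<noteq> {}"
  shows "\<exists>x\<in>G. \<forall>y\<in>G. y \<noteq> x \<longrightarrow> beats v x y"
proof -
  have "0 \<in> place v G ` G"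
    using place_bij[OF assms(1), of v] assms by (auto simp: bij_betw_def card_gt_0_iff)
  then obtain x where x: "x \<in> G" "place v G x = 0" by force
  then have "\<forall>y\<in>G. \<not> beats v y x" using assms by (auto simp: place_def)
  then show ?thesis using x beats_total by metis
qed

lemma champion_correct:
  assumes "\<And>q. q \<in> G \<times> G \<Longrightarrow> res q = truth v q" "finite G" "G \<noteq> {}" "y \<in> G" "y \<noteq> champion res G"
  shows "beats v (champion res G) y"
proof -
  let ?best = "\<lambda>x. x \<in> G \<and> (\<forall>y\<in>G. y \<noteq> x \<longrightarrow> wins res x y)"
  have "Ex ?best" using ex_max_beats[OF assms(2,3), of v] wins_correct[OF assms(1)] by metis
  then have "?best (Eps ?best)" by (rule someI_ex)
  moreover have "champion res G = Eps ?best" using \<open>Ex ?best\<close> by (simp add: champion_def)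
  ultimately show ?thesis using assms(4,5) wins_correct[OF assms(1)] by auto
qed

section \<open>The maximum of a sample in two rounds\<close>

definition chunk :: "nat \<Rightarrow> nat list \<Rightarrow> nat \<Rightarrow> nat set" where
  "chunk g R a = set (take g (drop (a * g) R))"

lemma chunk_Union:
  assumes "length R = g * g"
  shows "(\<Union>a<g. chunk g R a) = set R"
proof
  show "(\<Union>a<g. chunk g R a) \<subseteq> set R"
    by (auto simp: chunk_def dest!: in_set_takeD in_set_dropD)
  show "set R \<subseteq> (\<Union>a<g. chunk g R a)"
  proof
    fix x assume "x \<in> set R"
    then obtain j where j: "j < g * g" "x = R ! j" using assms by (auto simp: in_set_conv_nth)
    then have g: "0 < g" by (cases g) auto
    have a: "j div g < g" using j by (simp add: less_mult_imp_div_less)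
    have "j div g * g \<le> length R" using j assms div_times_less_eq_dividend[of j g] by linarith
    then have "take g (drop (j div g * g) R) ! (j mod g) = x"
      using g j by simp
    moreover have "j mod g < length (take g (drop (j div g * g) R))"
    proof -
      have "j mod g < g" using g by simp
      moreover have "j div g * g + j mod g < g * g" using j by simp
      ultimately show ?thesis
        unfolding length_take length_drop assms min_less_iff_conj by linarith
    qed
    ultimately have "x \<in> chunk g R (j div g)" unfolding chunk_def by (metis nth_mem)
    then show "x \<in> (\<Union>a<g. chunk g R a)" using a by auto
  qed
qed

lemma card_chunk: "card (chunk g R a) \<le> g"
  unfolding chunk_def by (rule order_trans[OF card_length]) simp

lemma chunk_nonempty:
  assumes "length R = g * g" "a < g"
  shows "chunk g R a \<noteq> {}"
proof -
  have "a * g < g * g" using assms by simp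
  then show ?thesis using assms by (auto simp: chunk_def)
qed

text \<open>Comparing all pairs of \<open>g * g\<close> samples would take \<open>g ^ 4\<close>
  tests. Two levels, within \<open>g\<close> chunks of length \<open>g\<close> and then among the
  \<open>g\<close> winners, take at most \<open>2 * g ^ 3\<close> tests and only two rounds.\<close>

definition tournament :: "nat \<Rightarrow> nat \<Rightarrow> nat list \<Rightarrow> nat prog" where
  "tournament g u R = bind_prog (tests (\<Union>a<g. chunk g R a \<times> chunk g R a) u) (\<lambda>res.
     let W = (\<lambda>a. champion res (chunk g R a)) ` {..<g}
     in bind_prog (tests (W \<times> W) u) (\<lambda>res'. Ret (champion res' W)))"

lemma tournament_cards:
  fixes R :: "nat list"
  shows "card (\<Union>a<g. chunk g R a \<times> chunk g R a) \<le> g ^ 3"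
    and "card ((f :: nat \<Rightarrow> nat) ` {..<g} \<times> f ` {..<g}) \<le> g ^ 3"
proof -
  have "card (\<Union>a<g. chunk g R a \<times> chunk g R a) \<le> (\<Sum>a<g. card (chunk g R a \<times> chunk g R a))"
    by (rule card_UN_le) simp
  also have "\<dots> \<le> (\<Sum>a<g. g * g)"
    by (intro sum_mono) (simp add: card_cartesian_product mult_mono card_chunk)
  finally show "card (\<Union>a<g. chunk g R a \<times> chunk g R a) \<le> g ^ 3" by (simp add: power3_eq_cube)
  have f: "card (f ` {..<g}) \<le> g" using card_image_le[of "{..<g}" f] by simp
  then have "card (f ` {..<g} \<times> f ` {..<g}) \<le> g * g"
    by (simp add: card_cartesian_product mult_mono)
  also have "\<dots> \<le> g ^ 3" by (cases g) (auto simp: power3_eq_cube)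
  finally show "card (f ` {..<g} \<times> f ` {..<g}) \<le> g ^ 3" .
qed

lemma tournament_winners:
  assumes "length R = g * g" "1 \<le> g"
  shows "(\<lambda>a. champion res (chunk g R a)) ` {..<g} \<subseteq> set R" "(\<lambda>a. champion res (chunk g R a)) ` {..<g} \<noteq> {}"
proof -
  have "champion res (chunk g R a) \<in> chunk g R a" if "a < g" for a
    using champion_in[OF chunk_nonempty[OF assms(1) that]] .
  then show "(\<lambda>a. champion res (chunk g R a)) ` {..<g} \<subseteq> set R"
    unfolding chunk_Union[OF assms(1), symmetric] by auto
  show "(\<lambda>a. champion res (chunk g R a)) ` {..<g} \<noteq> {}" using assms(2) by (auto simp: lessThan_empty_iff)
qed

lemma safe_tournament:
  assumes "length R = g * g" "1 \<le> g" "set R \<subseteq> X" "24 * u * g ^ 3 \<le> Q" "2 \<le> N"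
  shows "safe X (tournament g u R) Q N (\<lambda>p. p \<in> set R)"
proof -
  let ?T = "\<Union>a<g. chunk g R a \<times> chunk g R a"
  have "chunk g R a \<subseteq> X" if "a < g" for a using chunk_Union[OF assms(1)] assms(3) that by blast
  then have "?T \<subseteq> X \<times> X" by blast
  then have "safe X (tests ?T u) (12 * u * g ^ 3) 1 (\<lambda>_. True)"
    by (intro safe_tests mult_left_mono tournament_cards) (auto simp: chunk_def)
  moreover have "safe X (let W = (\<lambda>a. champion res (chunk g R a)) ` {..<g}
     in bind_prog (tests (W \<times> W) u) (\<lambda>res'. Ret (champion res' W))) (12 * u * g ^ 3) 1 (\<lambda>p. p \<in> set R)" for res
  proof -
    let ?W = "(\<lambda>a. champion res (chunk g R a)) ` {..<g}"
    have "safe X (tests (?W \<times> ?W) u) (12 * u * g ^ 3) 1 (\<lambda>_. True)"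
      using tournament_winners[OF assms(1,2), of res] assms(3)
      by (intro safe_tests mult_left_mono tournament_cards) auto
    moreover have "safe X (Ret (champion res' ?W)) 0 0 (\<lambda>p. p \<in> set R)" for res'
      using champion_in[OF tournament_winners(2)[OF assms(1,2), of res], of res']
        tournament_winners(1)[OF assms(1,2), of res] by auto
    ultimately show ?thesis unfolding Let_def
      by (intro safe_bind[where I = "\<lambda>_. True" and ?Q2.0 = 0 and ?R2.0 = 0]) auto
  qed
  ultimately show ?thesis unfolding tournament_def
    using assms by (intro safe_bind[where I = "\<lambda>_. True"]) auto
qed

lemma wp_tournament:
  assumes "length R = g * g" "1 \<le> g" "\<And>p. \<phi> p \<le> 1"
    and "\<And>p. p \<in> set R \<Longrightarrow> (\<And>y. y \<in> set R \<Longrightarrow> y \<noteq> p \<Longrightarrow> beats v p y) \<Longrightarrow> \<phi> p \<le> B"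
  shows "wp v adv (tournament g u R) \<phi> \<le> ennreal (2 * real g ^ 3 * (1/2) ^ u) + B"
proof -
  let ?T = "\<Union>a<g. chunk g R a \<times> chunk g R a"
  let ?e = "ennreal (real g ^ 3 * (1/2) ^ u)"
  let ?W = "\<lambda>res. (\<lambda>a. champion res (chunk g R a)) ` {..<g}"
  let ?F = "\<lambda>res. let W = ?W res in bind_prog (tests (W \<times> W) u) (\<lambda>res'. Ret (champion res' W))"
  have "wp v adv (?F res) \<phi> \<le> ?e + B" if res: "\<And>q. q \<in> ?T \<Longrightarrow> res q = truth v q" for res
  proof -
    have "\<phi> (champion res' (?W res)) \<le> B" if res': "\<And>q. q \<in> ?W res \<times> ?W res \<Longrightarrow> res' q = truth v q" for res'
    proof (rule assms(4))
      let ?p = "champion res' (?W res)"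
      note W = tournament_winners[OF assms(1,2), of res]
      show "?p \<in> set R" using champion_in[OF W(2)] W(1) by auto
      fix y assume y: "y \<in> set R" "y \<noteq> ?p"
      then obtain a where a: "a < g" "y \<in> chunk g R a" using chunk_Union[OF assms(1)] by blast
      let ?z = "champion res (chunk g R a)"
      have 1: "?z = ?p \<or> beats v ?p ?z"
        using champion_correct[OF res' _ W(2), of ?z] a by auto
      have 2: "y = ?z \<or> beats v ?z y"
      proof -
        have "beats v ?z y" if "y \<noteq> ?z"
          by (rule champion_correct[OF _ _ chunk_nonempty[OF assms(1) a(1)]])
            (use res a that in \<open>auto simp: chunk_def\<close>)
        then show ?thesis by auto
      qed
      show "beats v ?p y" using 1 2 y(2) beats_trans[of v ?p ?z y] by auto
    qed
    then have "wp v adv (tests (?W res \<times> ?W res) u) (\<lambda>res'. \<phi> (champion res' (?W res)))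
        \<le> ennreal (card (?W res \<times> ?W res) * (1/2) ^ u) + B"
      by (intro wp_tests_all_correct) (auto simp: assms(3))
    also have "\<dots> \<le> ?e + B"
      using tournament_cards(2)[of "\<lambda>a. champion res (chunk g R a)" g]
      by (intro add_mono ennreal_leI mult_right_mono) (simp_all only: of_nat_le_iff of_nat_power[symmetric], simp_all)
    finally show ?thesis by (simp add: Let_def wp_bind)
  qed
  then have "wp v adv (tests ?T u) (\<lambda>res. wp v adv (?F res) \<phi>)
      \<le> ennreal (card ?T * (1/2) ^ u) + (?e + B)"
  proof (intro wp_tests_all_correct)
    show "wp v adv (?F res) \<phi> \<le> 1" for res by (intro wp_le_const assms(3))
  qed (auto simp: chunk_def)
  also have "\<dots> \<le> ?e + (?e + B)"
    using tournament_cards(1)[of g R]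
    by (intro add_mono ennreal_leI mult_right_mono) (auto simp flip: of_nat_power)
  also have "\<dots> = ennreal (2 * real g ^ 3 * (1/2) ^ u) + B"
    by (simp add: add.assoc[symmetric] flip: ennreal_plus)
  finally show ?thesis by (simp add: tournament_def wp_bind)
qed

section \<open>Hitting and missing probabilities of uniform samples\<close>

lemma prob_sample_hits:
  assumes "finite X" "X \<noteq> {}" "L \<subseteq> X"
  shows "(\<integral>\<^sup>+ R. of_bool (set R \<inter> L \<noteq> {}) \<partial>measure_pmf (replicate_pmf m (pmf_of_set X)))
    \<le> ennreal (real m * real (card L) / real (card X))"
proof (induction m)
  case (Suc m)
  let ?D = "measure_pmf (replicate_pmf m (pmf_of_set X))"
  have "(\<integral>\<^sup>+ R. of_bool (set R \<inter> L \<noteq> {}) \<partial>measure_pmf (replicate_pmf (Suc m) (pmf_of_set X)))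
    = (\<integral>\<^sup>+ x. \<integral>\<^sup>+ R. of_bool (set (x # R) \<inter> L \<noteq> {}) \<partial>?D \<partial>measure_pmf (pmf_of_set X))"
    by (simp add: nn_integral_bind_pmf)
  also have "\<dots> \<le> (\<integral>\<^sup>+ x. \<integral>\<^sup>+ R. indicator L x + of_bool (set R \<inter> L \<noteq> {}) \<partial>?D \<partial>measure_pmf (pmf_of_set X))"
    by (intro nn_integral_mono) (auto simp: indicator_def)
  also have "\<dots> = emeasure (measure_pmf (pmf_of_set X)) L + (\<integral>\<^sup>+ R. of_bool (set R \<inter> L \<noteq> {}) \<partial>?D)"
    by (simp add: nn_integral_add)
  also have "emeasure (measure_pmf (pmf_of_set X)) L = ennreal (card L / card X)"
    using assms by (simp add: emeasure_pmf_of_set Int_absorb1)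
  also have "\<dots> + (\<integral>\<^sup>+ R. of_bool (set R \<inter> L \<noteq> {}) \<partial>?D) \<le> ennreal (card L / card X) + ennreal (real m * real (card L) / real (card X))"
    by (intro add_left_mono Suc.IH)
  also have "\<dots> = ennreal (real (Suc m) * real (card L) / real (card X))"
    by (simp add: add_divide_distrib distrib_right flip: ennreal_plus)
  finally show ?case .
qed simp

lemma prob_sample_misses:
  assumes "finite X" "X \<noteq> {}" "L \<subseteq> X"
  shows "(\<integral>\<^sup>+ R. of_bool (set R \<inter> L = {}) \<partial>measure_pmf (replicate_pmf m (pmf_of_set X)))
    = ennreal ((1 - card L / card X) ^ m)"
proof (induction m)
  case (Suc m)
  let ?D = "measure_pmf (replicate_pmf m (pmf_of_set X))"
  have c: "card L \<le> card X" "0 < card X" using assms by (auto intro: card_mono simp: card_gt_0_iff)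
  have "(\<integral>\<^sup>+ R. of_bool (set R \<inter> L = {}) \<partial>measure_pmf (replicate_pmf (Suc m) (pmf_of_set X)))
    = (\<integral>\<^sup>+ x. \<integral>\<^sup>+ R. of_bool (set (x # R) \<inter> L = {}) \<partial>?D \<partial>measure_pmf (pmf_of_set X))"
    by (simp add: nn_integral_bind_pmf)
  also have "\<dots> = (\<integral>\<^sup>+ x. \<integral>\<^sup>+ R. indicator (- L) x * of_bool (set R \<inter> L = {}) \<partial>?D \<partial>measure_pmf (pmf_of_set X))"
    by (intro nn_integral_cong) (auto simp: indicator_def)
  also have "\<dots> = emeasure (measure_pmf (pmf_of_set X)) (- L) * ennreal ((1 - card L / card X) ^ m)"
    by (simp add: nn_integral_cmult nn_integral_multc Suc.IH)
  also have "emeasure (measure_pmf (pmf_of_set X)) (- L) = ennreal (1 - card L / card X)"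
  proof -
    have "X \<inter> - L = X - L" by auto
    then have "card (X \<inter> - L) = card X - card L"
      using assms by (simp add: card_Diff_subset finite_subset)
    then show ?thesis
      using assms c by (simp add: emeasure_pmf_of_set of_nat_diff diff_divide_distrib)
  qed
  finally show ?case using c by (simp add: ennreal_mult[symmetric] field_simps)
qed simp

section \<open>Filtering schedules\<close>

text \<open>After a round of strength \<open>u\<close> the cap is
  \<open>n div 2 ^ (u div 2)\<close>. A round of strength \<open>boost u\<close> on that many
  elements costs of order \<open>boost u * n / 2 ^ (u div 2)\<close>, which is at most of order
  \<open>n / boost u\<close>: the strength grows exponentially while the cost vanishes.\<close>

definition boost :: "nat \<Rightarrow> nat" where
  "boost u = 2 ^ (u div 4)"

text \<open>The summand 24 pays for rounding: with \<open>w = u div 4\<close>, \<open>8 * u\<close>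
  is at most \<open>32 * w + 24\<close>, and \<open>64 \<le> u\<close> gives
  \<open>16 \<le> w\<close>.\<close>

lemma linear_le_power2: "16 \<le> w \<Longrightarrow> 32 * w + 24 \<le> (2::nat) ^ w"
  by (induction w rule: dec_induct) auto

lemma boost_ge:
  assumes "64 \<le> u"
  shows "8 * u \<le> boost u"
  using linear_le_power2[of "u div 4"] assms unfolding boost_def by linarith

lemma boost_mono: "u \<le> w \<Longrightarrow> boost u \<le> boost w"
  by (simp add: boost_def div_le_mono)

text \<open>Two applications of \<open>boost\<close> dominate a full exponential; hence the factor 2
  in front of \<open>log_star\<close> later.\<close>

lemma boost_boost:
  assumes "64 \<le> u"
  shows "2 ^ (2 * u) \<le> boost (boost u)"
proof -
  have "2 * u \<le> boost u div 4" using boost_ge[OF assms] by linarith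
  then show ?thesis unfolding boost_def[of "boost u"] by (intro power_increasing) auto
qed

lemma boost_iter_mono: "u \<le> w \<Longrightarrow> (boost ^^ j) u \<le> (boost ^^ j) w"
  by (induction j) (auto intro: boost_mono)

lemma boost_iter_ge:
  assumes "64 \<le> u"
  shows "2 ^ j * u \<le> (boost ^^ j) u"
proof (induction j)
  case (Suc j)
  have "64 \<le> (2::nat) ^ j * 64" by simp
  also have "\<dots> \<le> 2 ^ j * u" using assms by simp
  also note Suc.IH
  finally show ?case using boost_ge[of "(boost ^^ j) u"] Suc.IH by simp
qed simp

text \<open>
  The case \<open>u < 64\<close> only ensures termination.
\<close>

function schedule :: "nat \<Rightarrow> nat \<Rightarrow> nat \<Rightarrow> nat \<Rightarrow> (nat \<times> nat) list" where
  "schedule b n M u = (if b \<le> 2 ^ u \<or> u < 64 then [(10 * u + 8, M)]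
     else (u, n div 2 ^ (u div 2)) # schedule b n M (boost u))"
  by pat_completeness auto
termination
proof (relation "Wellfounded.measure (\<lambda>(b, n, M, u). b - u)")
  fix b n M u :: nat
  assume "\<not> (b \<le> 2 ^ u \<or> u < 64)"
  then have "u < b" "u < boost u"
    using less_exp[of u] boost_ge[of u] by linarith+
  then show "((b, n, M, boost u), b, n, M, u) \<in> Wellfounded.measure (\<lambda>(b, n, M, u). b - u)" by simp
qed simp

declare schedule.simps [simp del]

lemma schedule_induct [consumes 1, case_names final step]:
  assumes "64 \<le> u"
    and "\<And>u. 64 \<le> u \<Longrightarrow> b \<le> 2 ^ u \<Longrightarrow> schedule b n M u = [(10 * u + 8, M)] \<Longrightarrow> P u"
    and "\<And>u. 64 \<le> u \<Longrightarrow> 2 ^ u < b \<Longrightarrow> 8 * u \<le> boost u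
      \<Longrightarrow> schedule b n M u = (u, n div 2 ^ (u div 2)) # schedule b n M (boost u)
      \<Longrightarrow> P (boost u) \<Longrightarrow> P u"
  shows "P u"
  using assms(1)
proof (induction "b - u" arbitrary: u rule: less_induct)
  case less
  show ?case
  proof (cases "b \<le> 2 ^ u")
    case True
    then show ?thesis using assms(2)[OF less.prems True] by (simp add: schedule.simps)
  next
    case False
    have "8 * u \<le> boost u" using boost_ge less.prems by simp
    moreover have "u < b" using False less_exp[of u] by linarith
    ultimately have "P (boost u)" using less.prems by (intro less.hyps) auto
    moreover have "schedule b n M u = (u, n div 2 ^ (u div 2)) # schedule b n M (boost u)"
      using False less.prems by (subst schedule.simps) simp
    ultimately show ?thesis using assms(3) less.prems False \<open>8 * u \<le> boost u\<close> by simp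
  qed
qed

lemma schedule_final_cap:
  assumes "64 \<le> u"
  shows "final_cap m (schedule b n M u) = M"
proof -
  have "schedule b n M u \<noteq> [] \<and> snd (last (schedule b n M u)) = M"
    using assms by (induction u rule: schedule_induct[where n = n and M = M and b = b]) auto
  then show ?thesis by (simp add: final_cap_def)
qed

text \<open>The strength grows by at least one per round, so the losses are dominated by a geometric
  series starting at the first round.\<close>

lemma schedule_loss:
  assumes "64 \<le> u"
  shows "(\<Sum>(u, M)\<leftarrow>schedule b n M u. (1/2) ^ u) \<le> 2 * (1/2 :: real) ^ u"
  using assms
proof (induction u rule: schedule_induct[where n = n and M = M and b = b])
  case (final u)
  have "(1/2 :: real) ^ (10 * u + 8) \<le> (1/2) ^ u" by (intro power_decreasing) auto
  also have "\<dots> \<le> 2 * (1/2) ^ u" by simp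
  finally show ?case using final by simp
next
  case (step u)
  have "(1/2 :: real) ^ boost u \<le> (1/2) ^ Suc u" using step by (intro power_decreasing) auto
  then show ?case using step by simp
qed

text \<open>A non-final round occurs only while \<open>2 ^ u < b\<close>, so its cap is at least
  \<open>n div b\<close>, which leaves room for the \<open>a\<close> elements to keep.\<close>

lemma schedule_caps:
  assumes "64 \<le> u" "a \<le> M" "a * b \<le> n"
  shows "\<forall>(w, M')\<in>set (schedule b n M u). a \<le> M'"
  using assms(1)
proof (induction u rule: schedule_induct[where n = n and M = M and b = b])
  case (final u)
  then show ?case using assms by simp
next
  case (step u)
  have "(2::nat) ^ (u div 2) \<le> b" using power_increasing[of "u div 2" u "2::nat"] step by linarith
  then have "a * 2 ^ (u div 2) \<le> a * b" using step by (intro mult_left_mono) auto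
  also note assms(3)
  finally have "a \<le> n div 2 ^ (u div 2)" by (simp add: less_eq_div_iff_mult_less_eq)
  then show ?case using step by auto
qed

text \<open>The weight is an abort probability per unwanted element, and \<open>n\<close> bounds
  their number. A non-final round contributes at most 1/200, and whatever follows it is damped by at
  least a factor 1/2.\<close>

lemma schedule_abort_weight:
  assumes "64 \<le> u" "a \<le> M" "2 * a * b \<le> n" "n \<le> b ^ 10"
  shows "n * abort_weight a (schedule b n M u) \<le> 1 / 100"
  using assms(1)
proof (induction u rule: schedule_induct[where n = n and M = M and b = b])
  case (final u)
  \<comment> \<open>The origin of the strength \<open>10 * u + 8\<close>: from
    \<open>b \<le> 2 ^ u\<close> follows \<open>n \<le> 2 ^ (10 * u)\<close>, so on average at most
    1/256 of an unwanted element remains.\<close>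
  have "n \<le> (2 ^ u) ^ 10" using assms(4) final power_mono[of b "2 ^ u" 10] by linarith
  then have "real n \<le> 2 ^ (10 * u)"
    by (metis mult.commute of_nat_le_iff of_nat_numeral of_nat_power power_mult)
  then have "n * (1/2) ^ (10 * u + 8) \<le> (1/256 :: real)"
    by (simp add: power_add power_one_over field_simps)
  moreover have "1 / (real M + 1 - real a) \<le> 1" using assms by (simp add: field_simps)
  then have "n * (1/2) ^ (10 * u + 8) * (1 / (real M + 1 - real a)) \<le> n * (1/2) ^ (10 * u + 8) * 1"
    by (intro mult_left_mono) auto
  ultimately show ?case using final by (simp add: mult_ac)
next
  case (step u)
  let ?h = "u div 2" let ?W = "abort_weight a (schedule b n M (boost u))"
  let ?M = "n div 2 ^ ?h"
  show ?case
  proof (cases "n = 0")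
    case False
    have "(2::nat) ^ ?h \<le> b" using power_increasing[of ?h u "2::nat"] step by linarith
    then have "2 * a * 2 ^ ?h \<le> 2 * a * b" using step by (intro mult_left_mono) auto
    also note assms(3)
    finally have "real (2 * a * 2 ^ ?h) \<le> n" by (simp only: of_nat_le_iff)
    \<comment> \<open>\<open>a\<close> is at most half of the unrounded cap; the other half is the
      margin for Markov's inequality.\<close>
    then have a: "real a \<le> n / 2 ^ ?h / 2" by (simp add: field_simps)
    \<comment> \<open>Floor division: the unrounded cap lies below \<open>?M + 1\<close>, the first
      size that aborts.\<close>
    have "n < (?M + 1) * 2 ^ ?h"
      by (metis add.commute dividend_less_div_times mult.commute plus_1_eq_Suc mult_Suc_right mult_Suc
          zero_less_numeral zero_less_power)
    then have "real n < real ((?M + 1) * 2 ^ ?h)" by (simp only: of_nat_less_iff)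
    then have "n / 2 ^ ?h < real ?M + 1" by (simp add: field_simps)
    then have "n / 2 ^ ?h / 2 \<le> real ?M + 1 - real a" using a by linarith
    then have "1 / (real ?M + 1 - real a) \<le> 1 / (n / 2 ^ ?h / 2)"
      using False by (intro frac_le) auto
    then have "n * (1/2) ^ u * (1 / (real ?M + 1 - real a)) \<le> n * (1/2) ^ u * (1 / (n / 2 ^ ?h / 2))"
      by (intro mult_left_mono) auto
    also have "\<dots> = 2 * (1/2) ^ (u - ?h)"
      using False by (simp add: power_diff power_one_over field_simps)
    also have "\<dots> \<le> 2 * (1/2) ^ 32"
      using step by (intro mult_left_mono power_decreasing) auto
    finally have "n * (1/2) ^ u * (1 / (real ?M + 1 - real a)) \<le> 1 / 200" by (simp add: field_simps)
    moreover have "(1/2) ^ u * (n * ?W) \<le> (1/2) ^ 1 * (1 / 100)"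
    proof (intro mult_mono)
      show "(1/2 :: real) ^ u \<le> (1/2) ^ 1" using step by (intro power_decreasing) auto
      have "a * b \<le> n" using assms(3) by simp
      then have "\<forall>(w, M')\<in>set (schedule b n M (boost u)). a \<le> M'"
        using schedule_caps[OF _ assms(2)] step by simp
      then show "0 \<le> n * ?W" by (intro mult_nonneg_nonneg abort_weight_nonneg) auto
    qed (use step in auto)
    moreover have "n * abort_weight a (schedule b n M u)
        = n * (1/2) ^ u * (1 / (real ?M + 1 - real a)) + (1/2) ^ u * (n * ?W)"
      unfolding step(4) abort_weight.simps by (simp only: distrib_left mult_ac)
    ultimately show ?thesis by simp
  qed simp
qed

lemma schedule_cost:
  assumes "64 \<le> u"
  shows "filter_cost m (schedule b n M u) \<le> 216 * u * m + n"
proof -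
  \<comment> \<open>The induction needs a tail that shrinks with \<open>u\<close>. It closes because
    of \<open>216 + 4096 / 8 \<le> 4096\<close>; in the end \<open>2 ^ (u div 4)\<close> exceeds
    4096 and the tail falls below \<open>n\<close>.\<close>
  have "real (filter_cost m (schedule b n M u)) \<le> 216 * u * m + 4096 * n / 2 ^ (u div 4)"
    using assms
  proof (induction u arbitrary: m rule: schedule_induct[where n = n and M = M and b = b])
    case (final u)
    \<comment> \<open>\<open>10 * u + 8 \<le> 18 * u\<close>, and 216 is
      \<open>12 * 18\<close>.\<close>
    have "12 * (10 * u + 8) * m \<le> 216 * u * m" using final by (intro mult_right_mono) auto
    then have "real (12 * (10 * u + 8) * m) \<le> 216 * u * m"
      by (metis of_nat_le_iff of_nat_mult of_nat_numeral)
    moreover have "0 \<le> 4096 * n / 2 ^ (u div 4)" by simp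
    ultimately show ?case unfolding final(3) filter_cost.simps by linarith
  next
    case (step u)
    let ?F = "boost u" let ?M = "n div 2 ^ (u div 2)"
    have "real (filter_cost ?M (schedule b n M ?F)) \<le> 216 * real ?F * real ?M + 4096 * real n / 2 ^ (?F div 4)"
      using step(5)[of ?M] by simp
    also have "216 * real ?F * real ?M \<le> 216 * n / ?F"
    proof -
      have "?F * ?F \<le> 2 ^ (u div 2)"
        unfolding boost_def power_add[symmetric] by (intro power_increasing) auto
      then have "?M * (?F * ?F) \<le> ?M * 2 ^ (u div 2)" by (rule mult_left_mono) simp
      also have "\<dots> \<le> n" by simp
      finally have "real (?M * (?F * ?F)) \<le> n" by (simp only: of_nat_le_iff)
      then show ?thesis by (simp add: field_simps boost_def)
    qed
    also have "4096 * real n / 2 ^ (?F div 4) \<le> 4096 * real n / (8 * real ?F)"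
    proof (rule divide_left_mono)
      have "8 * ?F \<le> boost ?F" using step by (intro boost_ge) auto
      then have "real (8 * ?F) \<le> real (2 ^ (?F div 4))" unfolding boost_def[of ?F] by (simp only: of_nat_le_iff)
      then show "8 * real ?F \<le> 2 ^ (?F div 4)" by simp
      show "0 < 2 ^ (?F div 4) * (8 * real ?F)" by (simp add: boost_def)
    qed simp
    finally have "real (filter_cost ?M (schedule b n M ?F)) \<le> 216 * n / ?F + 512 * n / ?F" by simp
    also have "\<dots> \<le> 4096 * n / ?F"
      unfolding add_divide_distrib[symmetric] by (intro divide_right_mono) auto
    finally have "real (filter_cost ?M (schedule b n M ?F)) \<le> 4096 * n / 2 ^ (u div 4)"
      by (simp add: boost_def)
    then show ?case unfolding step(4) filter_cost.simps of_nat_add by (simp add: add_increasing)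
  qed
  also have "4096 * n / 2 ^ (u div 4) \<le> real n"
  proof -
    have "(2::real) ^ 12 \<le> 2 ^ (u div 4)" using assms by (intro power_increasing) auto
    then have "real n * 4096 \<le> real n * 2 ^ (u div 4)" by (intro mult_left_mono) auto
    then show ?thesis by (simp add: field_simps)
  qed
  finally have "real (filter_cost m (schedule b n M u)) \<le> real (216 * u * m + n)" by simp
  then show ?thesis by (simp only: of_nat_le_iff)
qed

lemma length_schedule:
  assumes "64 \<le> u" "w \<le> u" "b \<le> 2 ^ ((boost ^^ j) w)"
  shows "length (schedule b n M u) \<le> j + 1"
  using assms
proof (induction j arbitrary: u w)
  case 0
  then have "b \<le> 2 ^ u" using power_increasing[OF \<open>w \<le> u\<close>, of "2::nat"] by (auto intro: order_trans)
  then show ?case by (simp add: schedule.simps)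
next
  case (Suc j)
  show ?case
  proof (cases "b \<le> 2 ^ u")
    case False
    have "64 \<le> boost u" using boost_ge Suc.prems by fastforce
    then have "length (schedule b n M (boost u)) \<le> j + 1"
      using Suc.prems by (intro Suc.IH[of _ "boost w"]) (auto intro: boost_mono simp: funpow_Suc_right simp del: funpow.simps)
    then show ?thesis using False by (subst schedule.simps) simp
  qed (simp add: schedule.simps)
qed

section \<open>Iterated logarithms\<close>

lemma log_le_minus_one:
  fixes x :: real
  assumes "2 \<le> x" "2 \<le> H"
  shows "log H x \<le> x - 1"
proof -
  have "log H x \<le> log 2 x" using assms by (simp add: log_def frac_le)
  also have "log 2 x = 1 + ln (x / 2) / ln 2" using assms by (simp add: log_def ln_div field_simps)
  also have "ln (x / 2) / ln 2 \<le> (x / 2 - 1) / (1 / 2)"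
  proof (rule frac_le)
    show "ln (x / 2) \<le> x / 2 - 1" using assms by (intro ln_le_minus_one) auto
    show "1 / 2 \<le> ln (2::real)" using ln2_ge_two_thirds by simp
  qed (use assms in auto)
  finally show ?thesis by simp
qed

text \<open>This makes the \<open>LEAST\<close> in \<open>log_star\<close> meaningful. A positive
  iterate that is at most 2 becomes nonpositive within two more steps; so otherwise all iterates
  would exceed 2, where each logarithm subtracts at least 1.\<close>

lemma log_iter_nonpos:
  fixes x :: real
  assumes "2 \<le> H"
  shows "\<exists>i. (log H ^^ i) x \<le> 0"
proof (rule ccontr)
  assume "\<not> ?thesis"
  then have pos: "0 < (log H ^^ i) x" for i by (auto simp: not_le)
  have gt: "2 < (log H ^^ i) x" for i
  proof (rule ccontr)
    assume "\<not> 2 < (log H ^^ i) x"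
    then have "log H ((log H ^^ i) x) \<le> 1" using pos[of i] assms by (simp add: log_le_one_cancel_iff)
    then have "log H ((log H ^^ Suc i) x) \<le> 0" using pos[of "Suc i"] assms by simp
    then show False using pos[of "Suc (Suc i)"] by simp
  qed
  have "(log H ^^ i) x \<le> x - i" for i
  proof (induction i)
    case (Suc i)
    then show ?case using log_le_minus_one[of "(log H ^^ i) x" H] gt[of i] assms by simp
  qed simp
  then show False using gt[of "nat \<lceil>x\<rceil>"] by (smt (verit) real_nat_ceiling_ge)
qed

text \<open>The sequence of logarithms is read backwards. If \<open>w\<close> bounds
  \<open>log 2 H * x (Suc i)\<close>, which is \<open>log 2 (x i)\<close>, then
  \<open>x i \<le> 2 ^ w\<close>; the factor \<open>log 2 H\<close> carried along is itself at most
  \<open>2 ^ w\<close>, and two boosts reach \<open>2 ^ (2 * w)\<close>. This factor performs the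
  change from base \<open>H\<close> to base 2.\<close>

lemma boost_iter_log_star:
  fixes n :: nat
  assumes "2 \<le> H" "1 \<le> n" "64 \<le> u" "log 2 H \<le> u"
  shows "n \<le> (boost ^^ (2 * log_star H n)) u" "1 \<le> log_star H n"
proof -
  define L where "L = log_star H n"
  define x where "x = (\<lambda>i. (log H ^^ i) (real n))"
  have h1: "1 \<le> log 2 H" using assms by simp
  have xL: "x L \<le> 0" unfolding x_def L_def log_star_def by (rule LeastI_ex[OF log_iter_nonpos[OF assms(1)]])
  have pos: "0 < x i" if "i < L" for i
    using not_less_Least[of i "\<lambda>i. (log H ^^ i) (real n) \<le> 0"] that
    by (auto simp: x_def L_def log_star_def)
  have "L \<noteq> 0" using xL assms by (cases L) (auto simp: x_def)
  then show "1 \<le> log_star H n" by (simp add: L_def)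
  have xS: "x (Suc i) = log H (x i)" for i by (simp add: x_def)
  have "log 2 H * x (L - 1 - j) \<le> (boost ^^ (2 * j)) u" if "j \<le> L - 1" for j
    using that
  proof (induction j)
    case 0
    have "log H (x (L - 1)) \<le> 0" using xS[of "L - 1"] xL \<open>L \<noteq> 0\<close> by simp
    then have "x (L - 1) \<le> 1" using pos[of "L - 1"] \<open>L \<noteq> 0\<close> assms by simp
    then have "log 2 H * x (L - 1) \<le> log 2 H * 1" using h1 by (intro mult_left_mono) auto
    also have "\<dots> \<le> u" using assms by simp
    finally show ?case by simp
  next
    case (Suc j)
    let ?w = "(boost ^^ (2 * j)) u" let ?i = "L - 1 - Suc j"
    have "1 * u \<le> 2 ^ (2 * j) * u" by (intro mult_right_mono) auto
    then have w: "u \<le> ?w" using boost_iter_ge[OF assms(3), of "2 * j"] by linarith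
    have i: "?i < L" "L - 1 - j = Suc ?i" using Suc.prems by auto
    have "log 2 (x ?i) = log 2 H * log H (x ?i)"
      using assms by (simp add: log_def)
    also have "\<dots> \<le> ?w" using Suc xS[of ?i] i by simp
    finally have "x ?i \<le> 2 powr ?w" using pos[OF i(1)] by (simp add: log_le_iff)
    then have "x ?i \<le> 2 ^ ?w" by (simp add: powr_realpow)
    moreover have "log 2 H \<le> 2 ^ ?w"
    proof -
      have "log 2 H \<le> ?w" using assms w by linarith
      also have "\<dots> \<le> real (2 ^ ?w)" using less_exp[of ?w] by (simp only: of_nat_le_iff less_imp_le)
      finally show ?thesis by simp
    qed
    ultimately have "log 2 H * x ?i \<le> 2 ^ ?w * 2 ^ ?w"
      using h1 pos[OF i(1)] by (intro mult_mono) auto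
    also have "\<dots> = real (2 ^ (2 * ?w))" by (simp add: power_add[symmetric] mult_2)
    also have "\<dots> \<le> (boost ^^ (2 * Suc j)) u"
      using boost_boost[of ?w] w assms(3) by (simp only: of_nat_le_iff) simp
    finally show ?case .
  qed
  from this[of "L - 1"] have le: "log 2 H * n \<le> (boost ^^ (2 * (L - 1))) u" by (simp add: x_def)
  have "1 * real n \<le> log 2 H * n" using h1 by (intro mult_right_mono) auto
  with le have "real n \<le> (boost ^^ (2 * (L - 1))) u" by simp
  then have n: "n \<le> (boost ^^ (2 * (L - 1))) u" by simp
  \<comment> \<open>One more pair of boosts only rounds \<open>L - 1\<close> up to
    \<open>L\<close>.\<close>
  also have "\<dots> \<le> (boost ^^ (2 * L)) u"
  proof -
    let ?w = "(boost ^^ (2 * (L - 1))) u"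
    have "1 * u \<le> 2 ^ (2 * (L - 1)) * u" by (intro mult_right_mono) auto
    then have w: "u \<le> ?w" using boost_iter_ge[OF assms(3), of "2 * (L - 1)"] by linarith
    have "?w \<le> 2 ^ (2 * ?w)" using less_exp[of "2 * ?w"] by linarith
    also have "\<dots> \<le> boost (boost ?w)" using w assms by (intro boost_boost) auto
    also have "\<dots> = (boost ^^ (2 * L)) u" using \<open>L \<noteq> 0\<close> by (cases L) auto
    finally show ?thesis .
  qed
  finally show "n \<le> (boost ^^ (2 * log_star H n)) u" by (simp add: L_def)
qed

text \<open>Small guesses start with weak tests and need longer schedules than the last one. The
  excess is the number of boosts from \<open>64 + 2 ^ i\<close> to \<open>64 + 2 ^ i0\<close>, at
  most 1 unless \<open>2 ^ i\<close> is below the order of \<open>i0\<close>. Only about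
  \<open>log 2 i0\<close> guesses are affected, each by about \<open>log 2 i0\<close> at most, and
  the square of this logarithm is absorbed by \<open>i0 + 1\<close>.\<close>

lemma sum_length_schedules:
  assumes "b \<le> 2 ^ ((boost ^^ J) (64 + 2 ^ i0))"
  shows "(\<Sum>i\<le>i0. length (schedule b n M (64 + 2 ^ i))) \<le> (J + 34) * (i0 + 1)"
proof -
  \<comment> \<open>\<open>m + 1\<close> is the binary length of \<open>i0 + 1\<close>; it measures
    both the number of affected guesses and their excess.\<close>
  obtain m where m: "2 ^ m \<le> i0 + 1" "i0 + 1 < 2 ^ (m + 1)"
    using ex_power_ivl1[of 2 "i0 + 1"] by auto
  define m' where "m' = m + 1"
  have m': "i0 + 1 \<le> 2 ^ m'" "2 ^ m' \<le> 2 * (i0 + 1)" using m by (auto simp: m'_def)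
  let ?u = "\<lambda>i. 64 + 2 ^ i :: nat"
  have len: "length (schedule b n M (?u i)) \<le> J + d + 1" if "?u i0 \<le> (boost ^^ d) (?u i)" for i d
  proof -
    have "(boost ^^ J) (?u i0) \<le> (boost ^^ (J + d)) (?u i)"
      using that by (simp add: funpow_add boost_iter_mono)
    then have "b \<le> 2 ^ ((boost ^^ (J + d)) (?u i))"
      using assms power_increasing[of _ _ "2::nat"] by (meson le_trans one_le_numeral)
    then show ?thesis by (intro length_schedule[of _ "?u i"]) auto
  qed
  \<comment> \<open>\<open>28 + 4 * i0\<close> is four times \<open>i0 + 7\<close>, matching the
    division by 4 in \<open>boost\<close>, and \<open>64 + 2 ^ i0\<close> is at most
    \<open>2 ^ (i0 + 7)\<close>.\<close>
  have up: "?u i0 \<le> boost w" if "28 + 4 * i0 \<le> w" for w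
  proof -
    have "1 \<le> (2::nat) ^ i0" by simp
    then have "?u i0 \<le> 2 ^ i0 * 128" by linarith
    also have "\<dots> = 2 ^ (i0 + 7)" by (simp add: power_add)
    also have "\<dots> \<le> boost w" unfolding boost_def using that by (intro power_increasing) auto
    finally show ?thesis .
  qed
  have "length (schedule b n M (?u i)) \<le> (J + 2) + (if i < m' + 5 then m' else 0)" for i
  proof (cases "i < m' + 5")
    case True
    have "2 ^ m' * 64 \<le> 2 ^ m' * ?u i" by simp
    also have "\<dots> \<le> (boost ^^ m') (?u i)" by (rule boost_iter_ge) simp
    finally have "28 + 4 * i0 \<le> (boost ^^ m') (?u i)" using m' by linarith
    then have "?u i0 \<le> (boost ^^ Suc m') (?u i)" using up by simp
    then show ?thesis using len[of "Suc m'" i] True by simp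
  next
    case False
    then have "(2::nat) ^ (m' + 5) \<le> 2 ^ i" by (intro power_increasing) auto
    then have "28 + 4 * i0 \<le> ?u i" using m' by (simp add: power_add)
    then have "?u i0 \<le> (boost ^^ 1) (?u i)" using up by simp
    then show ?thesis using len[of 1 i] False by simp
  qed
  then have "(\<Sum>i\<le>i0. length (schedule b n M (?u i)))
      \<le> (\<Sum>i\<le>i0. (J + 2) + (if i < m' + 5 then m' else 0))"
    by (intro sum_mono)
  also have "\<dots> = (J + 2) * (i0 + 1) + (\<Sum>i\<le>i0. if i < m' + 5 then m' else 0)"
    unfolding sum.distrib by simp
  also have "(\<Sum>i\<le>i0. if i < m' + 5 then m' else 0) = (\<Sum>i\<in>{..i0} \<inter> {..<m' + 5}. m')"
    by (auto simp: sum.If_cases lessThan_def Int_def intro!: arg_cong[of _ _ card])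
  also have "\<dots> \<le> (\<Sum>i<m' + 5. m')" by (intro sum_mono2) auto
  also have "\<dots> = (m' + 5) * m'" by simp
  also have "\<dots> \<le> 16 * 2 ^ m'"
  proof -
    \<comment> \<open>With the extra \<open>2 * m' + 8\<close>, the left-hand side grows by just
      this amount from \<open>m'\<close> to \<open>m' + 1\<close>, so the doubling on the right
      closes the induction.\<close>
    have "(m' + 5) * m' + 2 * m' + 8 \<le> 16 * 2 ^ m'" for m' :: nat
      by (induction m') (auto simp: algebra_simps)
    from this[of m'] show ?thesis by linarith
  qed
  also have "\<dots> \<le> 32 * (i0 + 1)" using m' by simp
  finally show ?thesis by (simp add: algebra_simps)
qed

section \<open>Completing a guess\<close>

lemma card_filter_image:
  assumes "finite X" "mset xs = image_mset v (mset_set X)"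
  shows "card {x\<in>X. P (v x)} = card {i. i < length xs \<and> P (xs ! i)}"
proof -
  have "card {x\<in>X. P (v x)} = size (filter_mset P (image_mset v (mset_set X)))"
    using assms(1) by (simp add: filter_mset_image_mset)
  also have "\<dots> = length (filter P xs)" unfolding assms(2)[symmetric] by (simp flip: mset_filter)
  finally show ?thesis by (simp add: length_filter_conv_card)
qed

text \<open>These two counts are all that the analysis has to know about the sorted list in
  \<open>kth_value\<close>.\<close>

lemma kth_value_cards:
  assumes "finite X" "1 \<le> k" "k \<le> card X"
  shows "card {x\<in>X. v x > kth_value X v k} < k" "k \<le> card {x\<in>X. v x \<ge> kth_value X v k}"
proof -
  define ys where "ys = sorted_list_of_multiset (image_mset v (mset_set X))"
  define xs where "xs = rev ys"
  have ms: "mset xs = image_mset v (mset_set X)" by (simp add: xs_def ys_def)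
  then have len: "length xs = card X" by (metis size_image_mset size_mset size_mset_set)
  have "sorted ys" by (simp add: ys_def sorted_sorted_list_of_multiset)
  then have le: "xs ! j \<le> xs ! i" if "i \<le> j" "j < length xs" for i j
    using that by (auto simp: xs_def rev_nth sorted_nth_mono)
  have w: "kth_value X v k = xs ! (k - 1)" by (simp add: kth_value_def xs_def ys_def)
  have "{i. i < length xs \<and> xs ! (k - 1) < xs ! i} \<subseteq> {..<k - 1}"
  proof
    fix i assume i: "i \<in> {i. i < length xs \<and> xs ! (k - 1) < xs ! i}"
    show "i \<in> {..<k - 1}"
    proof (rule ccontr)
      assume "i \<notin> {..<k - 1}"
      then show False using le[of "k - 1" i] i by auto
    qed
  qed
  then have "card {i. i < length xs \<and> xs ! (k - 1) < xs ! i} \<le> card {..<k - 1}"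
    by (intro card_mono) auto
  then show "card {x\<in>X. v x > kth_value X v k} < k"
    using assms card_filter_image[OF assms(1) ms, of "\<lambda>y. xs ! (k - 1) < y"] by (simp add: w)
  have "{..<k} \<subseteq> {i. i < length xs \<and> xs ! (k - 1) \<le> xs ! i}"
    using le assms len by auto
  then have "card {..<k} \<le> card {i. i < length xs \<and> xs ! (k - 1) \<le> xs ! i}"
    by (intro card_mono) auto
  then show "k \<le> card {x\<in>X. v x \<ge> kth_value X v k}"
    using card_filter_image[OF assms(1) ms, of "\<lambda>y. xs ! (k - 1) \<le> y"] by (simp add: w)
qed

text \<open>Markov's inequality for the number of lost elements, whose mean is at most
  \<open>card A * \<delta>\<close>. The bound \<open>card A \<le> H * m\<close> is the form in which
  the hardness enters: \<open>m\<close> is 1 for the elements above v_k, and one more than the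
  admissible losses for those at or above it.\<close>

lemma wp_filtering_lose_many:
  fixes m :: nat and H \<delta> :: real
  assumes "finite C" "A \<subseteq> C" "\<And>x. x \<in> A \<Longrightarrow> truth v (qf x) = sg x" "1 \<le> m"
    and "(\<Sum>(u, M)\<leftarrow>L. (1/2) ^ u) \<le> \<delta>" "real (card A) \<le> H * m"
  shows "wp v adv (filtering qf sg L C) (\<lambda>out. of_bool (\<exists>C'. out = Some C' \<and> m \<le> card (A - C')))
    \<le> ennreal (H * \<delta>)"
proof -
  let ?\<phi> = "\<lambda>x out. of_bool (\<exists>C'. out = Some C' \<and> x \<notin> C') :: ennreal"
  have fin: "finite A" using assms by (blast intro: finite_subset)
  have "0 \<le> (\<Sum>(u, M)\<leftarrow>L. (1/2 :: real) ^ u)" by (intro sum_list_nonneg) auto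
  then have \<delta>0: "0 \<le> \<delta>" using assms(5) by linarith
  have le: "of_bool (\<exists>C'. out = Some C' \<and> m \<le> card (A - C')) \<le> ennreal (1 / m) * (\<Sum>x\<in>A. ?\<phi> x out)" for out
  proof (cases "\<exists>C'. out = Some C' \<and> m \<le> card (A - C')")
    case True
    then obtain C' where C': "out = Some C'" "m \<le> card (A - C')" by auto
    have eq: "(\<Sum>x\<in>A. ?\<phi> x out) = ennreal (card (A - C'))"
      using fin C' by (auto simp: Int_def set_diff_eq ennreal_of_nat_eq_real_of_nat)
    have "ennreal 1 \<le> ennreal (1 / m * card (A - C'))"
      using C' assms(4) by (intro ennreal_leI) (simp add: field_simps)
    also have "\<dots> = ennreal (1 / m) * ennreal (card (A - C'))"
      by (rule ennreal_mult) auto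
    finally show ?thesis using True unfolding eq by simp
  qed auto
  have "wp v adv (filtering qf sg L C) (\<lambda>out. of_bool (\<exists>C'. out = Some C' \<and> m \<le> card (A - C')))
    \<le> wp v adv (filtering qf sg L C) (\<lambda>out. ennreal (1 / m) * (\<Sum>x\<in>A. ?\<phi> x out))"
    by (intro wp_mono le)
  also have "\<dots> \<le> ennreal (1 / m) * wp v adv (filtering qf sg L C) (\<lambda>out. \<Sum>x\<in>A. ?\<phi> x out)"
    by (rule wp_cmult)
  also have "\<dots> \<le> ennreal (1 / m) * (\<Sum>x\<in>A. wp v adv (filtering qf sg L C) (?\<phi> x))"
    by (intro mult_left_mono wp_sum fin) simp
  also have "\<dots> \<le> ennreal (1 / m) * (\<Sum>x\<in>A. ennreal \<delta>)"
    by (intro mult_left_mono sum_mono order_trans[OF wp_filtering_lose] ennreal_leI)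
      (use assms in auto)
  also have "\<dots> = ennreal (1 / m * (card A * \<delta>))"
    using \<delta>0 by (simp add: ennreal_of_nat_eq_real_of_nat flip: ennreal_mult)
  also have "\<dots> \<le> ennreal (H * \<delta>)"
  proof (rule ennreal_leI)
    have "card A * \<delta> \<le> H * m * \<delta>" using assms(6) \<delta>0 by (intro mult_right_mono) auto
    then show "1 / m * (card A * \<delta>) \<le> H * \<delta>" using assms(4) by (simp add: field_simps)
  qed
  finally show ?thesis .
qed

text \<open>What the survivors must satisfy for the \<open>k\<close> best of them to be correct when
  \<open>w\<close> is v_k.\<close>

definition top_covered :: "nat set \<Rightarrow> (nat \<Rightarrow> real) \<Rightarrow> nat \<Rightarrow> real \<Rightarrow> nat set \<Rightarrow> bool" where
  "top_covered X v k w C \<longleftrightarrow> {x\<in>X. v x > w} \<subseteq> C \<and> k \<le> card {x\<in>C. v x \<ge> w}"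

text \<open>If the pivot lies below \<open>w\<close>, all elements at or above \<open>w\<close> beat
  it and the hardness bounds apply. Otherwise its value equals \<open>w\<close>, since
  \<open>2 * k\<close> elements beat it but fewer than \<open>k\<close> exceed \<open>w\<close>.
  Then perhaps only some of the ties are kept, but at least \<open>2 * k\<close> elements beat the
  pivot and about half of them may be lost. This is why its rank must be at least
  \<open>2 * k\<close>.\<close>

lemma wp_pivot_filter_uncovered:
  fixes H :: real
  assumes "finite X" "card {x\<in>X. v x > w} < k" "k \<le> card {x\<in>X. v x \<ge> w}"
    and H: "2 \<le> H" "card {x\<in>X. v x > w} \<le> H"
      "card {x\<in>X. v x \<ge> w} \<le> H * (card {x\<in>X. v x \<ge> w} - k + 1)"
    and p: "2 * k \<le> place v X p"
    and \<delta>: "(\<Sum>(u, M)\<leftarrow>L. (1/2) ^ u) \<le> \<delta>" "H * \<delta> \<le> 1 / 100"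
  shows "wp v adv (filtering (\<lambda>x. beat_query x p) (\<lambda>x. x < p) L X)
      (\<lambda>out. of_bool (\<exists>C. out = Some C \<and> \<not> top_covered X v k w C)) \<le> ennreal (1 / 50)"
proof -
  let ?\<Lambda> = "{x\<in>X. v x > w}" let ?U = "{x\<in>X. v x \<ge> w}"
  define A where "A = {x\<in>?U. beats v x p}"
  have pl: "place v X p = card {x\<in>X. beats v x p}" by (simp add: place_def)
  have A: "k \<le> card A \<and> card A \<le> H * (card A - k + 1) \<and> ?\<Lambda> \<subseteq> {x\<in>X. beats v x p}"
  proof (cases "v p < w")
    case True
    then have "A = ?U" "?\<Lambda> \<subseteq> {x\<in>X. beats v x p}" by (auto simp: A_def beats_def)
    then show ?thesis using assms by simp
  next
    case False
    then have A: "A = {x\<in>X. beats v x p}" by (auto simp: A_def beats_def)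
    then have c: "2 * k \<le> card A" using p pl by simp
    have "\<not> v p > w"
    proof
      assume "v p > w"
      then have "A \<subseteq> ?\<Lambda>" by (auto simp: A beats_def)
      then have "card A \<le> card ?\<Lambda>" using assms by (intro card_mono) auto
      then show False using c assms by linarith
    qed
    then have "?\<Lambda> \<subseteq> A" using False by (auto simp: A beats_def)
    moreover have "card A \<le> H * (card A - k + 1)"
    proof -
      have "card A \<le> 2 * (card A - k + 1)" using c by arith
      then have "real (card A) \<le> 2 * real (card A - k + 1)" by linarith
      also have "\<dots> \<le> H * (card A - k + 1)" using H by (intro mult_right_mono) auto
      finally show ?thesis .
    qed
    ultimately show ?thesis using c A by simp
  qed
  have keep: "truth v (beat_query x p) = (x < p)" if "beats v x p" for x
    using that wins_truth[of v x p] by (simp add: wins_def)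
  let ?F = "filtering (\<lambda>x. beat_query x p) (\<lambda>x. x < p) L X"
  let ?\<phi> = "\<lambda>A m out. of_bool (\<exists>C. out = Some C \<and> m \<le> card (A - C)) :: ennreal"
  have 1: "wp v adv ?F (?\<phi> ?\<Lambda> 1) \<le> ennreal (H * \<delta>)"
    by (rule wp_filtering_lose_many[OF assms(1) _ _ _ \<delta>(1)]) (use A keep H in auto)
  have 2: "wp v adv ?F (?\<phi> A (card A - k + 1)) \<le> ennreal (H * \<delta>)"
    by (rule wp_filtering_lose_many[OF assms(1) _ _ _ \<delta>(1)]) (use A keep H in \<open>auto simp: A_def\<close>)
  \<comment> \<open>The pivot may lie outside \<open>X\<close> here, so the queries are confined to
    \<open>X \<union> {p}\<close>.\<close>
  have safe: "safe (X \<union> {p}) ?F (filter_cost (card X) L) (length L)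
    (\<lambda>out. \<forall>C'. out = Some C' \<longrightarrow> C' \<subseteq> X \<and> card C' \<le> final_cap (card X) L)"
    by (rule safe_filtering) (use assms in \<open>auto simp: beat_query_def\<close>)
  have "wp v adv ?F (\<lambda>out. of_bool (\<exists>C. out = Some C \<and> \<not> top_covered X v k w C))
      \<le> wp v adv ?F (\<lambda>out. ?\<phi> ?\<Lambda> 1 out + ?\<phi> A (card A - k + 1) out)"
  proof (rule wp_mono_safe[OF safe])
    fix out assume out: "\<forall>C'. out = Some C' \<longrightarrow> C' \<subseteq> X \<and> card C' \<le> final_cap (card X) L"
    show "of_bool (\<exists>C. out = Some C \<and> \<not> top_covered X v k w C)
        \<le> ?\<phi> ?\<Lambda> 1 out + ?\<phi> A (card A - k + 1) out"
    proof (cases "\<exists>C. out = Some C \<and> \<not> top_covered X v k w C")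
      case True
      then obtain C where C: "out = Some C" "\<not> top_covered X v k w C" "C \<subseteq> X" using out by auto
      have fin: "finite A" "finite ?\<Lambda>" "finite C" using assms C by (auto simp: A_def intro: finite_subset)
      have "1 \<le> card (?\<Lambda> - C) \<or> card A - k + 1 \<le> card (A - C)"
      proof (rule ccontr)
        assume neg: "\<not> ?thesis"
        then have "?\<Lambda> - C = {}" using fin by (simp add: not_le)
        moreover have "k \<le> card {x\<in>C. v x \<ge> w}"
        proof -
          have "card A = card (A - C) + card (A \<inter> C)"
            using fin by (metis Int_commute add.commute card_Int_Diff)
          then have "k \<le> card (A \<inter> C)" using neg A by linarith
          also have "\<dots> \<le> card {x\<in>C. v x \<ge> w}" using fin by (intro card_mono) (auto simp: A_def)
          finally show ?thesis .
        qed
        ultimately show False using C by (auto simp: top_covered_def)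
      qed
      then show ?thesis using C by auto
    qed simp
  qed
  also have "\<dots> \<le> wp v adv ?F (?\<phi> ?\<Lambda> 1) + wp v adv ?F (?\<phi> A (card A - k + 1))"
    by (rule wp_add)
  also have "\<dots> \<le> ennreal (H * \<delta>) + ennreal (H * \<delta>)" by (intro add_mono 1 2)
  also have "\<dots> \<le> ennreal (1 / 100) + ennreal (1 / 100)" by (intro add_mono ennreal_leI \<delta>)
  also have "\<dots> = ennreal (1 / 50)" by (simp flip: ennreal_plus)
  finally show ?thesis .
qed

text \<open>The verification asks \<open>(q, x)\<close> without breaking ties: an element equal to
  the minimum \<open>q\<close> of \<open>S\<close> is no objection, so only the answer
  \<open>False\<close> keeps \<open>x\<close>. With final cap 0, \<open>Some\<close> means that no
  objection is left.\<close>

definition finish :: "nat set \<Rightarrow> nat \<Rightarrow> (nat \<times> nat) list \<Rightarrow> nat \<Rightarrow> nat set \<Rightarrow> nat set option prog" where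
  "finish X k L u C = bind_prog (tests (C \<times> C) u) (\<lambda>res.
     case select k C res of
       None \<Rightarrow> Ret None
     | Some (S, q) \<Rightarrow> bind_prog (filtering (\<lambda>x. (q, x)) (\<lambda>_. False) L (X - S))
         (\<lambda>out. Ret (case out of None \<Rightarrow> None | Some _ \<Rightarrow> Some S)))"

lemma safe_finish:
  assumes "finite X" "C \<subseteq> X" "card C \<le> M" "12 * u * M ^ 2 + filter_cost (card X) L \<le> Q"
    "1 + length L \<le> R"
  shows "safe X (finish X k L u C) Q R (\<lambda>_. True)"
proof -
  have fin: "finite C" using assms finite_subset by blast
  have "card (C \<times> C) \<le> M ^ 2" using assms(3) by (simp add: card_cartesian_product power2_eq_square mult_mono)
  then have "safe X (tests (C \<times> C) u) (12 * u * M ^ 2) 1 (\<lambda>_. True)"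
    using fin assms(2) by (intro safe_tests mult_left_mono) auto
  moreover have "safe X (case select k C res of
       None \<Rightarrow> Ret None
     | Some (S, q) \<Rightarrow> bind_prog (filtering (\<lambda>x. (q, x)) (\<lambda>_. False) L (X - S))
         (\<lambda>out. Ret (case out of None \<Rightarrow> None | Some _ \<Rightarrow> Some S)))
      (filter_cost (card X) L) (length L) (\<lambda>_. True)" for res
  proof (cases "select k C res")
    case (Some z)
    obtain S q where z: "z = (S, q)" by (cases z)
    note sel = select_Some[OF Some[unfolded z]]
    show ?thesis unfolding Some z option.case prod.case
      by (rule safe_bind[OF safe_filtering[where m = "card X"]])
        (use assms sel in \<open>auto intro!: card_mono\<close>)
  qed simp
  ultimately show ?thesis unfolding finish_def
    using assms by (intro safe_bind[where I = "\<lambda>_. True"]) auto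
qed

text \<open>Unless a comparison inside \<open>C\<close> errs, a false acceptance has to lose one
  fixed objection \<open>x\<close>, so it is as unlikely as the loss of a single element, for every
  set \<open>C\<close> of survivors. This one-sidedness makes premature guesses harmless.\<close>

lemma wp_finish_wrong:
  assumes "finite X" "C \<subseteq> X" "card C \<le> M" "final_cap (card X) L = 0"
    and \<delta>: "(\<Sum>(u, M)\<leftarrow>L. (1/2) ^ u) \<le> \<delta>"
  shows "wp v adv (finish X k L u C) (\<lambda>out. of_bool (\<exists>S. out = Some S \<and> \<not> is_top X v k S))
    \<le> ennreal (real M ^ 2 * (1/2) ^ u + \<delta>)"
proof -
  let ?\<phi> = "\<lambda>out. of_bool (\<exists>S. out = Some S \<and> \<not> is_top X v k S) :: ennreal"
  let ?F = "\<lambda>res. case select k C res of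
       None \<Rightarrow> Ret None
     | Some (S, q) \<Rightarrow> bind_prog (filtering (\<lambda>x. (q, x)) (\<lambda>_. False) L (X - S))
         (\<lambda>out. Ret (case out of None \<Rightarrow> None | Some _ \<Rightarrow> Some S))"
  have fin: "finite C" using assms finite_subset by blast
  have "0 \<le> (\<Sum>(u, M)\<leftarrow>L. (1/2 :: real) ^ u)" by (intro sum_list_nonneg) auto
  then have \<delta>0: "0 \<le> \<delta>" using \<delta> by linarith
  have "wp v adv (?F res) ?\<phi> \<le> ennreal \<delta>" if res: "\<And>q. q \<in> C \<times> C \<Longrightarrow> res q = truth v q" for res
  proof (cases "select k C res")
    case None
    then show ?thesis by simp
  next
    case (Some z)
    obtain S q where z: "z = (S, q)" by (cases z)
    note Some = Some[unfolded z]
    note sel = select_Some[OF Some]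
    let ?G = "filtering (\<lambda>x. (q, x)) (\<lambda>_. False) L (X - S)"
    have eq: "wp v adv (?F res) ?\<phi> = wp v adv ?G (\<lambda>out. of_bool (out \<noteq> None \<and> \<not> is_top X v k S))"
      unfolding Some by (auto simp: wp_bind intro!: arg_cong[of _ _ "wp v adv ?G"] ext split: option.splits)
    show ?thesis
    proof (cases "is_top X v k S")
      case True
      then show ?thesis unfolding eq by (simp add: wp_const)
    next
      case False
      then obtain x y where xy: "x \<in> X - S" "y \<in> S" "v x > v y"
        using sel assms(2) by (auto simp: is_top_def)
      have "v q \<le> v y" using select_min[OF res Some] xy by auto
      then have keep: "truth v (q, x) = False" using xy by (simp add: truth_def)
      have safe: "safe X ?G (filter_cost (card X) L) (length L)
          (\<lambda>out. \<forall>C'. out = Some C' \<longrightarrow> C' \<subseteq> X - S \<and> card C' \<le> final_cap (card X) L)"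
        by (rule safe_filtering) (use assms sel in \<open>auto intro!: card_mono\<close>)
      have "wp v adv (?F res) ?\<phi> \<le> wp v adv ?G (\<lambda>out. of_bool (\<exists>C'. out = Some C' \<and> x \<notin> C'))"
        unfolding eq
      proof (rule wp_mono_safe[OF safe])
        fix out assume "\<forall>C'. out = Some C' \<longrightarrow> C' \<subseteq> X - S \<and> card C' \<le> final_cap (card X) L"
        then have "\<forall>C'. out = Some C' \<longrightarrow> C' = {}"
          using assms by (metis card_eq_0_iff finite_Diff finite_subset le_zero_eq)
        then show "of_bool (out \<noteq> None \<and> \<not> is_top X v k S)
            \<le> (of_bool (\<exists>C'. out = Some C' \<and> x \<notin> C') :: ennreal)" by auto
      qed
      also have "\<dots> \<le> ennreal (\<Sum>(u, M)\<leftarrow>L. (1/2) ^ u)"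
        by (rule wp_filtering_lose) (use assms xy keep in auto)
      also have "\<dots> \<le> ennreal \<delta>" by (rule ennreal_leI[OF \<delta>])
      finally show ?thesis .
    qed
  qed
  then have "wp v adv (finish X k L u C) ?\<phi> \<le> ennreal (card (C \<times> C) * (1/2) ^ u) + ennreal \<delta>"
    unfolding finish_def wp_bind using fin
  proof (intro wp_tests_all_correct)
    show "wp v adv (?F res) ?\<phi> \<le> 1" for res by (rule wp_le_const) auto
  qed auto
  also have "\<dots> \<le> ennreal (real M ^ 2 * (1/2) ^ u) + ennreal \<delta>"
  proof (intro add_mono ennreal_leI mult_right_mono order_refl)
    have "card (C \<times> C) \<le> M ^ 2" using assms(3) by (simp add: card_cartesian_product power2_eq_square mult_mono)
    then show "real (card (C \<times> C)) \<le> real M ^ 2" by (simp only: of_nat_le_iff flip: of_nat_power)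
  qed simp
  finally show ?thesis using \<delta>0 by (simp add: ennreal_plus)
qed

text \<open>An element above \<open>w\<close> is beaten only by others above \<open>w\<close>, of
  which there are fewer than \<open>k\<close>; a survivor below \<open>w\<close> is beaten by at
  least \<open>k\<close> survivors.\<close>

lemma leaders_of_covered:
  assumes "finite C" "C \<subseteq> X" "top_covered X v k w C" "card {x\<in>X. v x > w} < k"
  shows "{x\<in>X. v x > w} \<subseteq> {x\<in>C. place v C x < k}" "x \<in> C \<Longrightarrow> place v C x < k \<Longrightarrow> w \<le> v x"
proof -
  show "{x\<in>X. v x > w} \<subseteq> {x\<in>C. place v C x < k}"
  proof
    fix x assume x: "x \<in> {x\<in>X. v x > w}"
    then have "x \<in> C" using assms by (auto simp: top_covered_def)
    moreover have "place v C x \<le> card {x\<in>C. v x > w}"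
      unfolding place_def using assms(1) x by (intro card_mono) (auto simp: beats_def)
    moreover have "{x\<in>C. v x > w} = {x\<in>X. v x > w}" using assms(2,3) by (auto simp: top_covered_def)
    ultimately show "x \<in> {x\<in>C. place v C x < k}" using assms(4) by auto
  qed
  assume x: "x \<in> C" "place v C x < k"
  show "w \<le> v x"
  proof (rule ccontr)
    assume "\<not> w \<le> v x"
    then have "card {x\<in>C. v x \<ge> w} \<le> place v C x"
      unfolding place_def using assms(1) by (intro card_mono) (auto simp: beats_def)
    then show False using x assms(3) by (simp add: top_covered_def)
  qed
qed

text \<open>When the top is covered and the pairs are judged correctly, \<open>w \<le> v q\<close>
  and nothing outside \<open>S\<close> is a true objection. Rejection then means an abort with no
  element to keep, that is \<open>a = 0\<close>.\<close>

lemma wp_finish_None: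
  assumes "finite X" "C \<subseteq> X" "card C \<le> M" "1 \<le> k"
    and cov: "top_covered X v k w C" "card {x\<in>X. v x > w} < k"
    and L: "card X * abort_weight 0 L \<le> \<epsilon>"
  shows "wp v adv (finish X k L u C) (\<lambda>out. of_bool (out = None)) \<le> ennreal (real M ^ 2 * (1/2) ^ u + \<epsilon>)"
proof -
  let ?\<phi> = "\<lambda>out. of_bool (out = None) :: ennreal"
  let ?F = "\<lambda>res. case select k C res of
       None \<Rightarrow> Ret None
     | Some (S, q) \<Rightarrow> bind_prog (filtering (\<lambda>x. (q, x)) (\<lambda>_. False) L (X - S))
         (\<lambda>out. Ret (case out of None \<Rightarrow> None | Some _ \<Rightarrow> Some S))"
  have fin: "finite C" using assms finite_subset by blast
  have W: "0 \<le> abort_weight 0 L" by (rule abort_weight_nonneg) auto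
  then have "0 \<le> card X * abort_weight 0 L" by simp
  then have \<epsilon>0: "0 \<le> \<epsilon>" using L by linarith
  have "k \<le> card {x\<in>C. v x \<ge> w}" using cov by (simp add: top_covered_def)
  also have "\<dots> \<le> card C" using fin by (intro card_mono) auto
  finally have kC: "k \<le> card C" .
  have "wp v adv (?F res) ?\<phi> \<le> ennreal \<epsilon>" if res: "\<And>q. q \<in> C \<times> C \<Longrightarrow> res q = truth v q" for res
  proof -
    let ?S = "{x\<in>C. place v C x < k}"
    obtain q where q: "select k C res = Some (?S, q)"
      using select_correct[OF res fin assms(4) kC] by blast
    note lead = leaders_of_covered[OF fin assms(2) cov]
    have "q \<in> ?S" using select_Some[OF q] by simp
    then have "w \<le> v q" using lead(2) by auto
    have none: "{x\<in>X - ?S. truth v (q, x) = False} = {}"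
    proof -
      have "v x \<le> w" if "x \<in> X - ?S" for x using lead(1) that by fastforce
      then show ?thesis using \<open>w \<le> v q\<close> by (fastforce simp: truth_def)
    qed
    let ?G = "filtering (\<lambda>x. (q, x)) (\<lambda>_. False) L (X - ?S)"
    have "wp v adv (?F res) ?\<phi> = wp v adv ?G ?\<phi>"
      unfolding q by (auto simp: wp_bind intro!: arg_cong[of _ _ "wp v adv ?G"] ext split: option.splits)
    also have "\<dots> \<le> ennreal (card {x\<in>X - ?S. truth v (q, x) \<noteq> False} * abort_weight 0 L)"
    proof (rule wp_filtering_abort)
      show "card {x\<in>X - ?S. truth v (q, x) = False} \<le> 0" unfolding none by simp
    qed (use assms in auto)
    also have "\<dots> \<le> ennreal (card X * abort_weight 0 L)"
      using assms W by (intro ennreal_leI mult_right_mono) (auto intro!: card_mono)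
    also have "\<dots> \<le> ennreal \<epsilon>" by (rule ennreal_leI[OF L])
    finally show ?thesis .
  qed
  then have "wp v adv (finish X k L u C) ?\<phi> \<le> ennreal (card (C \<times> C) * (1/2) ^ u) + ennreal \<epsilon>"
    unfolding finish_def wp_bind using fin
  proof (intro wp_tests_all_correct)
    show "wp v adv (?F res) ?\<phi> \<le> 1" for res by (rule wp_le_const) auto
  qed auto
  also have "\<dots> \<le> ennreal (real M ^ 2 * (1/2) ^ u) + ennreal \<epsilon>"
  proof (intro add_mono ennreal_leI mult_right_mono order_refl)
    have "card (C \<times> C) \<le> M ^ 2" using assms(3) by (simp add: card_cartesian_product power2_eq_square mult_mono)
    then show "real (card (C \<times> C)) \<le> real M ^ 2" by (simp only: of_nat_le_iff flip: of_nat_power)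
  qed simp
  finally show ?thesis using \<epsilon>0 by (simp add: ennreal_plus)
qed

section \<open>Comparing all pairs\<close>

definition brute_force :: "nat set \<Rightarrow> nat \<Rightarrow> nat \<Rightarrow> nat set prog" where
  "brute_force X k u = bind_prog (tests (X \<times> X) u) (\<lambda>res. Ret (leaders k X res))"

lemma safe_brute_force:
  assumes "finite X"
  shows "safe X (brute_force X k u) (12 * u * (card X) ^ 2) 1 (\<lambda>_. True)"
proof -
  have "safe X (tests (X \<times> X) u) (12 * u * (card X) ^ 2) 1 (\<lambda>_. True)"
    using assms by (intro safe_tests) (auto simp: card_cartesian_product power2_eq_square)
  then show ?thesis unfolding brute_force_def
    by (rule safe_bind[where ?Q2.0 = 0 and ?R2.0 = 0]) auto
qed

lemma wp_brute_force_wrong: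
  assumes "finite X" "k \<le> card X"
  shows "wp v adv (brute_force X k u) (\<lambda>S. of_bool (\<not> is_top X v k S)) \<le> ennreal (real (card X) ^ 2 * (1/2) ^ u)"
proof -
  have "is_top X v k (leaders k X res)" if "\<And>q. q \<in> X \<times> X \<Longrightarrow> res q = truth v q" for res
  proof -
    have "\<not> v x > v y" if "x \<in> X" "\<not> place v X x < k" "place v X y < k" for x y
    proof
      assume "v x > v y"
      then have "place v X x \<le> place v X y" by (intro place_mono assms) (simp add: beats_def)
      then show False using that by linarith
    qed
    moreover have "leaders k X res = {x\<in>X. place v X x < k}"
      by (rule leaders_correct) (use that in blast)
    ultimately show ?thesis
      using card_place_less[OF assms(1), of v k] assms(2) by (auto simp: is_top_def)
  qed
  then have "wp v adv (tests (X \<times> X) u) (\<lambda>res. of_bool (\<not> is_top X v k (leaders k X res)))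
      \<le> ennreal (card (X \<times> X) * (1/2) ^ u) + 0"
    using assms by (intro wp_tests_all_correct) auto
  then show ?thesis by (simp add: brute_force_def wp_bind card_cartesian_product power2_eq_square)
qed

section \<open>The guessing loop\<close>

text \<open>The strengths \<open>ut\<close>, \<open>ub\<close> and \<open>u\<close> serve the
  tournament, the pairs of survivors and the filtering. The final caps reflect the two uses of a
  schedule: up to \<open>M\<close> elements may beat the pivot, but no objection may remain.\<close>

definition guess :: "nat set \<Rightarrow> nat \<Rightarrow> nat \<Rightarrow> nat \<Rightarrow> nat \<Rightarrow> nat \<Rightarrow> nat \<Rightarrow> nat \<Rightarrow> nat set option prog" where
  "guess X k b g M ut ub u = Flip (replicate_pmf (g * g) (pmf_of_set X)) (\<lambda>R.
     bind_prog (tournament g ut R) (\<lambda>p.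
     bind_prog (filtering (\<lambda>x. beat_query x p) (\<lambda>x. x < p) (schedule b (card X) M u) X) (\<lambda>out.
     case out of
       None \<Rightarrow> Ret None
     | Some C \<Rightarrow> finish X k (schedule b (card X) 0 u) ub C)))"

lemma set_sample:
  assumes "finite X" "X \<noteq> {}" "R \<in> set_pmf (replicate_pmf m (pmf_of_set X))"
  shows "length R = m" "set R \<subseteq> X"
  using assms by (auto simp: set_replicate_pmf)

lemma safe_pivot_filter:
  assumes "finite X" "p \<in> X" "64 \<le> u"
  shows "safe X (filtering (\<lambda>x. beat_query x p) (\<lambda>x. x < p) (schedule b (card X) M u) X)
    (filter_cost (card X) (schedule b (card X) M u)) (length (schedule b (card X) M u))
    (\<lambda>out. \<forall>C. out = Some C \<longrightarrow> C \<subseteq> X \<and> card C \<le> M)"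
  by (rule safe_mono[OF safe_filtering[where m = "card X"]])
    (use assms in \<open>auto simp: beat_query_def schedule_final_cap\<close>)

lemma safe_guess:
  assumes "finite X" "X \<noteq> {}" "1 \<le> g" "64 \<le> u"
    and Q: "24 * ut * g ^ 3 + 2 * (216 * u * card X + card X) + 12 * ub * M ^ 2 \<le> Q"
    and R: "3 + length (schedule b (card X) M u) + length (schedule b (card X) 0 u) \<le> R"
  shows "safe X (guess X k b g M ut ub u) Q R (\<lambda>_. True)"
  unfolding guess_def safe.simps
proof
  let ?c = "216 * u * card X + card X"
  fix S assume "S \<in> set_pmf (replicate_pmf (g * g) (pmf_of_set X))"
  note S = set_sample[OF assms(1,2) this]
  have "safe X (case out of None \<Rightarrow> Ret None | Some C \<Rightarrow> finish X k (schedule b (card X) 0 u) ub C)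
      (12 * ub * M ^ 2 + ?c) (1 + length (schedule b (card X) 0 u)) (\<lambda>_. True)"
    if "\<forall>C. out = Some C \<longrightarrow> C \<subseteq> X \<and> card C \<le> M" for out
    using that schedule_cost[OF assms(4), of "card X" b "card X" 0] assms(1)
    by (auto split: option.splits intro!: safe_finish[where M = M])
  then have "safe X (bind_prog (filtering (\<lambda>x. beat_query x p) (\<lambda>x. x < p) (schedule b (card X) M u) X)
       (\<lambda>out. case out of None \<Rightarrow> Ret None | Some C \<Rightarrow> finish X k (schedule b (card X) 0 u) ub C))
      (?c + (12 * ub * M ^ 2 + ?c))
      (length (schedule b (card X) M u) + (1 + length (schedule b (card X) 0 u))) (\<lambda>_. True)"
    if "p \<in> set S" for p
    using schedule_cost[OF assms(4), of "card X" b "card X" M] that S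
    by (intro safe_bind[OF safe_pivot_filter[OF assms(1) _ assms(4)]]) auto
  then show "safe X (bind_prog (tournament g ut S) (\<lambda>p.
     bind_prog (filtering (\<lambda>x. beat_query x p) (\<lambda>x. x < p) (schedule b (card X) M u) X)
       (\<lambda>out. case out of None \<Rightarrow> Ret None | Some C \<Rightarrow> finish X k (schedule b (card X) 0 u) ub C)))
     Q R (\<lambda>_. True)"
    using Q R
    by (intro safe_bind[OF safe_tournament[OF S(1) assms(3) S(2) order_refl order_refl]]) auto
qed

lemma wp_guess_wrong:
  assumes "finite X" "X \<noteq> {}" "1 \<le> g" "64 \<le> u"
  shows "wp v adv (guess X k b g M ut ub u) (\<lambda>out. of_bool (\<exists>S. out = Some S \<and> \<not> is_top X v k S))
    \<le> ennreal (real M ^ 2 * (1/2) ^ ub + 2 * (1/2) ^ u)"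
proof -
  let ?\<phi> = "\<lambda>out. of_bool (\<exists>S. out = Some S \<and> \<not> is_top X v k S) :: ennreal"
  let ?e = "ennreal (real M ^ 2 * (1/2) ^ ub + 2 * (1/2) ^ u)"
  let ?F = "\<lambda>p. filtering (\<lambda>x. beat_query x p) (\<lambda>x. x < p) (schedule b (card X) M u) X"
  let ?f = "\<lambda>out. case out of None \<Rightarrow> Ret None | Some C \<Rightarrow> finish X k (schedule b (card X) 0 u) ub C"
  have fin: "wp v adv (?f out) ?\<phi> \<le> ?e" if "\<forall>C. out = Some C \<longrightarrow> C \<subseteq> X \<and> card C \<le> M" for out
  proof (cases out)
    case (Some C)
    then show ?thesis
      using that assms(1) wp_finish_wrong[OF assms(1) _ _ schedule_final_cap[OF assms(4)] schedule_loss[OF assms(4)]]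
      by simp
  qed simp
  have piv: "wp v adv (bind_prog (?F p) ?f) ?\<phi> \<le> ?e" if "p \<in> X" for p
  proof -
    have "wp v adv (?F p) (\<lambda>out. wp v adv (?f out) ?\<phi>) \<le> wp v adv (?F p) (\<lambda>_. ?e)"
      by (rule wp_mono_safe[OF safe_pivot_filter[OF assms(1) that assms(4)]]) (rule fin)
    then show ?thesis by (simp add: wp_bind wp_const)
  qed
  have "wp v adv (bind_prog (tournament g ut R) (\<lambda>p. bind_prog (?F p) ?f)) ?\<phi> \<le> ?e"
    if "R \<in> set_pmf (replicate_pmf (g * g) (pmf_of_set X))" for R
  proof -
    note R = set_sample[OF assms(1,2) that]
    have "wp v adv (tournament g ut R) (\<lambda>p. wp v adv (bind_prog (?F p) ?f) ?\<phi>)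
        \<le> wp v adv (tournament g ut R) (\<lambda>_. ?e)"
      by (rule wp_mono_safe[OF safe_tournament[OF R(1) assms(3) R(2) order_refl order_refl]])
        (use piv R in auto)
    then show ?thesis unfolding wp_bind[of _ _ "tournament g ut R"] by (simp add: wp_const)
  qed
  then have "wp v adv (guess X k b g M ut ub u) ?\<phi>
      \<le> (\<integral>\<^sup>+ R. ?e \<partial>measure_pmf (replicate_pmf (g * g) (pmf_of_set X)))"
    unfolding guess_def wp.simps by (intro nn_integral_mono_AE) (simp add: AE_measure_pmf_iff)
  then show ?thesis by simp
qed

text \<open>Failure budget: 1/50 each for a sample that is too good or too bad, 1/100 for the
  tournament, 1/100 for an abort, 1/50 for losing the top, 1/50 for \<open>finish\<close>; together
  1/10.\<close>

lemma wp_guess_None: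
  fixes H :: real
  assumes "finite X" "1 \<le> k" "1 \<le> g" "64 \<le> u"
    and w: "card {x\<in>X. v x > w} < k" "k \<le> card {x\<in>X. v x \<ge> w}"
    and H: "2 \<le> H" "card {x\<in>X. v x > w} \<le> H"
      "card {x\<in>X. v x \<ge> w} \<le> H * (card {x\<in>X. v x \<ge> w} - k + 1)" "H * (2 * (1/2) ^ u) \<le> 1 / 100"
    and b: "2 * M * b \<le> card X" "card X \<le> b ^ 10" "M < card X"
    and low: "real (g * g * (2 * k)) / real (card X) \<le> 1 / 50" and high: "(1 - real M / real (card X)) ^ (g * g) \<le> 1 / 50"
    and ut: "2 * real g ^ 3 * (1/2) ^ ut \<le> (1 / 100 :: real)" and ub: "real M ^ 2 * (1/2) ^ ub \<le> (1 / 100 :: real)"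
  shows "wp v adv (guess X k b g M ut ub u) (\<lambda>out. of_bool (out = None)) \<le> ennreal (1 / 8)"
proof -
  let ?\<phi> = "\<lambda>out. of_bool (out = None) :: ennreal"
  let ?L = "schedule b (card X) M u"
  let ?F = "\<lambda>p. filtering (\<lambda>x. beat_query x p) (\<lambda>x. x < p) ?L X"
  let ?f = "\<lambda>out. case out of None \<Rightarrow> Ret None | Some C \<Rightarrow> finish X k (schedule b (card X) 0 u) ub C"
  let ?bad = "\<lambda>out. of_bool (\<exists>C. out = Some C \<and> \<not> top_covered X v k w C) :: ennreal"
  have X: "X \<noteq> {}" using b by auto
  have fin: "wp v adv (?f out) ?\<phi> \<le> ?\<phi> out + (?bad out + ennreal (1 / 50))"
    if inv: "\<forall>C. out = Some C \<longrightarrow> C \<subseteq> X \<and> card C \<le> M" for out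
  proof (cases "\<exists>C. out = Some C \<and> top_covered X v k w C")
    case True
    then obtain C where C: "out = Some C" "top_covered X v k w C" by auto
    have "card X * abort_weight 0 (schedule b (card X) 0 u) \<le> 1 / 100"
      by (rule schedule_abort_weight) (use assms in auto)
    then have "wp v adv (finish X k (schedule b (card X) 0 u) ub C) ?\<phi>
        \<le> ennreal (real M ^ 2 * (1/2) ^ ub + 1 / 100)"
      using inv C w assms(1,2) by (intro wp_finish_None) auto
    also have "\<dots> \<le> ennreal (1 / 50)" using ub by (intro ennreal_leI) simp
    finally show ?thesis using C by (simp add: add_increasing)
  next
    case False
    have "wp v adv (?f out) ?\<phi> \<le> 1" by (rule wp_le_const) simp
    also have "1 \<le> ?\<phi> out + ?bad out" using False by (cases out) auto
    also have "\<dots> \<le> ?\<phi> out + (?bad out + ennreal (1 / 50))" by (simp add: add.assoc[symmetric])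
    finally show ?thesis .
  qed
  have piv: "wp v adv (bind_prog (?F p) ?f) ?\<phi> \<le> ennreal (1 / 20)"
    if p: "p \<in> X" "2 * k \<le> place v X p" "place v X p \<le> M" for p
  proof -
    have abort: "wp v adv (?F p) ?\<phi> \<le> ennreal (1 / 100)"
    proof -
      have keep: "truth v (beat_query x p) = (x < p) \<longleftrightarrow> beats v x p" for x
        using wins_truth[of v x p] by (simp add: wins_def)
      \<comment> \<open>At most \<open>M\<close> elements beat the pivot, so \<open>M\<close> plays
        the role of the number \<open>a\<close> of elements to keep.\<close>
      have caps: "\<forall>(u, M')\<in>set ?L. M \<le> M'"
        by (rule schedule_caps) (use assms in auto)
      have "wp v adv (?F p) ?\<phi>
          \<le> ennreal (card {x\<in>X. truth v (beat_query x p) \<noteq> (x < p)} * abort_weight M ?L)"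
        by (rule wp_filtering_abort[OF assms(1) _ caps])
          (use p in \<open>simp add: keep place_def\<close>)
      also have "\<dots> \<le> ennreal (card X * abort_weight M ?L)"
        using assms(1) abort_weight_nonneg[OF caps]
        by (intro ennreal_leI mult_right_mono) (auto intro!: card_mono)
      also have "\<dots> \<le> ennreal (1 / 100)"
        by (intro ennreal_leI schedule_abort_weight) (use assms in auto)
      finally show ?thesis .
    qed
    have uncov: "wp v adv (?F p) ?bad \<le> ennreal (1 / 50)"
      by (rule wp_pivot_filter_uncovered[OF assms(1) w H(1,2,3) p(2) schedule_loss[OF assms(4)] H(4)])
    have "wp v adv (bind_prog (?F p) ?f) ?\<phi> \<le> wp v adv (?F p) (\<lambda>out. ?\<phi> out + (?bad out + ennreal (1 / 50)))"
      unfolding wp_bind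
      by (rule wp_mono_safe[OF safe_pivot_filter[OF assms(1) p(1) assms(4)]]) (rule fin)
    also have "\<dots> \<le> wp v adv (?F p) ?\<phi> + wp v adv (?F p) (\<lambda>out. ?bad out + ennreal (1 / 50))"
      by (rule wp_add)
    also have "\<dots> \<le> wp v adv (?F p) ?\<phi> + (wp v adv (?F p) ?bad + wp v adv (?F p) (\<lambda>_. ennreal (1 / 50)))"
      by (intro add_left_mono wp_add)
    also have "\<dots> \<le> ennreal (1 / 100) + (ennreal (1 / 50) + ennreal (1 / 50))"
      unfolding wp_const by (intro add_mono abort uncov order_refl)
    also have "\<dots> = ennreal (1 / 20)" by (simp flip: ennreal_plus)
    finally show ?thesis .
  qed
  \<comment> \<open>The maximum of the sample has place at least \<open>2 * k\<close> iff the sample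
    avoids \<open>T1\<close>, and place at most \<open>M\<close> iff it meets
    \<open>T2\<close>.\<close>
  define T1 where "T1 = {x\<in>X. place v X x < 2 * k}"
  define T2 where "T2 = {x\<in>X. place v X x < Suc M}"
  let ?D = "measure_pmf (replicate_pmf (g * g) (pmf_of_set X))"
  have samp: "wp v adv (bind_prog (tournament g ut R) (\<lambda>p. bind_prog (?F p) ?f)) ?\<phi>
      \<le> of_bool (set R \<inter> T1 \<noteq> {}) + (of_bool (set R \<inter> T2 = {}) + ennreal (3 / 50))"
    if "R \<in> set_pmf (replicate_pmf (g * g) (pmf_of_set X))" for R
  proof -
    note R = set_sample[OF assms(1) X that]
    show ?thesis
    proof (cases "set R \<inter> T1 \<noteq> {} \<or> set R \<inter> T2 = {}")
      case True
      have "wp v adv (bind_prog (tournament g ut R) (\<lambda>p. bind_prog (?F p) ?f)) ?\<phi> \<le> 1"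
        by (rule wp_le_const) simp
      also have "1 \<le> of_bool (set R \<inter> T1 \<noteq> {}) + (of_bool (set R \<inter> T2 = {}) :: ennreal)"
        using True by (cases "set R \<inter> T1 \<noteq> {}") auto
      also have "\<dots> \<le> of_bool (set R \<inter> T1 \<noteq> {}) + (of_bool (set R \<inter> T2 = {}) + ennreal (3 / 50))"
        by (simp add: add.assoc[symmetric])
      finally show ?thesis .
    next
      case False
      then obtain z where z: "z \<in> set R" "place v X z \<le> M" by (auto simp: T2_def less_Suc_eq_le)
      have "wp v adv (bind_prog (?F p) ?f) ?\<phi> \<le> ennreal (1 / 20)"
        if p: "p \<in> set R" "\<And>y. y \<in> set R \<Longrightarrow> y \<noteq> p \<Longrightarrow> beats v p y" for p
      proof (rule piv)
        show "p \<in> X" using p R by auto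
        show "2 * k \<le> place v X p" using False p R by (auto simp: T1_def)
        show "place v X p \<le> M"
          using place_mono[OF assms(1) p(2)[OF z(1)]] z by fastforce
      qed
      then have "wp v adv (tournament g ut R) (\<lambda>p. wp v adv (bind_prog (?F p) ?f) ?\<phi>)
          \<le> ennreal (2 * real g ^ 3 * (1/2) ^ ut) + ennreal (1 / 20)"
      proof (intro wp_tournament[OF R(1) assms(3)])
        show "wp v adv (bind_prog (?F p) ?f) ?\<phi> \<le> 1" for p by (rule wp_le_const) simp
      qed auto
      also have "\<dots> \<le> ennreal (1 / 100) + ennreal (1 / 20)" by (intro add_mono ennreal_leI ut order_refl)
      also have "\<dots> = ennreal (3 / 50)" by (simp flip: ennreal_plus)
      finally show ?thesis using False by (simp add: wp_bind[of _ _ "tournament g ut R"])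
    qed
  qed
  have "wp v adv (guess X k b g M ut ub u) ?\<phi>
      \<le> (\<integral>\<^sup>+ R. of_bool (set R \<inter> T1 \<noteq> {}) + (of_bool (set R \<inter> T2 = {}) + ennreal (3 / 50)) \<partial>?D)"
    unfolding guess_def wp.simps using samp
    by (intro nn_integral_mono_AE) (simp add: AE_measure_pmf_iff)
  also have "\<dots> = (\<integral>\<^sup>+ R. of_bool (set R \<inter> T1 \<noteq> {}) \<partial>?D)
      + ((\<integral>\<^sup>+ R. of_bool (set R \<inter> T2 = {}) \<partial>?D) + ennreal (3 / 50))"
    by (simp add: nn_integral_add)
  also have "\<dots> \<le> ennreal (1 / 50) + (ennreal (1 / 50) + ennreal (3 / 50))"
  proof (intro add_mono order_refl)
    have "(\<integral>\<^sup>+ R. of_bool (set R \<inter> T1 \<noteq> {}) \<partial>?D) \<le> ennreal (real (g * g) * card T1 / card X)"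
      by (rule prob_sample_hits[OF assms(1) X]) (auto simp: T1_def)
    also have "\<dots> \<le> ennreal (g * g * (2 * k) / card X)"
    proof (intro ennreal_leI divide_right_mono)
      have "card T1 \<le> 2 * k" unfolding T1_def card_place_less[OF assms(1)] by simp
      then have "g * g * card T1 \<le> g * g * (2 * k)" by (rule mult_left_mono) simp
      then show "real (g * g) * card T1 \<le> real (g * g * (2 * k))" by (simp only: of_nat_le_iff of_nat_mult[symmetric])
    qed simp
    also have "\<dots> \<le> ennreal (1 / 50)" by (rule ennreal_leI[OF low])
    finally show "(\<integral>\<^sup>+ R. of_bool (set R \<inter> T1 \<noteq> {}) \<partial>?D) \<le> ennreal (1 / 50)" .
    have "(\<integral>\<^sup>+ R. of_bool (set R \<inter> T2 = {}) \<partial>?D) = ennreal ((1 - card T2 / card X) ^ (g * g))"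
      by (rule prob_sample_misses[OF assms(1) X]) (auto simp: T2_def)
    also have "\<dots> \<le> ennreal ((1 - M / card X) ^ (g * g))"
    proof (intro ennreal_leI power_mono)
      have "card T2 = Suc M" unfolding T2_def card_place_less[OF assms(1)] using b by simp
      then show "1 - card T2 / card X \<le> 1 - M / card X" by (simp add: divide_right_mono)
      have "card T2 \<le> card X" using assms(1) by (intro card_mono) (auto simp: T2_def)
      then show "0 \<le> 1 - card T2 / card X" by (auto simp: divide_le_eq_1)
    qed
    also have "\<dots> \<le> ennreal (1 / 50)" by (rule ennreal_leI[OF high])
    finally show "(\<integral>\<^sup>+ R. of_bool (set R \<inter> T2 = {}) \<partial>?D) \<le> ennreal (1 / 50)" .
  qed
  also have "\<dots> \<le> ennreal (1 / 8)" by (simp flip: ennreal_plus) 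
  finally show ?thesis .
qed

text \<open>When the fuel is used up, the empty set is output, which is wrong for
  \<open>1 \<le> k\<close>; the analysis charges it as a failure.\<close>

primrec guess_loop :: "(nat \<Rightarrow> nat set option prog) \<Rightarrow> nat \<Rightarrow> nat \<Rightarrow> strategy pmf" where
  "guess_loop G 0 i = return_pmf (Output {})"
| "guess_loop G (Suc f) i = to_strategy (G i)
     (\<lambda>out. case out of None \<Rightarrow> guess_loop G f (Suc i) | Some S \<Rightarrow> return_pmf (Output S))"

primrec loop_bound :: "(nat \<Rightarrow> real) \<Rightarrow> (nat \<Rightarrow> real) \<Rightarrow> real \<Rightarrow> nat \<Rightarrow> nat \<Rightarrow> real" where
  "loop_bound c p \<eta> 0 i = \<eta>"
| "loop_bound c p \<eta> (Suc f) i = c i + p i * loop_bound c p \<eta> f (Suc i)"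

lemma loop_bound_nonneg:
  assumes "\<And>i. 0 \<le> c i" "\<And>i. 0 \<le> p i" "0 \<le> \<eta>"
  shows "0 \<le> loop_bound c p \<eta> f i"
  using assms by (induction f arbitrary: i) auto

lemma queries_within_guess_loop:
  assumes "\<And>i. safe X (G i) (Q i) (R i) (\<lambda>_. True)" "a \<in> set_pmf (guess_loop G f i)"
  shows "queries_within X a"
  using assms(2)
proof (induction f arbitrary: i a)
  case 0
  then show ?case by (auto intro: queries_within.intros)
next
  case (Suc f)
  show ?case
    by (rule queries_within_to_strategy[OF assms(1) _ Suc.prems[unfolded guess_loop.simps]])
      (auto split: option.splits intro: Suc.IH queries_within.intros)
qed

text \<open>The error bounds hold for every transcript, so the adversary may adapt to earlier
  guesses. \<open>loop_bound\<close> is the resulting recurrence: pay for guess \<open>i\<close>,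
  and with probability at most \<open>p i\<close> go on to the next.\<close>

lemma cost_guess_loop:
  fixes \<alpha> \<beta> \<eta> :: real and \<delta> p :: "nat \<Rightarrow> real"
  assumes safe: "\<And>i. safe X (G i) (Q i) (R i) (\<lambda>_. True)"
    and none: "\<And>i. wp v adv (G i) (\<lambda>out. of_bool (out = None)) \<le> ennreal (p i)"
    and wrong: "\<And>i. wp v adv (G i) (\<lambda>out. of_bool (\<exists>S. out = Some S \<and> \<not> P S)) \<le> ennreal (\<delta> i)"
    and nonneg: "0 \<le> \<alpha>" "0 \<le> \<beta>" "0 \<le> \<eta>" "\<And>i. 0 \<le> p i" "\<And>i. 0 \<le> \<delta> i"
    and t: "\<eta> = 0 \<or> (\<Sum>j<f. R (i + j)) \<le> t"
  shows "cost_to_go v adv P (ennreal \<alpha>) (ennreal \<beta>) (ennreal \<eta>) t h (guess_loop G f i)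
    \<le> ennreal (loop_bound (\<lambda>i. \<alpha> * Q i + \<beta> * R i + \<eta> * \<delta> i) p \<eta> f i)"
  using t
proof (induction f arbitrary: i t h)
  case 0
  then show ?case by (simp add: cost_to_go_output)
next
  case (Suc f)
  let ?c = "\<lambda>i. \<alpha> * Q i + \<beta> * R i + \<eta> * \<delta> i"
  let ?B = "loop_bound ?c p \<eta> f (Suc i)"
  have B: "0 \<le> ?B" using nonneg by (intro loop_bound_nonneg) auto
  define \<phi> where "\<phi> = (\<lambda>out. ennreal ?B * of_bool (out = None)
      + ennreal \<eta> * of_bool (\<exists>S. out = Some S \<and> \<not> P S))"
  have "cost_to_go v adv P (ennreal \<alpha>) (ennreal \<beta>) (ennreal \<eta>) t h (guess_loop G (Suc f) i)
    \<le> ennreal \<alpha> * of_nat (Q i) + ennreal \<beta> * of_nat (R i) + wp v adv (G i) \<phi>"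
    unfolding guess_loop.simps
  proof (rule cost_to_go_to_strategy[OF safe, where ?t0.0 = "\<Sum>j<f. R (Suc i + j)"])
    show "ennreal \<eta> = 0 \<or> R i + (\<Sum>j<f. R (Suc i + j)) \<le> t"
      using Suc.prems by (auto simp: sum.lessThan_Suc_shift simp del: sum.lessThan_Suc)
    fix out t h assume "ennreal \<eta> = 0 \<or> (\<Sum>j<f. R (Suc i + j)) \<le> t"
    then have "\<eta> = 0 \<or> (\<Sum>j<f. R (Suc i + j)) \<le> t" using nonneg by auto
    then show "cost_to_go v adv P (ennreal \<alpha>) (ennreal \<beta>) (ennreal \<eta>) t h
        (case out of None \<Rightarrow> guess_loop G f (Suc i) | Some S \<Rightarrow> return_pmf (Output S)) \<le> \<phi> out"
      using Suc.IH[of "Suc i" t h] by (cases out) (auto simp: \<phi>_def cost_to_go_output)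
  qed
  also have "wp v adv (G i) \<phi> \<le> ennreal ?B * ennreal (p i) + ennreal \<eta> * ennreal (\<delta> i)"
    unfolding \<phi>_def
    by (intro order_trans[OF wp_add] add_mono order_trans[OF wp_cmult] mult_left_mono none wrong) auto
  finally have "cost_to_go v adv P (ennreal \<alpha>) (ennreal \<beta>) (ennreal \<eta>) t h (guess_loop G (Suc f) i)
    \<le> ennreal \<alpha> * ennreal (real (Q i)) + ennreal \<beta> * ennreal (real (R i))
      + (ennreal ?B * ennreal (p i) + ennreal \<eta> * ennreal (\<delta> i))"
    by (simp add: ennreal_of_nat_eq_real_of_nat add_left_mono)
  also have "\<dots> = ennreal (loop_bound ?c p \<eta> (Suc f) i)"
    using B nonneg by (simp flip: ennreal_mult ennreal_plus add: algebra_simps)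
  finally show ?case .
qed

section \<open>Integer roots and logarithms\<close>

definition root10 :: "nat \<Rightarrow> nat" where
  "root10 n = (LEAST b. n \<le> b ^ 10)"

definition clog :: "nat \<Rightarrow> nat" where
  "clog n = (LEAST l. n \<le> 2 ^ l)"

definition isqrt :: "nat \<Rightarrow> nat" where
  "isqrt n = (LEAST g. n < (g + 1) ^ 2)"

text \<open>The parameters are compared with powers of this root \<open>b\<close>: the tournament
  has of order \<open>g ^ 3 \<le> b ^ 9\<close> pairs, and the square of a width
  \<open>b ^ 4\<close> is \<open>b ^ 8\<close>, so that a factor \<open>b\<close> remains to pay for
  logarithms.\<close>

lemma root10_bounds:
  assumes "1 \<le> n"
  shows "n \<le> root10 n ^ 10" "root10 n ^ 10 \<le> 1024 * n" "1 \<le> root10 n" "root10 n \<le> n"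
proof -
  let ?b = "root10 n"
  have n: "n \<le> n ^ 10" using assms by (simp add: self_le_power)
  then show le: "n \<le> ?b ^ 10" unfolding root10_def by (rule LeastI)
  show "?b \<le> n" unfolding root10_def using n by (rule Least_le)
  show b: "1 \<le> ?b"
  proof (rule ccontr)
    assume "\<not> 1 \<le> ?b"
    then have "?b = 0" by simp
    then show False using le assms by simp
  qed
  show "?b ^ 10 \<le> 1024 * n"
  proof (cases "?b = 1")
    case False
    have "\<not> n \<le> (?b - 1) ^ 10"
      using not_less_Least[of "?b - 1" "\<lambda>b. n \<le> b ^ 10"] b unfolding root10_def[symmetric] by simp
    then have "(?b - 1) ^ 10 \<le> n" by simp
    \<comment> \<open>For a root of at least 2, rounding up at most doubles it, whence 1024 as
      \<open>2 ^ 10\<close>.\<close>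
    moreover have "?b ^ 10 \<le> (2 * (?b - 1)) ^ 10" using False b by (intro power_mono) auto
    ultimately show ?thesis by (simp add: power_mult_distrib)
  qed (use assms in simp)
qed

lemma clog_le: "n \<le> 2 ^ l \<Longrightarrow> clog n \<le> l"
  unfolding clog_def by (rule Least_le)

lemma le_power_clog: "n \<le> 2 ^ clog n"
  unfolding clog_def by (rule LeastI[of _ n]) (simp add: less_imp_le less_exp)

lemma clog_le_log:
  assumes "1 \<le> n"
  shows "clog n \<le> log 2 n + 1"
proof (cases "clog n")
  case 0
  have "0 \<le> log 2 (real n)" using assms by simp
  then show ?thesis using 0 by simp
next
  case (Suc l)
  then have "\<not> n \<le> 2 ^ l"
    using not_less_Least[of l "\<lambda>l. n \<le> 2 ^ l"] unfolding clog_def[symmetric] by simp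
  then have "real (2 ^ l) \<le> real n" by (simp only: of_nat_le_iff)
  then have "l \<le> log 2 n" using assms by (simp add: le_log2_of_power)
  then show ?thesis using Suc by simp
qed

lemma isqrt_bounds: "isqrt n ^ 2 \<le> n" "n < (isqrt n + 1) ^ 2"
proof -
  have "n < (n + 1) ^ 2" by (simp add: power2_eq_square)
  then show "n < (isqrt n + 1) ^ 2" unfolding isqrt_def by (rule LeastI)
  show "isqrt n ^ 2 \<le> n"
  proof (cases "isqrt n")
    case (Suc g)
    then show ?thesis
      using not_less_Least[of g "\<lambda>g. n < (g + 1) ^ 2"] unfolding isqrt_def[symmetric] by simp
  qed simp
qed

section \<open>Solutions of the cost recurrence\<close>

lemma loop_bound_flat:
  assumes "\<And>i. 0 \<le> c i" "\<And>i. i0 \<le> i \<Longrightarrow> c i \<le> r"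
  shows "loop_bound c (\<lambda>i. if i < i0 then 1 else 1 / 8) 0 f i \<le> (\<Sum>j=i..<i0. c j) + 2 * r"
proof (induction f arbitrary: i)
  case 0
  have "0 \<le> r" using assms(1)[of i0] assms(2)[of i0] by linarith
  then show ?case using assms(1) by (simp add: sum_nonneg)
next
  case (Suc f)
  have "0 \<le> r" using assms(1)[of i0] assms(2)[of i0] by linarith
  then show ?case using Suc.IH[of "Suc i"] assms(2)[of i]
    by (cases "i < i0") (auto simp: sum.atLeast_Suc_lessThan)
qed

text \<open>Costs double while the chance of continuing drops to 1/8, so the series converges from
  \<open>i0\<close> on. The subtracted \<open>2 ^ i * K\<close> makes the geometric sum before
  \<open>i0\<close> telescope.\<close>

lemma loop_bound_doubling:
  assumes "\<And>i. c i \<le> 2 ^ i * K" "0 \<le> K"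
  shows "loop_bound c (\<lambda>i. if i < i0 then 1 else 1 / 8) 0 f i
    \<le> (if i < i0 then 3 * 2 ^ i0 * K - 2 ^ i * K else 2 * 2 ^ i * K)"
proof (induction f arbitrary: i)
  case 0
  have "(2::real) ^ i \<le> 3 * 2 ^ i0" if "i < i0"
  proof -
    have "(2::real) ^ i \<le> 2 ^ i0" using that by (intro power_increasing) auto
    also have "\<dots> \<le> 3 * 2 ^ i0" by simp
    finally show ?thesis .
  qed
  then show ?case using assms(2) by (auto intro: mult_right_mono)
next
  case (Suc f)
  consider "i0 \<le> i" | "Suc i = i0" | "Suc i < i0" by linarith
  then show ?case
  proof cases
    case 1
    have "0 \<le> 2 ^ i * K" using assms(2) by simp
    then show ?thesis using Suc.IH[of "Suc i"] assms(1)[of i] 1 by simp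
  next
    case 2
    then show ?thesis using Suc.IH[of "Suc i"] assms(1)[of i] by (auto simp: algebra_simps)
  next
    case 3
    then show ?thesis using Suc.IH[of "Suc i"] assms(1)[of i] by auto
  qed
qed

text \<open>Wrong outputs form a geometric series; the last term bounds the chance that all
  sufficient guesses fail until the fuel is used up.\<close>

lemma loop_bound_halving:
  assumes "\<And>i. c i \<le> d * (1/2) ^ i" "0 \<le> d"
  shows "loop_bound c (\<lambda>i. if i < i0 then 1 else 1 / 8) 1 f i
    \<le> 2 * d * (1/2) ^ i + (1/8) ^ (f - (i0 - i))"
proof (induction f arbitrary: i)
  case 0
  then show ?case using assms(2) by simp
next
  case (Suc f)
  have d: "0 \<le> d * (1/2) ^ i" using assms(2) by simp
  show ?case
  proof (cases "i < i0")
    case True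
    then have "Suc f - (i0 - i) = f - (i0 - Suc i)" by simp
    then show ?thesis using Suc.IH[of "Suc i"] assms(1)[of i] True by simp
  next
    case False
    then show ?thesis using Suc.IH[of "Suc i"] assms(1)[of i] d by simp
  qed
qed

text \<open>The third bound multiplies \<lambda> + \<kappa> / (s + 1) by s + 1, one more than the
  admissible losses. The last one uses \<kappa> = s + (k - \<lambda>) with k - \<lambda> at least 1,
  so that \<kappa> / (s + 1) is at most k - \<lambda>; it limits the number of guesses in terms of
  k.\<close>

lemma hardness_bounds:
  fixes v :: "nat \<Rightarrow> real"
  assumes "finite X" "1 \<le> k" "k \<le> card X"
  defines "w \<equiv> kth_value X v k"
  shows "2 \<le> hardness X v k" "real (card {x\<in>X. v x > w}) \<le> hardness X v k"
    "real (card {x\<in>X. v x \<ge> w}) \<le> hardness X v k * real (card {x\<in>X. v x \<ge> w} - k + 1)"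
    "hardness X v k \<le> max 2 (real k)"
proof -
  define l where "l = card {x\<in>X. v x > w}"
  define t where "t = card {x\<in>X. v x = w}"
  have U: "card {x\<in>X. v x \<ge> w} = l + t"
  proof -
    have "{x\<in>X. v x \<ge> w} = {x\<in>X. v x > w} \<union> {x\<in>X. v x = w}" by auto
    then show ?thesis unfolding l_def t_def using assms(1) by (simp add: card_Un_disjoint disjoint_iff)
  qed
  have k: "l < k" "k \<le> l + t"
    using kth_value_cards[OF assms(1-3), of v] U unfolding l_def w_def by auto
  define s where "s = l + t - k"
  have H: "hardness X v k = max 2 (real l + t / (real s + 1))"
    using k by (simp add: hardness_def slack_def num_above_def num_tied_def l_def t_def w_def s_def of_nat_diff)
  show "2 \<le> hardness X v k" by (simp add: H)
  have "0 \<le> t / (real s + 1)" by simp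
  then show "real (card {x\<in>X. v x > w}) \<le> hardness X v k" unfolding l_def[symmetric] by (simp add: H le_max_iff_disj)
  show "real (card {x\<in>X. v x \<ge> w}) \<le> hardness X v k * real (card {x\<in>X. v x \<ge> w} - k + 1)"
  proof -
    have "real l * 1 \<le> real l * (real s + 1)" by (intro mult_left_mono) auto
    then have "real (l + t) \<le> (real l + t / (real s + 1)) * (real s + 1)"
      by (simp add: field_simps)
    also have "\<dots> \<le> hardness X v k * (real s + 1)" unfolding H by (intro mult_right_mono) auto
    finally show ?thesis unfolding U s_def by (simp add: add.commute)
  qed
  have "real t = real s + (real k - real l)" using k by (simp add: s_def of_nat_diff)
  moreover have "real s * 1 \<le> real s * (real k - real l)" using k by (intro mult_left_mono) auto
  ultimately have "t / (real s + 1) \<le> real k - real l" by (simp add: field_simps)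
  then show "hardness X v k \<le> max 2 (real k)" by (simp add: H)
qed

section \<open>Parameters and costs\<close>

text \<open>
  \<open>root10 n ^ 4\<close> is of order \<open>n\<^bsup>2/5\<^esup>\<close>: all pairs among that many elements cost less than \<open>n\<close>, so
  the pivot rank need only be of order \<open>max k n\<^bsup>2/5\<^esup>\<close>. This keeps the sample small enough for a
  tournament with two rounds.
\<close>

definition width :: "nat \<Rightarrow> nat \<Rightarrow> nat" where
  "width n k = max k (root10 n ^ 4)"

text \<open>With about \<open>n / (100 * width n k)\<close> samples, at most 1/50 of a sample is
  expected at places below \<open>2 * k\<close>, whereas at least 5 are expected among the best
  \<open>2000 * width n k\<close> elements; \<open>exp (- 5)\<close> is below 1/50.\<close>

definition sample_side :: "nat \<Rightarrow> nat \<Rightarrow> nat" where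
  "sample_side n k = isqrt (n div (100 * width n k))"

text \<open>The two strengths containing \<open>2 ^ i\<close> make wrong outputs ever less likely,
  so that these errors are summable over all guesses. The tournament strength does not grow with
  \<open>i\<close>, because a bad pivot can only make a guess fail. Each 7 leaves an error of
  1/128.\<close>

definition guess_at :: "nat set \<Rightarrow> nat \<Rightarrow> nat \<Rightarrow> nat set option prog" where
  "guess_at X k i = (let n = card X; g = sample_side n k; M = 2000 * width n k
     in guess X k (root10 n) g M (clog (2 * g ^ 3) + 7) (2 * clog M + 7 + 2 ^ i) (64 + 2 ^ i))"

text \<open>The threshold is \<open>2 * M * b\<close> with \<open>M = 2000 * width n k\<close>, the
  room demanded by \<open>schedule_abort_weight\<close>. The fuel exceeds the index of the first
  sufficient guess, which is controlled by \<open>k\<close>.\<close>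

definition top_strategy :: "nat set \<Rightarrow> nat \<Rightarrow> strategy pmf" where
  "top_strategy X k = (let n = card X in
     if n < 4000 * width n k * root10 n
     then to_strategy (brute_force X k (2 * clog n + 2)) (\<lambda>S. return_pmf (Output S))
     else guess_loop (guess_at X k) (2 * n + 2) 0)"

lemma half_power_clog:
  assumes "2 * clog n \<le> e"
  shows "real n ^ 2 * (1/2) ^ e \<le> (1/2) ^ (e - 2 * clog n)"
proof -
  have "real n \<le> real (2 ^ clog n)" using le_power_clog[of n] by (simp only: of_nat_le_iff)
  then have "real n ^ 2 \<le> (2 ^ clog n) ^ 2" by (intro power_mono) auto
  then have "real n ^ 2 * (1/2) ^ e \<le> (2 ^ clog n) ^ 2 * (1/2) ^ e" by (rule mult_right_mono) simp
  also have "\<dots> = (1/2) ^ (e - 2 * clog n)"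
    using assms by (simp add: power_diff power_one_over mult.commute flip: power_mult)
  finally show ?thesis .
qed

lemma sample_side_bounds:
  assumes "1 \<le> k" "1 \<le> n" "4000 * width n k * root10 n \<le> n"
  defines "g \<equiv> sample_side n k"
  shows "1 \<le> g" "g * g * (100 * width n k) \<le> n" "n < 400 * width n k * (g * g)" "g \<le> root10 n ^ 3"
proof -
  let ?K = "width n k" let ?m = "n div (100 * ?K)" let ?b = "root10 n"
  note b = root10_bounds[OF assms(2)]
  have K: "1 \<le> ?K" using assms(1) by (simp add: width_def)
  have "4000 * ?K * 1 \<le> 4000 * ?K * ?b" using b by (intro mult_left_mono) auto
  then have "4000 * ?K \<le> n" using assms(3) by linarith
  then have m: "1 \<le> ?m" using K by (simp add: less_eq_div_iff_mult_less_eq)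
  have g: "g * g \<le> ?m" "?m < (g + 1) * (g + 1)"
    using isqrt_bounds[of ?m] unfolding g_def sample_side_def power2_eq_square by auto
  show g1: "1 \<le> g"
  proof (rule ccontr)
    assume "\<not> 1 \<le> g"
    then have "g = 0" by simp
    then show False using g m by simp
  qed
  have "g * g * (100 * ?K) \<le> ?m * (100 * ?K)" using g by (intro mult_right_mono) auto
  also have "\<dots> \<le> n" by simp
  finally show gn: "g * g * (100 * ?K) \<le> n" .
  have "n < (?m + 1) * (100 * ?K)"
    using dividend_less_div_times[of "100 * ?K" n] K by (simp add: algebra_simps)
  also have "\<dots> \<le> ((g + 1) * (g + 1)) * (100 * ?K)" using g by (intro mult_right_mono) auto
  \<comment> \<open>Rounding the root down is covered by \<open>g + 1 \<le> 2 * g\<close>; this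
    turns 100 into 400.\<close>
  also have "\<dots> \<le> ((2 * g) * (2 * g)) * (100 * ?K)" using g1 by (intro mult_right_mono mult_mono) auto
  finally show "n < 400 * ?K * (g * g)" by (simp add: algebra_simps)
  \<comment> \<open>The width is at least \<open>?b ^ 4\<close>, which cancels against
    \<open>n \<le> ?b ^ 10\<close> and leaves \<open>g \<le> ?b ^ 3\<close>.\<close>
  have "g * g * ?b ^ 4 \<le> g * g * (100 * ?K)" by (intro mult_left_mono) (auto simp: width_def)
  also have "\<dots> \<le> ?b ^ 10" using gn b(1) by linarith
  also have "\<dots> = ?b ^ 6 * ?b ^ 4" by (simp flip: power_add)
  finally have "g * g \<le> ?b ^ 6" by (rule mult_right_le_imp_le) (use b(3) in simp)
  also have "\<dots> = ?b ^ 3 * ?b ^ 3" by (simp flip: power_add)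
  finally have "g ^ 2 \<le> (?b ^ 3) ^ 2" by (simp only: power2_eq_square)
  then show "g \<le> ?b ^ 3" by (rule power2_le_imp_le) simp
qed

lemma sample_misses_small:
  assumes "1 \<le> k" "1 \<le> n" "4000 * width n k * root10 n \<le> n"
  defines "g \<equiv> sample_side n k"
  shows "(1 - real (2000 * width n k) / real n) ^ (g * g) \<le> 1 / 50"
proof -
  let ?K = "width n k" let ?x = "real (2000 * ?K) / real n"
  note g = sample_side_bounds[OF assms(1-3), folded g_def]
  have "4000 * ?K * 1 \<le> 4000 * ?K * root10 n"
    using root10_bounds[OF assms(2)] by (intro mult_left_mono) auto
  then have "2000 * ?K \<le> n" using assms(3) by linarith
  then have "real (2000 * ?K) \<le> real n" by (simp only: of_nat_le_iff)
  then have x: "?x \<le> 1" using assms(2) by (simp add: divide_le_eq_1)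
  have "real n \<le> real (400 * ?K * (g * g))" using g(3) by (simp only: of_nat_le_iff)
  \<comment> \<open>The quotient 2000 / 400, the expected number of useful samples; it becomes the
    exponent below.\<close>
  then have "5 \<le> real (g * g) * ?x" using assms(2) by (simp add: field_simps)
  have "(1 - ?x) ^ (g * g) \<le> exp (- ?x) ^ (g * g)"
    using x exp_ge_add_one_self[of "- ?x"] by (intro power_mono) auto
  also have "\<dots> = exp (- (real (g * g) * ?x))" by (simp only: exp_of_nat_mult[symmetric] mult_minus_right)
  also have "\<dots> \<le> exp (- 5)" using \<open>5 \<le> real (g * g) * ?x\<close> by simp
  also have "\<dots> \<le> 1 / 50"
  proof -
    have "1 + 1 + 1\<^sup>2 / 2 \<le> exp (1::real)" by (rule exp_lower_Taylor_quadratic) simp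
    then have "(5/2) ^ 5 \<le> exp (1::real) ^ 5" by (intro power_mono) auto
    also have "exp (1::real) ^ 5 = exp 5" by (simp flip: exp_of_nat_mult)
    finally have "50 \<le> exp (5::real)" by (simp add: field_simps)
    then show ?thesis by (simp add: exp_minus field_simps)
  qed
  finally show ?thesis .
qed

section \<open>Budgets of a single guess\<close>

definition query_cap :: "nat \<Rightarrow> nat \<Rightarrow> nat \<Rightarrow> nat" where
  "query_cap n k i = (let g = sample_side n k; M = 2000 * width n k in
     24 * (clog (2 * g ^ 3) + 7) * g ^ 3 + 2 * (216 * (64 + 2 ^ i) * n + n)
     + 12 * (2 * clog M + 7 + 2 ^ i) * M ^ 2)"

text \<open>The 3 counts the two tournament rounds and the round that compares all pairs of
  survivors.\<close>

definition round_cap :: "nat \<Rightarrow> nat \<Rightarrow> nat \<Rightarrow> nat" where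
  "round_cap n k i = 3 + length (schedule (root10 n) n (2000 * width n k) (64 + 2 ^ i))
     + length (schedule (root10 n) n 0 (64 + 2 ^ i))"

lemma clog_mult_power_le:
  assumes "x \<le> 2 ^ p * y ^ q"
  shows "clog x \<le> p + q * clog y"
proof (rule clog_le)
  have "y ^ q \<le> (2 ^ clog y) ^ q" by (intro power_mono le_power_clog) simp
  then have "2 ^ p * y ^ q \<le> 2 ^ p * (2 ^ clog y) ^ q" by simp
  also have "\<dots> = 2 ^ (p + q * clog y)" by (simp add: power_add mult.commute flip: power_mult)
  finally show "x \<le> 2 ^ (p + q * clog y)" using assms by linarith
qed

lemma clog_le_self: "clog n \<le> n"
  by (rule clog_le) (simp add: less_imp_le less_exp)

text \<open>This absorbs \<open>log 2 H\<close> times the logarithm from comparing all pairs of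
  survivors into one factor \<open>k\<close>. Passing to the square root lets each of the two
  logarithms cost only a multiple of \<open>sqrt k\<close>.\<close>

lemma log2_square_le:
  assumes "1 \<le> k"
  shows "(1 + log 2 (real k)) ^ 2 \<le> 9 * k"
proof -
  have "log 2 (real k) = 2 * log 2 (sqrt k)" using assms by (simp add: log_def ln_sqrt)
  also have "log 2 (sqrt k) \<le> sqrt k"
  proof (cases "2 \<le> sqrt k")
    case True
    then show ?thesis using log_le_minus_one[of "sqrt k" 2] by simp
  next
    case False
    then have "log 2 (sqrt k) \<le> 1" using assms by (simp add: log_le_one_cancel_iff)
    moreover have "1 \<le> sqrt k" using assms by simp
    ultimately show ?thesis by linarith
  qed
  finally have "1 + log 2 (real k) \<le> 3 * sqrt k" using assms
    by (smt (verit) of_nat_1 of_nat_le_iff real_sqrt_ge_one)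
  then have "(1 + log 2 (real k)) ^ 2 \<le> (3 * sqrt k) ^ 2" using assms by (intro power_mono) auto
  then show ?thesis by (simp add: power_mult_distrib)
qed

text \<open>The factor \<open>2 ^ i\<close> is pulled out for the doubling recurrence. With
  \<open>b = root10 n\<close>, the tournament costs of order \<open>b ^ 9 * b\<close>. The pairs of
  survivors cost \<open>k ^ 2\<close> times a logarithm if \<open>k\<close> determines the width,
  and of order \<open>b ^ 8 * b\<close> otherwise; \<open>b ^ 10\<close> is of order
  \<open>n\<close>.\<close>

lemma query_cap_le:
  assumes "1 \<le> k" "1 \<le> n" "4000 * width n k * root10 n \<le> n"
  shows "real (query_cap n k i) \<le> 2 ^ i * (2 * 10 ^ 12 * (real n + real k ^ 2 * (1 + log 2 k)))"
proof -
  let ?b = "root10 n" let ?K = "width n k" let ?g = "sample_side n k" let ?M = "2000 * ?K"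
  note b = root10_bounds[OF assms(2)]
  note g = sample_side_bounds[OF assms]
  have lb: "clog ?b \<le> ?b" by (rule clog_le_self)
  have i1: "1 \<le> (2::nat) ^ i" by simp
  have g3: "?g ^ 3 \<le> ?b ^ 9" using power_mono[OF g(4), of 3] by (simp flip: power_mult)
  have 1: "24 * (clog (2 * ?g ^ 3) + 7) * ?g ^ 3 \<le> 417792 * n"
  proof -
    have "clog (2 * ?g ^ 3) \<le> 1 + 9 * clog ?b" using g3 by (intro clog_mult_power_le) simp
    then have "clog (2 * ?g ^ 3) + 7 \<le> 17 * ?b" using lb b(3) by linarith
    then have "24 * (clog (2 * ?g ^ 3) + 7) * ?g ^ 3 \<le> 24 * (17 * ?b) * ?b ^ 9"
      using g3 by (intro mult_mono) auto
    also have "\<dots> = 408 * ?b ^ 10" by (simp add: power_numeral_reduce)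
    finally show ?thesis using b(2) by linarith
  qed
  have 2: "2 * (216 * (64 + 2 ^ i) * n + n) \<le> 2 ^ i * (28082 * n)"
  proof -
    have "64 + 2 ^ i \<le> 65 * (2::nat) ^ i" using i1 by linarith
    then have "216 * (64 + 2 ^ i) * n \<le> 216 * (65 * 2 ^ i) * n" by (intro mult_mono) auto
    moreover have "1 * n \<le> 2 ^ i * n" using i1 by (intro mult_right_mono) auto
    ultimately have "2 * (216 * (64 + 2 ^ i) * n + n) \<le> 2 * (216 * (65 * 2 ^ i) * n + 2 ^ i * n)"
      by (intro mult_left_mono add_mono) simp_all
    also have "\<dots> = 2 ^ i * (28082 * n)" by (simp add: algebra_simps)
    finally show ?thesis .
  qed
  have 3: "12 * (2 * clog ?M + 7 + 2 ^ i) * ?M ^ 2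
      \<le> 2 ^ i * (48000000 * ((30 + 2 * clog k) * k ^ 2 + 38912 * n))"
  proof -
    have "clog ?M \<le> 11 + 1 * clog ?K" by (intro clog_mult_power_le) simp
    then have "2 * clog ?M + 7 + 2 ^ i \<le> 2 ^ i * (30 + 2 * clog ?K)"
    proof -
      assume a: "clog ?M \<le> 11 + 1 * clog ?K"
      have "1 * (29 + 2 * clog ?K) \<le> 2 ^ i * (29 + 2 * clog ?K)" using i1 by (intro mult_right_mono) auto
      then show ?thesis using a by (simp add: algebra_simps)
    qed
    then have "12 * (2 * clog ?M + 7 + 2 ^ i) * ?M ^ 2 \<le> 12 * (2 ^ i * (30 + 2 * clog ?K)) * ?M ^ 2"
      by (intro mult_mono) auto
    also have "\<dots> = 2 ^ i * (48000000 * ((30 + 2 * clog ?K) * ?K ^ 2))"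
      by (simp add: power_mult_distrib)
    also have "(30 + 2 * clog ?K) * ?K ^ 2 \<le> (30 + 2 * clog k) * k ^ 2 + 38912 * n"
    proof (cases "?b ^ 4 \<le> k")
      case True
      then show ?thesis by (simp add: width_def max_absorb1)
    next
      case False
      then have K: "?K = ?b ^ 4" by (simp add: width_def)
      have "clog ?K \<le> 0 + 4 * clog ?b" unfolding K by (intro clog_mult_power_le) simp
      then have "30 + 2 * clog ?K \<le> 38 * ?b" using lb b(3) by linarith
      then have "(30 + 2 * clog ?K) * ?K ^ 2 \<le> 38 * ?b * ?K ^ 2" by (rule mult_right_mono) simp
      also have "\<dots> = 38 * ?b ^ 9" unfolding K by (simp add: power_numeral_reduce)
      also have "\<dots> \<le> 38 * ?b ^ 10" using b(3) by (intro mult_left_mono power_increasing) auto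
      finally show ?thesis using b(2) by linarith
    qed
    finally show ?thesis by simp
  qed
  have "query_cap n k i \<le> 2 ^ i * (417792 * n + 28082 * n
      + 48000000 * ((30 + 2 * clog k) * k ^ 2 + 38912 * n))"
  proof -
    have "1 * (417792 * n) \<le> 2 ^ i * (417792 * n)" using i1 by (intro mult_right_mono) auto
    then show ?thesis using 1 2 3 unfolding query_cap_def Let_def distrib_left by linarith
  qed
  then have "real (query_cap n k i) \<le> real (2 ^ i * (417792 * n + 28082 * n
      + 48000000 * ((30 + 2 * clog k) * k ^ 2 + 38912 * n)))" by (simp only: of_nat_le_iff)
  \<comment> \<open>The large coefficient is
    \<open>417792 + 28082 + 48000000 * 38912\<close>.\<close>
  also have "\<dots> = 2 ^ i * (1867776445874 * real n + 48000000 * ((30 + 2 * real (clog k)) * real k ^ 2))"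
    by (simp add: algebra_simps)
  also have "\<dots> \<le> 2 ^ i * (2 * 10 ^ 12 * (real n + real k ^ 2 * (1 + log 2 k)))"
  proof (rule mult_left_mono)
    have "0 \<le> log 2 (real k)" using assms(1) by simp
    then have "30 + 2 * real (clog k) \<le> 32 * (1 + log 2 k)" 
      using clog_le_log[OF assms(1)] unfolding distrib_left by linarith
    then have "(30 + 2 * real (clog k)) * real k ^ 2 \<le> 32 * (1 + log 2 k) * real k ^ 2"
      by (rule mult_right_mono) simp
    moreover have "0 \<le> (1 + log 2 k) * real k ^ 2" using \<open>0 \<le> log 2 (real k)\<close> by simp
    ultimately show "1867776445874 * real n + 48000000 * ((30 + 2 * real (clog k)) * real k ^ 2)
      \<le> 2 * 10 ^ 12 * (real n + real k ^ 2 * (1 + log 2 k))" by (simp add: algebra_simps)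
  qed simp
  finally show ?thesis .
qed

text \<open>Let \<open>b = root10 n\<close>. If the width is \<open>k\<close>, then
  \<open>n ^ 3\<close> is of order at most \<open>k ^ 3 * b ^ 3\<close>, and replacing one factor
  \<open>n\<close> by \<open>b ^ 10\<close> gives \<open>b ^ 7 * n ^ 2\<close> of order
  \<open>k ^ 3\<close>, more than enough. If the width is \<open>b ^ 4\<close>, the threshold bounds
  \<open>b\<close>, and with it \<open>n\<close>, by a constant.\<close>

lemma brute_force_cost:
  assumes "1 \<le> k" "1 \<le> n" "n < 4000 * width n k * root10 n"
  shows "12 * (2 * clog n + 2) * n ^ 2 \<le> 10 ^ 17 * (n + k ^ 3)"
proof -
  let ?b = "root10 n" let ?K = "width n k"
  note b = root10_bounds[OF assms(2)]
  have "clog n \<le> 0 + 10 * clog ?b" using b(1) by (intro clog_mult_power_le) simp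
  then have "2 * clog n + 2 \<le> 22 * ?b" using clog_le_self[of ?b] b(3) by linarith
  then have "12 * (2 * clog n + 2) \<le> 264 * ?b" by simp
  then have "12 * (2 * clog n + 2) * n ^ 2 \<le> 264 * ?b * n ^ 2" by (rule mult_right_mono) simp
  also have "\<dots> \<le> 10 ^ 17 * (n + k ^ 3)"
  proof (cases "?b ^ 4 \<le> k")
    case True
    then have n: "n < 4000 * k * ?b" using assms(3) by (simp add: width_def max_absorb1)
    have "?b ^ 7 * ?b ^ 3 * n ^ 2 = ?b ^ 10 * n ^ 2" by (simp flip: power_add)
    also have "\<dots> \<le> (1024 * n) * n ^ 2" using b(2) by (intro mult_right_mono) auto
    also have "\<dots> = 1024 * n ^ 3" by (simp add: power_numeral_reduce)
    also have "\<dots> \<le> 1024 * (4000 * k * ?b) ^ 3" using n by (intro mult_left_mono power_mono) auto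
    also have "\<dots> = (65536000000000 * k ^ 3) * ?b ^ 3" by (simp add: power_mult_distrib)
    finally have "?b ^ 7 * n ^ 2 * ?b ^ 3 \<le> (65536000000000 * k ^ 3) * ?b ^ 3" by (simp add: mult_ac)
    then have "?b ^ 7 * n ^ 2 \<le> 65536000000000 * k ^ 3" using b(3) by simp
    moreover have "?b ^ 1 * n ^ 2 \<le> ?b ^ 7 * n ^ 2"
      using b(3) by (intro mult_right_mono power_increasing) auto
    ultimately have "?b ^ 1 * n ^ 2 \<le> 65536000000000 * k ^ 3" by (rule order_trans[rotated])
    then show ?thesis by simp
  next
    case False
    then have n: "n < 4000 * ?b ^ 5" using assms(3) by (simp add: width_def power_numeral_reduce)
    have "?b ^ 5 * ?b ^ 5 = ?b ^ 10" by (simp flip: power_add)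
    also have "\<dots> \<le> 1024 * n" by (rule b(2))
    also have "\<dots> \<le> 4096000 * ?b ^ 5" using n by simp
    finally have b5: "?b ^ 5 \<le> 4096000" by (rule mult_right_le_imp_le) (use b(3) in simp)
    \<comment> \<open>\<open>22 ^ 5\<close> is 5153632, above 4096000.\<close>
    have "?b < 22"
    proof (rule ccontr)
      assume "\<not> ?b < 22"
      then have "22 ^ 5 \<le> ?b ^ 5" by (intro power_mono) auto
      then show False using b5 by simp
    qed
    then have "?b * n \<le> 22 * (4000 * 4096000)" using n b5 by (intro mult_mono) auto
    then have "?b * n * n \<le> 22 * (4000 * 4096000) * n" by (rule mult_right_mono) simp
    then have "264 * (?b * n * n) \<le> 264 * (22 * (4000 * 4096000) * n)" by (rule mult_left_mono) simp
    also have "\<dots> \<le> 10 ^ 17 * (n + k ^ 3)" by simp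
    finally show ?thesis by (simp add: power2_eq_square mult.assoc)
  qed
  finally show ?thesis .
qed

section \<open>The top-k strategy\<close>

lemma safe_guess_at:
  assumes "finite X" "1 \<le> k" "k \<le> card X" "4000 * width (card X) k * root10 (card X) \<le> card X"
  shows "safe X (guess_at X k i) (query_cap (card X) k i) (round_cap (card X) k i) (\<lambda>_. True)"
proof -
  have "1 \<le> card X" using assms by linarith
  then have "X \<noteq> {}" "1 \<le> sample_side (card X) k"
    using sample_side_bounds(1)[OF assms(2) _ assms(4)] by auto
  then show ?thesis unfolding guess_at_def Let_def
    by (intro safe_guess assms(1)) (auto simp: query_cap_def round_cap_def Let_def)
qed

lemma guess_at_errors:
  assumes "finite X" "1 \<le> k" "k \<le> card X" "4000 * width (card X) k * root10 (card X) \<le> card X"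
  shows "wp v adv (guess_at X k i) (\<lambda>out. of_bool (\<exists>S. out = Some S \<and> \<not> is_top X v k S))
      \<le> ennreal (1 / 64 * (1/2) ^ i)"
    and "log 2 (hardness X v k) \<le> 2 ^ i
      \<Longrightarrow> wp v adv (guess_at X k i) (\<lambda>out. of_bool (out = None)) \<le> ennreal (1 / 8)"
proof -
  let ?n = "card X" let ?K = "width ?n k" let ?b = "root10 ?n" let ?M = "2000 * ?K"
  let ?g = "sample_side ?n k" let ?u = "64 + 2 ^ i :: nat"
  let ?ut = "clog (2 * ?g ^ 3) + 7" let ?ub = "2 * clog ?M + 7 + 2 ^ i"
  have n1: "1 \<le> ?n" using assms by linarith
  then have X: "X \<noteq> {}" by auto
  note g = sample_side_bounds[OF assms(2) n1 assms(4)]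
  note b = root10_bounds[OF n1]
  have i: "(1/2 :: real) ^ 2 ^ i \<le> (1/2) ^ i"
    by (intro power_decreasing) (auto simp: less_imp_le less_exp)
  have ub: "real ?M ^ 2 * (1/2) ^ ?ub \<le> 1 / 128 * (1/2) ^ 2 ^ i"
  proof -
    have "real ?M ^ 2 * (1/2) ^ (2 * clog ?M + 7) \<le> 1 / 128"
      using half_power_clog[of ?M "2 * clog ?M + 7"] by (simp add: power_one_over)
    then have "real ?M ^ 2 * (1/2) ^ (2 * clog ?M + 7) * (1/2) ^ 2 ^ i \<le> 1 / 128 * (1/2) ^ 2 ^ i"
      by (rule mult_right_mono) simp
    then show ?thesis unfolding power_add[of _ "2 * clog ?M + 7" "2 ^ i"] by (simp only: mult.assoc)
  qed
  have "wp v adv (guess_at X k i) (\<lambda>out. of_bool (\<exists>S. out = Some S \<and> \<not> is_top X v k S))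
      \<le> ennreal (real ?M ^ 2 * (1/2) ^ ?ub + 2 * (1/2) ^ ?u)"
    unfolding guess_at_def Let_def by (rule wp_guess_wrong) (use assms X g in auto)
  also have "\<dots> \<le> ennreal (1 / 64 * (1/2) ^ i)"
  proof (rule ennreal_leI)
    have "2 * (1/2 :: real) ^ ?u = 1 / 2 ^ 63 * (1/2) ^ 2 ^ i" by (simp add: power_add power_one_over)
    also have "\<dots> \<le> 1 / 128 * (1/2) ^ 2 ^ i" by (intro mult_right_mono) auto
    finally show "real ?M ^ 2 * (1/2) ^ ?ub + 2 * (1/2) ^ ?u \<le> 1 / 64 * (1/2) ^ i"
      using ub i by linarith
  qed
  finally show "wp v adv (guess_at X k i) (\<lambda>out. of_bool (\<exists>S. out = Some S \<and> \<not> is_top X v k S))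
      \<le> ennreal (1 / 64 * (1/2) ^ i)" .
  assume Hi: "log 2 (hardness X v k) \<le> 2 ^ i"
  let ?H = "hardness X v k"
  note H = hardness_bounds[OF assms(1-3), of v]
  note w = kth_value_cards[OF assms(1-3), of v]
  have "?H = 2 powr log 2 ?H" using H(1) by simp
  also have "\<dots> \<le> 2 powr (real (2 ^ i))" using Hi by (intro powr_mono) auto
  finally have H2: "?H \<le> 2 ^ 2 ^ i" by (simp only: powr_realpow zero_less_numeral)
  have K: "1 \<le> ?K" "k \<le> ?K" using assms(2) by (auto simp: width_def)
  have "4000 * ?K * 1 \<le> 4000 * ?K * ?b" using b by (intro mult_left_mono) auto
  then have M: "2 * ?M \<le> ?n" using assms(4) by linarith
  show "wp v adv (guess_at X k i) (\<lambda>out. of_bool (out = None)) \<le> ennreal (1 / 8)"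
    unfolding guess_at_def Let_def
  proof (rule wp_guess_None[OF assms(1,2) g(1) _ w H(1,2,3)])
    \<comment> \<open>The summand 64 in \<open>?u\<close> leaves \<open>2 / 2 ^ 64\<close> once
      \<open>2 ^ 2 ^ i\<close> has been paid for the hardness.\<close>
    have "?H * (2 * (1/2) ^ ?u) \<le> 2 ^ 2 ^ i * (2 * (1/2) ^ ?u)" using H2 by (intro mult_right_mono) auto
    also have "\<dots> = 1 / 2 ^ 63" by (simp add: power_add power_one_over)
    also have "\<dots> \<le> 1 / 100" by simp
    finally show "?H * (2 * (1/2) ^ ?u) \<le> 1 / 100" .
    show "2 * ?M * ?b \<le> ?n" using assms(4) by simp
    show "?n \<le> ?b ^ 10" by (rule b(1))
    show "?M < ?n" using M K by linarith
    show "(1 - real ?M / real ?n) ^ (?g * ?g) \<le> 1 / 50"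
      by (rule sample_misses_small[OF assms(2) n1 assms(4)])
    show "real (?g * ?g * (2 * k)) / real ?n \<le> 1 / 50"
    proof -
      have "?g * ?g * (100 * k) \<le> ?g * ?g * (100 * ?K)" using K by (intro mult_left_mono) auto
      then have "?g * ?g * (100 * k) \<le> ?n" using g(2) by linarith
      then have "real (?g * ?g * (100 * k)) \<le> real ?n" by (simp only: of_nat_le_iff)
      then show ?thesis using n1 by (simp add: field_simps)
    qed
    show "2 * real ?g ^ 3 * (1/2) ^ ?ut \<le> 1 / 100"
    proof -
      have "real (2 * ?g ^ 3) \<le> real (2 ^ clog (2 * ?g ^ 3))"
        using le_power_clog[of "2 * ?g ^ 3"] by (simp only: of_nat_le_iff)
      then have "2 * real ?g ^ 3 * (1/2) ^ ?ut \<le> 2 ^ clog (2 * ?g ^ 3) * (1/2) ^ ?ut"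
        by (intro mult_right_mono) auto
      also have "\<dots> = 1 / 128" by (simp add: power_add power_one_over)
      finally show ?thesis by simp
    qed
    have "(1/2 :: real) ^ 2 ^ i \<le> 1" by (intro power_le_one) auto
    then show "real ?M ^ 2 * (1/2) ^ ?ub \<le> 1 / 100" using ub by linarith
  qed simp
qed

text \<open>\<open>i0\<close> is the first guess that reaches \<open>H\<close>. Minimality bounds
  \<open>2 ^ i0\<close> by about \<open>log 2 H\<close>, which limits the cost, and
  \<open>i0\<close> by about its logarithm, which limits the number of guesses.\<close>

lemma hardness_exponent:
  assumes "2 \<le> (H :: real)"
  obtains i0 :: nat where "log 2 H \<le> 2 ^ i0" "2 ^ i0 \<le> 2 * log 2 H"
    "real i0 + 1 \<le> 3 * max 1 (log 2 (log 2 H))"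
proof -
  have h: "1 \<le> log 2 H" using assms by simp
  define i0 where "i0 = (LEAST i. log 2 H \<le> 2 ^ i)"
  have "\<exists>i. log 2 H \<le> 2 ^ i" using real_arch_pow[of 2 "log 2 H"] by (auto intro: less_imp_le)
  then have 1: "log 2 H \<le> 2 ^ i0" unfolding i0_def by (rule LeastI_ex)
  have "2 ^ i0 \<le> 2 * log 2 H \<and> real i0 + 1 \<le> 3 * max 1 (log 2 (log 2 H))"
  proof (cases i0)
    case 0
    then show ?thesis using h by simp
  next
    case (Suc j)
    then have j: "2 ^ j < log 2 H"
      using not_less_Least[of j "\<lambda>i. log 2 H \<le> 2 ^ i"] unfolding i0_def[symmetric] by simp
    then have "real j \<le> log 2 (log 2 H)" by (intro less_imp_le less_log_of_power) auto
    then show ?thesis using Suc j by auto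
  qed
  then show ?thesis using 1 that by blast
qed

lemma log2_hardness_le:
  assumes "finite X" "1 \<le> k" "k \<le> card X"
  shows "log 2 (hardness X v k) \<le> 1 + log 2 k"
proof -
  note H = hardness_bounds[OF assms, of v]
  have "hardness X v k \<le> 2 * k" using H(4) assms(2) by auto
  then have "log 2 (hardness X v k) \<le> log 2 (2 * k)" using H(1) assms(2) by simp
  also have "\<dots> = 1 + log 2 k" using assms(2) by (simp add: log_mult)
  finally show ?thesis .
qed

text \<open>From \<open>i0\<close> on the strength starts above \<open>log 2 H\<close>, so
  \<open>2 * L\<close> boosts reach \<open>n\<close>, hence also \<open>root10 n\<close>; two
  schedules of length at most \<open>2 * L + 1\<close> and three further rounds give the first
  bound.\<close>

lemma sum_round_caps:
  assumes "1 \<le> n" "2 \<le> H" "log 2 H \<le> 2 ^ i0"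
  defines "L \<equiv> log_star H n"
  shows "i0 \<le> i \<Longrightarrow> round_cap n k i \<le> 4 * L + 5"
    and "(\<Sum>j<i0. round_cap n k j) \<le> (4 * L + 71) * (i0 + 1)"
proof -
  let ?b = "root10 n" let ?u = "64 + 2 ^ i0 :: nat"
  note ls = boost_iter_log_star[OF assms(2,1), of ?u, folded L_def]
  have u: "log 2 H \<le> ?u" using assms(3) by simp
  have "?b \<le> n" by (rule root10_bounds[OF assms(1)])
  also have "n \<le> (boost ^^ (2 * L)) ?u" using ls u by simp
  also have "\<dots> \<le> 2 ^ ((boost ^^ (2 * L)) ?u)" by (simp add: less_imp_le less_exp)
  finally have b: "?b \<le> 2 ^ ((boost ^^ (2 * L)) ?u)" .
  show "round_cap n k i \<le> 4 * L + 5" if "i0 \<le> i"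
  proof -
    have "(2::nat) ^ i0 \<le> 2 ^ i" using that by (intro power_increasing) auto
    then have "length (schedule ?b n M (64 + 2 ^ i)) \<le> 2 * L + 1" for M
      by (intro length_schedule[OF _ _ b]) auto
    from this[of 0] this[of "2000 * width n k"] show ?thesis by (simp add: round_cap_def)
  qed
  have "(\<Sum>j<i0. round_cap n k j) \<le> (\<Sum>j\<le>i0. round_cap n k j)" by (intro sum_mono2) auto
  also have "\<dots> = 3 * (i0 + 1) + (\<Sum>j\<le>i0. length (schedule ?b n (2000 * width n k) (64 + 2 ^ j)))
      + (\<Sum>j\<le>i0. length (schedule ?b n 0 (64 + 2 ^ j)))"
    by (simp add: round_cap_def sum.distrib)
  also have "\<dots> \<le> 3 * (i0 + 1) + (2 * L + 34) * (i0 + 1) + (2 * L + 34) * (i0 + 1)"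
    by (intro add_mono order_refl sum_length_schedules b)
  also have "\<dots> = (4 * L + 71) * (i0 + 1)" by (simp add: algebra_simps)
  finally show "(\<Sum>j<i0. round_cap n k j) \<le> (4 * L + 71) * (i0 + 1)" .
qed

lemma top_strategy_guessing:
  fixes v adv
  assumes "finite X" "1 \<le> k" "k \<le> card X" "4000 * width (card X) k * root10 (card X) \<le> card X"
  defines "H \<equiv> hardness X v k"
  defines "A \<equiv> guess_loop (guess_at X k) (2 * card X + 2) 0"
  shows "success_prob v adv (is_top X v k) A \<ge> 2 / 3"
    and "expected_queries v adv A \<le> ennreal (10 ^ 15 * (real (card X) * log 2 H + real k ^ 3))"
    and "expected_rounds v adv A
      \<le> ennreal (300 * (max 1 (log 2 (log 2 H)) * real (log_star H (real (card X)))))"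
proof -
  let ?n = "card X" let ?G = "guess_at X k" let ?P = "is_top X v k"
  have n1: "1 \<le> ?n" using assms by linarith
  have H: "2 \<le> H" using hardness_bounds[OF assms(1-3), of v] by (simp add: H_def)
  obtain i0 :: nat where i0: "log 2 H \<le> 2 ^ i0" "2 ^ i0 \<le> 2 * log 2 H"
    "real i0 + 1 \<le> 3 * max 1 (log 2 (log 2 H))"
    using hardness_exponent[OF H] by blast
  \<comment> \<open>Insufficient guesses get the trivial bound 1: they may well fail, and only their
    cost matters.\<close>
  define p where "p = (\<lambda>i. if i < i0 then 1 else 1 / 8 :: real)"
  have none: "wp v adv (?G i) (\<lambda>out. of_bool (out = None)) \<le> ennreal (p i)" for i
  proof (cases "i < i0")
    case True
    have "wp v adv (?G i) (\<lambda>out. of_bool (out = None)) \<le> 1" by (rule wp_le_const) simp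
    then show ?thesis using True by (simp add: p_def)
  next
    case False
    then have "(2::real) ^ i0 \<le> 2 ^ i" by (intro power_increasing) auto
    then have "log 2 H \<le> 2 ^ i" using i0(1) by linarith
    then show ?thesis using False guess_at_errors(2)[OF assms(1-4), of v i adv] by (simp add: p_def H_def)
  qed
  note cost = cost_guess_loop[where G = ?G and P = ?P and i = 0 and p = p,
      OF safe_guess_at[OF assms(1-4)] none guess_at_errors(1)[OF assms(1-4)]]
  have pos: "0 \<le> p i" for i by (simp add: p_def)

  \<comment> \<open>A cut-off at the total round budget of all guesses interrupts no run.\<close>
  let ?T = "\<Sum>j<2 * ?n + 2. round_cap ?n k (0 + j)"
  have "cost_to_go v adv ?P (ennreal 0) (ennreal 0) (ennreal 1) ?T [] A
      \<le> ennreal (loop_bound (\<lambda>i. 0 * real (query_cap ?n k i) + 0 * real (round_cap ?n k i) + 1 * (1 / 64 * (1/2) ^ i)) p 1 (2 * ?n + 2) 0)"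
    unfolding A_def by (rule cost) (use pos in auto)
  also have "\<dots> \<le> ennreal (1 / 3)"
  proof (rule ennreal_leI)
    \<comment> \<open>The fuel reaches at least one sufficient guess, because \<open>i0\<close> is
      below \<open>2 * k + 2\<close>; the failure of such a guess accounts for the 1/8.\<close>
    have "i0 < 2 ^ i0" by (rule less_exp)
    then have "real i0 < real (2 ^ i0)" by (simp only: of_nat_less_iff)
    also have "\<dots> \<le> 2 * log 2 H" using i0(2) by simp
    also have "\<dots> \<le> 2 * (1 + log 2 k)" using log2_hardness_le[OF assms(1-3), of v] by (simp add: H_def)
    also have "log 2 k \<le> k"
      by (rule log2_of_power_le) (use assms(2) in \<open>auto simp: less_imp_le less_exp\<close>)
    finally have "i0 < 2 + 2 * k" by simp
    then have f: "1 \<le> 2 * ?n + 2 - (i0 - 0)" using assms(3) by simp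
    have "loop_bound (\<lambda>i. 0 * real (query_cap ?n k i) + 0 * real (round_cap ?n k i) + 1 * (1 / 64 * (1/2) ^ i)) p 1 (2 * ?n + 2) 0
        \<le> 2 * (1 / 64) * (1/2) ^ 0 + (1/8) ^ (2 * ?n + 2 - (i0 - 0))"
      unfolding p_def by (rule loop_bound_halving) auto
    also have "(1/8 :: real) ^ (2 * ?n + 2 - (i0 - 0)) \<le> (1/8) ^ 1" using f by (intro power_decreasing) auto
    finally show "loop_bound (\<lambda>i. 0 * real (query_cap ?n k i) + 0 * real (round_cap ?n k i) + 1 * (1 / 64 * (1/2) ^ i)) p 1 (2 * ?n + 2) 0
        \<le> 1 / 3" by simp
  qed
  finally have "success_prob v adv ?P A \<ge> 1 - 1 / 3"
    by (intro success_prob_ge) auto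
  then show "success_prob v adv ?P A \<ge> 2 / 3" by simp

  define K where "K = 2 * 10 ^ 12 * (real ?n + real k ^ 2 * (1 + log 2 k))"
  have k0: "0 \<le> log 2 (real k)" using assms(2) by simp
  then have K0: "0 \<le> K" by (simp add: K_def)
  show "expected_queries v adv A \<le> ennreal (10 ^ 15 * (real ?n * log 2 H + real k ^ 3))"
  proof (rule expected_queries_le)
    fix t
    have "cost_to_go v adv ?P (ennreal 1) (ennreal 0) (ennreal 0) t [] A
        \<le> ennreal (loop_bound (\<lambda>i. 1 * real (query_cap ?n k i) + 0 * real (round_cap ?n k i) + 0 * (1 / 64 * (1/2) ^ i)) p 0 (2 * ?n + 2) 0)"
      unfolding A_def by (rule cost) (use pos in auto)
    also have "\<dots> \<le> ennreal (10 ^ 15 * (real ?n * log 2 H + real k ^ 3))"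
    proof (rule ennreal_leI)
      have "loop_bound (\<lambda>i. 1 * real (query_cap ?n k i) + 0 * real (round_cap ?n k i) + 0 * (1 / 64 * (1/2) ^ i)) p 0 (2 * ?n + 2) 0
        \<le> (if 0 < i0 then 3 * 2 ^ i0 * K - 2 ^ 0 * K else 2 * 2 ^ 0 * K)"
        unfolding p_def
        by (rule loop_bound_doubling) (use query_cap_le[OF assms(2) n1 assms(4)] K0 in \<open>auto simp: K_def\<close>)
      also have "\<dots> \<le> 3 * 2 ^ i0 * K" using K0 by auto
      also have "\<dots> \<le> 3 * (2 * log 2 H) * K" using i0(2) K0 by (intro mult_right_mono) auto
      \<comment> \<open>The mixed term goes into \<open>k ^ 3\<close>, since \<open>log 2 H\<close>
        is at most \<open>1 + log 2 k\<close>.\<close>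
      also have "\<dots> = 12 * 10 ^ 12 * (real ?n * log 2 H + real k ^ 2 * (log 2 H * (1 + log 2 k)))"
        by (simp add: K_def algebra_simps)
      also have "log 2 H * (1 + log 2 k) \<le> (1 + log 2 k) * (1 + log 2 k)"
        using log2_hardness_le[OF assms(1-3), of v] k0 by (intro mult_right_mono) (auto simp: H_def)
      also have "\<dots> \<le> 9 * k" using log2_square_le[OF assms(2)] by (simp add: power2_eq_square)
      also have "12 * 10 ^ 12 * (real ?n * log 2 H + real k ^ 2 * real (9 * k))
          \<le> 10 ^ 15 * (real ?n * log 2 H + real k ^ 3)"
      proof -
        have "0 \<le> real ?n * log 2 H" using H by simp
        then show ?thesis by (simp add: power_numeral_reduce)
      qed
      finally show "loop_bound (\<lambda>i. 1 * real (query_cap ?n k i) + 0 * real (round_cap ?n k i) + 0 * (1 / 64 * (1/2) ^ i)) p 0 (2 * ?n + 2) 0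
        \<le> 10 ^ 15 * (real ?n * log 2 H + real k ^ 3)" by (simp add: mult_left_mono)
    qed
    finally show "cost_to_go v adv ?P 1 0 0 t [] A \<le> ennreal (10 ^ 15 * (real ?n * log 2 H + real k ^ 3))"
      by simp
  qed

  define L where "L = log_star H (real ?n)"
  note rounds = sum_round_caps[OF n1 H i0(1), folded L_def]
  have L1: "1 \<le> L"
    unfolding L_def by (rule boost_iter_log_star(2)[OF H n1, of "64 + 2 ^ i0"]) (use i0 in auto)
  show "expected_rounds v adv A \<le> ennreal (300 * (max 1 (log 2 (log 2 H)) * real L))"
  proof (rule expected_rounds_le)
    fix t
    have "cost_to_go v adv ?P (ennreal 0) (ennreal 1) (ennreal 0) t [] A
        \<le> ennreal (loop_bound (\<lambda>i. 0 * real (query_cap ?n k i) + 1 * real (round_cap ?n k i) + 0 * (1 / 64 * (1/2) ^ i)) p 0 (2 * ?n + 2) 0)"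
      unfolding A_def by (rule cost) (use pos in auto)
    also have "\<dots> \<le> ennreal (300 * (max 1 (log 2 (log 2 H)) * real L))"
    proof (rule ennreal_leI)
      have "loop_bound (\<lambda>i. 0 * real (query_cap ?n k i) + 1 * real (round_cap ?n k i) + 0 * (1 / 64 * (1/2) ^ i)) p 0 (2 * ?n + 2) 0
        \<le> (\<Sum>j=0..<i0. 0 * real (query_cap ?n k j) + 1 * real (round_cap ?n k j) + 0 * (1 / 64 * (1/2) ^ j)) + 2 * real (4 * L + 5)"
        unfolding p_def
      proof (rule loop_bound_flat)
        fix i assume "i0 \<le> i"
        then have "real (round_cap ?n k i) \<le> real (4 * L + 5)" using rounds(1) by (simp only: of_nat_le_iff)
        then show "0 * real (query_cap ?n k i) + 1 * real (round_cap ?n k i) + 0 * (1 / 64 * (1/2) ^ i) \<le> real (4 * L + 5)"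
          by simp
      qed simp
      also have "(\<Sum>j=0..<i0. 0 * real (query_cap ?n k j) + 1 * real (round_cap ?n k j) + 0 * (1 / 64 * (1/2) ^ j))
          = real (\<Sum>j<i0. round_cap ?n k j)" by (simp add: atLeast0LessThan)
      \<comment> \<open>At most 75 from the early guesses and 18 from the later ones, rounded up to
        100.\<close>
      also have "real (\<Sum>j<i0. round_cap ?n k j) + 2 * real (4 * L + 5) \<le> real ((100 * L) * (i0 + 1))"
      proof -
        have "4 * L + 5 \<le> 9 * L" using L1 by linarith
        then have "2 * (4 * L + 5) * 1 \<le> 18 * L * (i0 + 1)" by (intro mult_mono[of "2 * (4 * L + 5)" "18 * L"]) auto
        moreover have "(4 * L + 71) * (i0 + 1) \<le> 75 * L * (i0 + 1)" using L1 by (intro mult_right_mono) auto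
        ultimately have "(\<Sum>j<i0. round_cap ?n k j) + 2 * (4 * L + 5) \<le> 100 * L * (i0 + 1)"
          using rounds(2)[of k] by (simp add: algebra_simps)
        then have "real ((\<Sum>j<i0. round_cap ?n k j) + 2 * (4 * L + 5)) \<le> real (100 * L * (i0 + 1))"
          by (simp only: of_nat_le_iff)
        then show ?thesis by simp
      qed
      also have "real ((100 * L) * (i0 + 1)) = 100 * real L * (real i0 + 1)" by (simp add: algebra_simps)
      also have "\<dots> \<le> 100 * real L * (3 * max 1 (log 2 (log 2 H)))"
        using i0(3) by (intro mult_left_mono) auto
      finally show "loop_bound (\<lambda>i. 0 * real (query_cap ?n k i) + 1 * real (round_cap ?n k i) + 0 * (1 / 64 * (1/2) ^ i)) p 0 (2 * ?n + 2) 0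
        \<le> 300 * (max 1 (log 2 (log 2 H)) * real L)" by (simp add: mult_ac)
    qed
    finally show "cost_to_go v adv ?P 0 1 0 t [] A \<le> ennreal (300 * (max 1 (log 2 (log 2 H)) * real L))"
      by simp
  qed
qed

lemma top_strategy_brute_force:
  fixes v adv
  assumes "finite X" "1 \<le> k" "k \<le> card X" "card X < 4000 * width (card X) k * root10 (card X)"
  defines "H \<equiv> hardness X v k"
  defines "A \<equiv> to_strategy (brute_force X k (2 * clog (card X) + 2)) (\<lambda>S. return_pmf (Output S))"
  shows "success_prob v adv (is_top X v k) A \<ge> 2 / 3"
    and "expected_queries v adv A \<le> ennreal (10 ^ 17 * (real (card X) * log 2 H + real k ^ 3))"
    and "expected_rounds v adv A
      \<le> ennreal (max 1 (log 2 (log 2 H)) * real (log_star H (real (card X))))"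
proof -
  let ?n = "card X" let ?P = "is_top X v k" let ?u = "2 * clog ?n + 2"
  let ?B = "brute_force X k ?u"
  have n1: "1 \<le> ?n" using assms by linarith
  have H: "2 \<le> H" using hardness_bounds[OF assms(1-3), of v] by (simp add: H_def)
  have cost: "cost_to_go v adv ?P \<alpha> \<beta> \<eta> t h A
      \<le> \<alpha> * of_nat (12 * ?u * ?n ^ 2) + \<beta> * of_nat 1 + \<eta> * ennreal (1 / 4)"
    if "\<eta> = 0 \<or> 1 + 0 \<le> t" for \<alpha> \<beta> \<eta> t h
  proof -
    have "cost_to_go v adv ?P \<alpha> \<beta> \<eta> t h A
        \<le> \<alpha> * of_nat (12 * ?u * ?n ^ 2) + \<beta> * of_nat 1 + wp v adv ?B (\<lambda>S. \<eta> * of_bool (\<not> ?P S))"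
      unfolding A_def
      by (rule cost_to_go_to_strategy[OF safe_brute_force[OF assms(1)] _ that])
        (simp add: cost_to_go_output)
    also have "wp v adv ?B (\<lambda>S. \<eta> * of_bool (\<not> ?P S)) \<le> \<eta> * wp v adv ?B (\<lambda>S. of_bool (\<not> ?P S))"
      by (rule wp_cmult)
    also have "wp v adv ?B (\<lambda>S. of_bool (\<not> ?P S)) \<le> ennreal (real ?n ^ 2 * (1/2) ^ ?u)"
      by (rule wp_brute_force_wrong[OF assms(1,3)])
    also have "\<dots> \<le> ennreal (1 / 4)"
      using half_power_clog[of ?n ?u] by (intro ennreal_leI) (simp add: power2_eq_square)
    finally show ?thesis by (simp add: add_left_mono mult_left_mono)
  qed
  have "success_prob v adv ?P A \<ge> 1 - 1 / 4"
    using cost[of 1 1 0 0 "[]"] by (intro success_prob_ge[where t = 1]) auto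
  then show "success_prob v adv ?P A \<ge> 2 / 3" by simp
  show "expected_queries v adv A \<le> ennreal (10 ^ 17 * (real ?n * log 2 H + real k ^ 3))"
  proof (rule expected_queries_le)
    fix t
    have "cost_to_go v adv ?P 1 0 0 t [] A \<le> of_nat (12 * ?u * ?n ^ 2)"
      using cost[of 0 t 1 0 "[]"] by simp
    also have "\<dots> = ennreal (real (12 * ?u * ?n ^ 2))" by (simp add: ennreal_of_nat_eq_real_of_nat)
    also have "\<dots> \<le> ennreal (10 ^ 17 * (real ?n * log 2 H + real k ^ 3))"
    proof (rule ennreal_leI)
      have "real (12 * ?u * ?n ^ 2) \<le> real (10 ^ 17 * (?n + k ^ 3))"
        using brute_force_cost[OF assms(2) n1 assms(4)] by (simp only: of_nat_le_iff)
      also have "\<dots> = 10 ^ 17 * (real ?n * 1 + real k ^ 3)" by simp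
      also have "\<dots> \<le> 10 ^ 17 * (real ?n * log 2 H + real k ^ 3)"
        using H by (intro mult_left_mono add_mono) auto
      finally show "real (12 * ?u * ?n ^ 2) \<le> 10 ^ 17 * (real ?n * log 2 H + real k ^ 3)" .
    qed
    finally show "cost_to_go v adv ?P 1 0 0 t [] A \<le> ennreal (10 ^ 17 * (real ?n * log 2 H + real k ^ 3))" .
  qed
  show "expected_rounds v adv A \<le> ennreal (max 1 (log 2 (log 2 H)) * real (log_star H (real ?n)))"
  proof (rule expected_rounds_le)
    fix t
    have "cost_to_go v adv ?P 0 1 0 t [] A \<le> ennreal (1 * 1)"
      using cost[of 0 t 0 1 "[]"] by simp
    also have "\<dots> \<le> ennreal (max 1 (log 2 (log 2 H)) * real (log_star H (real ?n)))"
    proof (intro ennreal_leI mult_mono)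
      \<comment> \<open>Some strength above both 64 and \<open>log 2 H\<close> is chosen only to
        obtain \<open>1 \<le> log_star\<close>, so that the single round fits under the
        bound.\<close>
      have "log 2 H \<le> real (64 + nat \<lceil>log 2 H\<rceil>)" by linarith
      then have "1 \<le> log_star H (real ?n)"
        by (intro boost_iter_log_star(2)[OF H n1, of "64 + nat \<lceil>log 2 H\<rceil>"]) auto
      then show "1 \<le> real (log_star H (real ?n))" by simp
    qed auto
    finally show "cost_to_go v adv ?P 0 1 0 t [] A
      \<le> ennreal (max 1 (log 2 (log 2 H)) * real (log_star H (real ?n)))" .
  qed
qed

theorem mainTheorem13:
  "\<exists>(oblivious_top :: nat set \<Rightarrow> nat \<Rightarrow> strategy pmf) (C :: real). C > 0 \<and>
     (\<forall>(X :: nat set) (k :: nat). finite X \<longrightarrow> 1 \<le> k \<longrightarrow> k \<le> card X \<longrightarrow>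
       (\<forall>a \<in> set_pmf (oblivious_top X k). queries_within X a) \<and>
       (\<forall>(v :: nat \<Rightarrow> real) (adv :: adversary).
          success_prob v adv (is_top X v k) (oblivious_top X k) \<ge> 2 / 3 \<and>
          expected_queries v adv (oblivious_top X k)
            \<le> ennreal (C * (real (card X) * log 2 (hardness X v k) + real k ^ 3)) \<and>
          expected_rounds v adv (oblivious_top X k)
            \<le> ennreal (C * (max 1 (log 2 (log 2 (hardness X v k)))
                            * real (log_star (hardness X v k) (real (card X)))))))"
\<comment> \<open>The brute-force branch dictates \<open>10 ^ 17\<close>; the guessing branch has
  \<open>10 ^ 15\<close> for queries and 300 for rounds.\<close>
proof (intro exI[of _ top_strategy] exI[of _ "10 ^ 17"] conjI allI impI)
  fix X :: "nat set" and k :: nat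
  assume X: "finite X" "1 \<le> k" "k \<le> card X"
  let ?n = "card X"
  let ?B = "to_strategy (brute_force X k (2 * clog ?n + 2)) (\<lambda>S. return_pmf (Output S))"
  let ?G = "guess_loop (guess_at X k) (2 * ?n + 2) 0"
  have cases: "(?n < 4000 * width ?n k * root10 ?n \<and> top_strategy X k = ?B)
      \<or> (4000 * width ?n k * root10 ?n \<le> ?n \<and> top_strategy X k = ?G)"
    by (auto simp: top_strategy_def Let_def)
  show "\<forall>a \<in> set_pmf (top_strategy X k). queries_within X a"
    using cases
  proof (elim disjE conjE)
    assume "top_strategy X k = ?B"
    then show ?thesis
      using queries_within_to_strategy[OF safe_brute_force[OF X(1)], where f = "\<lambda>S. return_pmf (Output S)"]
      by (auto intro: queries_within.intros)
  next
    assume "4000 * width ?n k * root10 ?n \<le> ?n" "top_strategy X k = ?G"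
    then show ?thesis
      using queries_within_guess_loop[where G = "guess_at X k", OF safe_guess_at[OF X]] by metis
  qed
  fix v :: "nat \<Rightarrow> real" and adv :: adversary
  let ?H = "hardness X v k"
  have H: "2 \<le> ?H" by (rule hardness_bounds(1)[OF X])
  show "success_prob v adv (is_top X v k) (top_strategy X k) \<ge> 2 / 3"
    using cases top_strategy_brute_force(1)[OF X] top_strategy_guessing(1)[OF X] by auto
  have "0 \<le> real ?n * log 2 ?H + real k ^ 3" using H by simp
  then have "ennreal (10 ^ 15 * (real ?n * log 2 ?H + real k ^ 3))
      \<le> ennreal (10 ^ 17 * (real ?n * log 2 ?H + real k ^ 3))"
    by (intro ennreal_leI mult_right_mono) auto
  then show "expected_queries v adv (top_strategy X k)
      \<le> ennreal (10 ^ 17 * (real ?n * log 2 ?H + real k ^ 3))"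
    using cases top_strategy_brute_force(2)[OF X, of v adv] top_strategy_guessing(2)[OF X, of v adv]
    by (auto intro: order_trans)
  have "ennreal (c * (max 1 (log 2 (log 2 ?H)) * real (log_star ?H (real ?n))))
      \<le> ennreal (10 ^ 17 * (max 1 (log 2 (log 2 ?H)) * real (log_star ?H (real ?n))))"
    if "c \<le> 10 ^ 17" for c
    using that by (intro ennreal_leI mult_right_mono) auto
  from this[of 1] this[of 300] show "expected_rounds v adv (top_strategy X k)
      \<le> ennreal (10 ^ 17 * (max 1 (log 2 (log 2 ?H)) * real (log_star ?H (real ?n))))"
    using cases top_strategy_brute_force(3)[OF X, of v adv] top_strategy_guessing(3)[OF X, of v adv]
    by (auto intro: order_trans)
qed simp

end
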